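(* Let $\mathcal X,\mathcal S_1,\mathcal S_2,\hat{\mathcal X}$ be finite alphabets, let $(X_i,S_{1,i},S_{2,i})$ be i.i.d. $\sim p(x,s_1,s_2)$, let $d:\mathcal X\times\hat{\mathcal X}\to[0,\infty)$ be a distortion measure, $D$ a distortion level and $R_1',R_2'\ge0$. Consider the source coding problem in which the encoder knows $X^n$, $S_1^n$ and a rate-$R_2'$ description of $S_2^n$, and the decoder knows $S_2^n$ and a rate-$R_1'$ description of $S_1^n$, and let $R_{12}^*(D)$ be its rate-distortion function. Then $$R_{12}^*(D)\ \le\ \min\; I(U;X,S_1|V_1,V_2)-I(U;S_2|V_1,V_2),$$ where the minimum is over all $p(v_1|s_1)\,p(v_2|s_2)\,p(u|x,s_1,v_1,v_2)\,p(\hat x|u,s_2,v_1,v_2)$ such that $$R_1'\ge I(V_1;S_1)-I(V_1;S_2,V_2),\qquad R_2'\ge I(V_2;S_2)-I(V_2;X,S_1,V_1),\qquad \mathbb E[d(X,\hat X)]\le D,$$ $U,V_1,V_2$ being auxiliary random variables with finite alphabets and the joint law of $(X,S_1,S_2,V_1,V_2,U,\hat X)$ being the product of $p(x,s_1,s_2)$ and the listed conditional distributions.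
   Context: Notation: $x^n=(x_1,\dots,x_n)$; $I(\cdot;\cdot)$ is mutual information (logarithms to base 2). An $(n,2^{nR},2^{nR_1'},2^{nR_2'},D)$ code consists of three encoding maps $f_{v1}:\mathcal S_1^n\to\{1,\dots,2^{nR_1'}\}$, $f_{v2}:\mathcal S_2^n\to\{1,\dots,2^{nR_2'}\}$, $f:\mathcal X^n\times\mathcal S_1^n\times\{1,\dots,2^{nR_2'}\}\to\{1,\dots,2^{nR}\}$ and a decoding map $g:\{1,\dots,2^{nR}\}\times\mathcal S_2^n\times\{1,\dots,2^{nR_1'}\}\to\hat{\mathcal X}^n$, such that $\hat X^n=g\big(f(X^n,S_1^n,f_{v2}(S_2^n)),S_2^n,f_{v1}(S_1^n)\big)$ satisfies $\mathbb E[\frac1n\sum_{i=1}^nd(X_i,\hat X_i)]\le D$. For given $D$, $(R,R_1',R_2')$ is achievable if for every $\epsilon>0$ there exists (for some $n$) an $(n,2^{nR},2^{nR_1'},2^{nR_2'},D+\epsilon)$ code; $R_{12}^*(D)$ is the infimum of all $R$ such that $(R,R_1',R_2')$ is achievable. *)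

theory Defs
  imports "HOL-Probability.Probability"
begin

text \<open>
  Words of length \<open>n\<close> are lists of length \<open>n\<close>. The index set \<open>{1, ..., 2^(nR)}\<close> is the set of
  positive integers not exceeding the real number \<open>2^(nR)\<close>, which need not be an integer.
\<close>

definition words :: "nat \<Rightarrow> 'a list set" where
  "words n = {xs. length xs = n}"

definition messages :: "nat \<Rightarrow> real \<Rightarrow> nat set" where
  "messages n R = {m. 1 \<le> m \<and> real m \<le> 2 powr (real n * R)}"

definition avg_distortion :: "('x \<Rightarrow> 'y \<Rightarrow> real) \<Rightarrow> nat \<Rightarrow> 'x list \<Rightarrow> 'y list \<Rightarrow> real" where
  "avg_distortion d n xs ys = (1 / real n) * (\<Sum>i<n. d (xs ! i) (ys ! i))"

text \<open>
  The source block \<open>(X\<^sub>i, S\<^sub>1\<^sub>,\<^sub>i, S\<^sub>2\<^sub>,\<^sub>i)\<close>, \<open>i < n\<close>, is distributed as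
  \<^term>\<open>replicate_pmf n p\<close>, the law of \<open>n\<close> independent draws from \<open>p\<close>.
\<close>

definition is_code ::
  "('x \<times> 's1 \<times> 's2) pmf \<Rightarrow> ('x \<Rightarrow> 'y \<Rightarrow> real) \<Rightarrow> nat \<Rightarrow> real \<Rightarrow> real \<Rightarrow> real \<Rightarrow> real \<Rightarrow>
   ('s1 list \<Rightarrow> nat) \<Rightarrow> ('s2 list \<Rightarrow> nat) \<Rightarrow> ('x list \<times> 's1 list \<times> nat \<Rightarrow> nat) \<Rightarrow>
   (nat \<times> 's2 list \<times> nat \<Rightarrow> 'y list) \<Rightarrow> bool" where
  "is_code p d n R R1' R2' D fv1 fv2 f g \<longleftrightarrow>
     fv1 \<in> words n \<rightarrow> messages n R1' \<and>
     fv2 \<in> words n \<rightarrow> messages n R2' \<and>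
     f \<in> words n \<times> words n \<times> messages n R2' \<rightarrow> messages n R \<and>
     g \<in> messages n R \<times> words n \<times> messages n R1' \<rightarrow> words n \<and>
     measure_pmf.expectation (replicate_pmf n p)
       (\<lambda>z. let xs = map (\<lambda>(x, s1, s2). x) z;
                s1s = map (\<lambda>(x, s1, s2). s1) z;
                s2s = map (\<lambda>(x, s1, s2). s2) z
             in avg_distortion d n xs (g (f (xs, s1s, fv2 s2s), s2s, fv1 s1s))) \<le> D"

text \<open>The block length must be positive: for \<open>n = 0\<close> the average distortion degenerates to \<open>0\<close>.\<close>

definition achievable ::
  "('x \<times> 's1 \<times> 's2) pmf \<Rightarrow> ('x \<Rightarrow> 'y \<Rightarrow> real) \<Rightarrow> real \<Rightarrow> real \<Rightarrow> real \<Rightarrow> real \<Rightarrow> bool" where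
  "achievable p d D R R1' R2' \<longleftrightarrow>
     (\<forall>\<epsilon>>0. \<exists>n\<ge>1. \<exists>fv1 fv2 f g. is_code p d n R R1' R2' (D + \<epsilon>) fv1 fv2 f g)"

text \<open>Extended reals: the infimum is \<open>\<infinity>\<close> if no rate is achievable at distortion level \<open>D\<close>.\<close>

definition R12_star ::
  "('x \<times> 's1 \<times> 's2) pmf \<Rightarrow> ('x \<Rightarrow> 'y \<Rightarrow> real) \<Rightarrow> real \<Rightarrow> real \<Rightarrow> real \<Rightarrow> ereal" where
  "R12_star p d R1' R2' D = Inf {ereal R | R. achievable p d D R R1' R2'}"

text \<open>
  These are the library's \<open>\<I>(A ; B)\<close> and \<open>\<I>(A ; B | C)\<close> to base 2, for random variables on the
  probability space \<open>q\<close>.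
\<close>

definition mutual_info :: "'z pmf \<Rightarrow> ('z \<Rightarrow> 'a) \<Rightarrow> ('z \<Rightarrow> 'b) \<Rightarrow> real" where
  "mutual_info q A B =
     prob_space.mutual_information (measure_pmf q) 2
       (count_space (range A)) (count_space (range B)) A B"

definition cond_mutual_info ::
  "'z pmf \<Rightarrow> ('z \<Rightarrow> 'a) \<Rightarrow> ('z \<Rightarrow> 'b) \<Rightarrow> ('z \<Rightarrow> 'c) \<Rightarrow> real" where
  "cond_mutual_info q A B C =
     prob_space.conditional_mutual_information (measure_pmf q) 2
       (count_space (range A)) (count_space (range B)) (count_space (range C)) A B C"

text \<open>Sample points are tuples \<open>(x, s\<^sub>1, s\<^sub>2, v\<^sub>1, v\<^sub>2, u, y)\<close>, where \<open>y\<close> is the reconstruction symbol.\<close>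

type_synonym ('x, 's1, 's2, 'v1, 'v2, 'u, 'y) outcome =
  "'x \<times> 's1 \<times> 's2 \<times> 'v1 \<times> 'v2 \<times> 'u \<times> 'y"

definition rv_X :: "('x, 's1, 's2, 'v1, 'v2, 'u, 'y) outcome \<Rightarrow> 'x" where
  "rv_X = (\<lambda>(x, s1, s2, v1, v2, u, y). x)"
definition rv_S1 :: "('x, 's1, 's2, 'v1, 'v2, 'u, 'y) outcome \<Rightarrow> 's1" where
  "rv_S1 = (\<lambda>(x, s1, s2, v1, v2, u, y). s1)"
definition rv_S2 :: "('x, 's1, 's2, 'v1, 'v2, 'u, 'y) outcome \<Rightarrow> 's2" where
  "rv_S2 = (\<lambda>(x, s1, s2, v1, v2, u, y). s2)"
definition rv_V1 :: "('x, 's1, 's2, 'v1, 'v2, 'u, 'y) outcome \<Rightarrow> 'v1" where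
  "rv_V1 = (\<lambda>(x, s1, s2, v1, v2, u, y). v1)"
definition rv_V2 :: "('x, 's1, 's2, 'v1, 'v2, 'u, 'y) outcome \<Rightarrow> 'v2" where
  "rv_V2 = (\<lambda>(x, s1, s2, v1, v2, u, y). v2)"
definition rv_U :: "('x, 's1, 's2, 'v1, 'v2, 'u, 'y) outcome \<Rightarrow> 'u" where
  "rv_U = (\<lambda>(x, s1, s2, v1, v2, u, y). u)"
definition rv_Y :: "('x, 's1, 's2, 'v1, 'v2, 'u, 'y) outcome \<Rightarrow> 'y" where
  "rv_Y = (\<lambda>(x, s1, s2, v1, v2, u, y). y)"

definition joint_law ::
  "('x \<times> 's1 \<times> 's2) pmf \<Rightarrow> ('s1 \<Rightarrow> 'v1 pmf) \<Rightarrow> ('s2 \<Rightarrow> 'v2 pmf) \<Rightarrow>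
   ('x \<Rightarrow> 's1 \<Rightarrow> 'v1 \<Rightarrow> 'v2 \<Rightarrow> 'u pmf) \<Rightarrow> ('u \<Rightarrow> 's2 \<Rightarrow> 'v1 \<Rightarrow> 'v2 \<Rightarrow> 'y pmf) \<Rightarrow>
   ('x, 's1, 's2, 'v1, 'v2, 'u, 'y) outcome pmf" where
  "joint_law p pv1 pv2 pu py =
     do {
       (x, s1, s2) \<leftarrow> p;
       v1 \<leftarrow> pv1 s1;
       v2 \<leftarrow> pv2 s2;
       u \<leftarrow> pu x s1 v1 v2;
       y \<leftarrow> py u s2 v1 v2;
       return_pmf (x, s1, s2, v1, v2, u, y)
     }"

definition admissible_laws ::
  "('x::finite \<times> 's1::finite \<times> 's2::finite) pmf \<Rightarrow> ('x \<Rightarrow> 'y::finite \<Rightarrow> real) \<Rightarrow>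
   real \<Rightarrow> real \<Rightarrow> real \<Rightarrow>
   ('x, 's1, 's2, 'v1::finite, 'v2::finite, 'u::finite, 'y) outcome pmf set" where
  "admissible_laws p d R1' R2' D =
     {q. (\<exists>pv1 pv2 pu py. q = joint_law p pv1 pv2 pu py) \<and>
         R1' \<ge> mutual_info q rv_V1 rv_S1 - mutual_info q rv_V1 (\<lambda>z. (rv_S2 z, rv_V2 z)) \<and>
         R2' \<ge> mutual_info q rv_V2 rv_S2 - mutual_info q rv_V2 (\<lambda>z. (rv_X z, rv_S1 z, rv_V1 z)) \<and>
         measure_pmf.expectation q (\<lambda>z. d (rv_X z) (rv_Y z)) \<le> D}"

definition rate_of :: "('x, 's1, 's2, 'v1, 'v2, 'u, 'y) outcome pmf \<Rightarrow> real" where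
  "rate_of q =
     cond_mutual_info q rv_U (\<lambda>z. (rv_X z, rv_S1 z)) (\<lambda>z. (rv_V1 z, rv_V2 z)) -
     cond_mutual_info q rv_U rv_S2 (\<lambda>z. (rv_V1 z, rv_V2 z))"

end

theory Submission
  imports Defs
begin

text \<open>
  Output statistics of random binning. Each of \<open>V\<^sub>1\<close>, \<open>V\<^sub>2\<close>, \<open>U\<close> is a word drawn from a memoryless
  channel \<open>W\<close> whose input block \<open>a\<close> one party knows and which must be conveyed to a party holding
  a correlated block \<open>b\<close>. Hash the word at random to a pair \<open>(f, j)\<close>. At rates of \<open>f\<close> below
  \<open>H(V | A)\<close> the index \<open>f\<close> is nearly uniform and independent of \<open>a\<close>, so it can be drawn beforehand
  as shared randomness and the word be sampled from \<open>W(a)\<close> conditioned on \<open>f\<close>. Once the rates of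
  \<open>f\<close> and \<open>j\<close> add up to more than \<open>H(V | B)\<close>, the pair and \<open>b\<close> determine the word, so only \<open>j\<close> is
  sent, at any rate above \<open>H(V | B) - H(V | A) = I(V; A) - I(V; B)\<close>. Since the simulated words have
  nearly the exact i.i.d. law, the three simulations compose without typicality arguments, and
  a deterministic choice of all randomness is at least as good as the average.

  The rate constraints are not strict. A tight positive rate is relaxed by coding only a fraction
  \<open>1 / (1 + \<delta>)\<close> of the block. If the rate is \<open>0\<close>, equality in Gibbs' inequality makes \<open>W(a)\<close> a
  function of \<open>b\<close>, and both parties read the word off a shared random function.
\<close>

section \<open>Conditional entropies\<close>

text \<open>The two descriptions seem to depend on each other in a circle: V1 is decoded with the
  help of V2, and V2 with the help of V1. There is no circle because V1 is selected from S1 alone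
  and V2 from S2 alone. Each party thus owns one word exactly and uses it as side information for
  decoding the other. Only U needs both words at both ends; there the encoder works with a decoded
  V2 and the decoder with a decoded V1.

  The second obstacle is that the decoding estimate for one word takes the other word to have its
  exact law, whereas that word is simulated too. Every estimate is therefore an upper bound for
  arbitrary functions with values in [0, 1]. Error probabilities and normalised distortions are such
  functions, so a simulated word may be exchanged for an exact one inside any of them at a fixed
  price. Upper bounds suffice throughout, which keeps everything in nonnegative integrals, where the
  order of integration may be changed freely.\<close>

definition posterior :: "'z pmf \<Rightarrow> ('z \<Rightarrow> 'v) \<Rightarrow> ('z \<Rightarrow> 'b) \<Rightarrow> 'v \<Rightarrow> 'b \<Rightarrow> real" where
  "posterior q V B v b =
     measure_pmf.prob q {z. V z = v \<and> B z = b} / measure_pmf.prob q {z. B z = b}"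

text \<open>Written as the mean of a single random variable, so that the weak law applies directly
  to its block version.\<close>

definition cond_ent :: "'z pmf \<Rightarrow> ('z \<Rightarrow> 'v) \<Rightarrow> ('z \<Rightarrow> 'b) \<Rightarrow> real" where
  "cond_ent q V B = measure_pmf.expectation q (\<lambda>z. - log 2 (posterior q V B (V z) (B z)))"

lemma posterior_map_pmf: "posterior (map_pmf f q) V B = posterior q (V \<circ> f) (B \<circ> f)"
  by (simp add: posterior_def fun_eq_iff vimage_def)

lemma cond_ent_map_pmf: "cond_ent (map_pmf f q) V B = cond_ent q (V \<circ> f) (B \<circ> f)"
  by (simp add: cond_ent_def posterior_map_pmf)

lemma posterior_pos: "z \<in> set_pmf q \<Longrightarrow> 0 < posterior q V B (V z) (B z)"
  unfolding posterior_def by (intro divide_pos_pos measure_pmf_posI) auto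

lemma posterior_nonneg: "0 \<le> posterior q V B v b"
  by (simp add: posterior_def)

text \<open>Only an inequality, even over the whole alphabet: if \<open>b\<close> has probability 0,
  division by zero makes every posterior 0. Sub-probability is enough both for Gibbs' inequality and
  for counting decoding candidates.\<close>

lemma sum_posterior_le_1:
  assumes "finite A" shows "(\<Sum>v\<in>A. posterior q V B v b) \<le> 1"
proof -
  have "(\<Sum>v\<in>A. measure_pmf.prob q {z. V z = v \<and> B z = b})
      = measure_pmf.prob q (\<Union>v\<in>A. {z. V z = v \<and> B z = b})"
    using assms by (intro measure_pmf.finite_measure_finite_Union[symmetric])
      (auto simp: disjoint_family_on_def)
  also have "\<dots> \<le> measure_pmf.prob q {z. B z = b}"
    by (intro measure_pmf.finite_measure_mono) auto
  finally show ?thesis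
    unfolding posterior_def sum_divide_distrib[symmetric]
    by (cases "measure_pmf.prob q {z. B z = b} = 0") (simp_all add: divide_le_eq_1 zero_less_measure_iff)
qed

lemma sum_image_pmf:
  fixes q :: "'z::finite pmf" and g :: "'a \<Rightarrow> real"
  shows "(\<Sum>y\<in>range f. measure_pmf.prob q (f -` {y}) * g y) = measure_pmf.expectation q (\<lambda>z. g (f z))"
proof -
  have "measure_pmf.expectation (map_pmf f q) g = (\<Sum>y\<in>range f. pmf (map_pmf f q) y *\<^sub>R g y)"
    by (intro integral_measure_pmf) auto
  then show ?thesis by (simp add: pmf_map)
qed

lemma mutual_info_eq:
  fixes q :: "'z::finite pmf"
  shows "mutual_info q A B = measure_pmf.expectation q
    (\<lambda>z. log 2 (measure_pmf.prob q {w. A w = A z \<and> B w = B z} /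
       (measure_pmf.prob q {w. A w = A z} * measure_pmf.prob q {w. B w = B z})))"
proof -
  interpret information_space "measure_pmf q" 2 by unfold_locales simp
  have sf: "simple_function (measure_pmf q) f" for f :: "'z \<Rightarrow> 'k"
    by (simp add: simple_function_def)
  have sd: "simple_distributed (measure_pmf q) f (\<lambda>x. measure_pmf.prob q (f -` {x}))" for f :: "'z \<Rightarrow> 'k"
    by (rule measure_pmf.simple_distributedI[OF sf]) auto
  have "mutual_info q A B = (\<Sum>y\<in>range (\<lambda>z. (A z, B z)). measure_pmf.prob q ((\<lambda>z. (A z, B z)) -` {y}) *
     (case y of (a, b) \<Rightarrow> log 2 (measure_pmf.prob q ((\<lambda>z. (A z, B z)) -` {(a,b)}) /
        (measure_pmf.prob q (A -` {a}) * measure_pmf.prob q (B -` {b})))))"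
    unfolding mutual_info_def
    using mutual_information_simple_distributed[OF sd[of A] sd[of B] sd[of "\<lambda>z. (A z, B z)"]]
    by (simp add: case_prod_beta)
  then show ?thesis
    unfolding sum_image_pmf by (simp add: vimage_def)
qed

lemma cond_mutual_info_eq:
  fixes q :: "'z::finite pmf"
  shows "cond_mutual_info q A B C = measure_pmf.expectation q
    (\<lambda>z. log 2 (measure_pmf.prob q {w. A w = A z \<and> B w = B z \<and> C w = C z} /
       (measure_pmf.prob q {w. A w = A z \<and> C w = C z} *
         (measure_pmf.prob q {w. B w = B z \<and> C w = C z} / measure_pmf.prob q {w. C w = C z}))))"
proof -
  interpret information_space "measure_pmf q" 2 by unfold_locales simp
  have sf: "simple_function (measure_pmf q) f" for f :: "'z \<Rightarrow> 'k"
    by (simp add: simple_function_def)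
  have sd: "simple_distributed (measure_pmf q) f (\<lambda>x. measure_pmf.prob q (f -` {x}))" for f :: "'z \<Rightarrow> 'k"
    by (rule measure_pmf.simple_distributedI[OF sf]) auto
  have "cond_mutual_info q A B C = (\<Sum>y\<in>range (\<lambda>z. (A z, B z, C z)). measure_pmf.prob q ((\<lambda>z. (A z, B z, C z)) -` {y}) *
     (case y of (a, b, c) \<Rightarrow> log 2 (measure_pmf.prob q ((\<lambda>z. (A z, B z, C z)) -` {(a,b,c)}) /
        (measure_pmf.prob q ((\<lambda>z. (A z, C z)) -` {(a,c)}) *
          (measure_pmf.prob q ((\<lambda>z. (B z, C z)) -` {(b,c)}) / measure_pmf.prob q (C -` {c}))))))"
    unfolding cond_mutual_info_def
    using conditional_mutual_information_eq[OF sd[of C] sd[of "\<lambda>z. (B z, C z)"]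
       sd[of "\<lambda>z. (A z, C z)"] sd[of "\<lambda>z. (A z, B z, C z)"]]
    by (simp add: case_prod_beta)
  then show ?thesis
    unfolding sum_image_pmf by (simp add: vimage_def)
qed

lemma integrable_finite_type_pmf [simp]:
  fixes q :: "'z::finite pmf" and f :: "'z \<Rightarrow> real"
  shows "integrable (measure_pmf q) f"
  by (rule integrable_measure_pmf_finite) simp

lemma expectation_cong_set_pmf:
  assumes "\<And>z. z \<in> set_pmf q \<Longrightarrow> f z = (g z :: real)"
  shows "measure_pmf.expectation q f = measure_pmf.expectation q g"
  by (rule integral_cong_AE) (auto simp: AE_measure_pmf_iff assms)


lemma log_divide_mult:
  fixes a b c :: real
  assumes "0 < a" "0 < b" "0 < c"
  shows "log 2 (a / (b * c)) = log 2 (a / c) - log 2 b"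
  using assms by (simp add: log_divide log_mult)
lemma log_divide_mult_divide:
  fixes a b c :: real
  assumes "0 < a" "0 < b" "0 < c" "0 < e"
  shows "log 2 (a / (b * (c / e))) = log 2 (a / c) - log 2 (b/e)"
  using assms by (simp add: log_divide log_mult)

text \<open>Both information densities are a log-posterior minus the same term log P(V), which
  cancels. In the conditional version below the common term is the log-posterior of V given
  C.\<close>

lemma mutual_info_diff:
  fixes q :: "'z::finite pmf"
  shows "mutual_info q V A - mutual_info q V B = cond_ent q V B - cond_ent q V A"
proof -
  have "mutual_info q V A = measure_pmf.expectation q
      (\<lambda>z. log 2 (posterior q V A (V z) (A z)) - log 2 (measure_pmf.prob q {w. V w = V z}))" for A :: "'z \<Rightarrow> 'k"
    unfolding mutual_info_eq posterior_def
    by (intro expectation_cong_set_pmf log_divide_mult measure_pmf_posI) auto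
  note this[of A] this[of B]
  then show ?thesis by (simp add: cond_ent_def)
qed

lemma cond_mutual_info_diff:
  fixes q :: "'z::finite pmf"
  shows "cond_mutual_info q V A C - cond_mutual_info q V B C
    = cond_ent q V (\<lambda>z. (B z, C z)) - cond_ent q V (\<lambda>z. (A z, C z))"
proof -
  have "cond_mutual_info q V A C = measure_pmf.expectation q
      (\<lambda>z. log 2 (posterior q V (\<lambda>z. (A z, C z)) (V z) (A z, C z)) - log 2 (posterior q V C (V z) (C z)))"
    for A :: "'z \<Rightarrow> 'k"
    unfolding cond_mutual_info_eq posterior_def prod.inject
    by (intro expectation_cong_set_pmf log_divide_mult_divide measure_pmf_posI) auto
  note this[of A] this[of B]
  then show ?thesis by (simp add: cond_ent_def)
qed

section \<open>Random hashing\<close>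

text \<open>The hash estimates below are second-moment and union bounds, so they use the
  independence of two hash values only.\<close>

lemma map_Pi_pmf_pair:
  assumes "finite A" "v \<in> A" "v' \<in> A" "v \<noteq> v'"
  shows "map_pmf (\<lambda>G. (G v, G v')) (Pi_pmf A dflt p) = pair_pmf (p v) (p v')"
proof -
  have "A = insert v (A - {v})" using assms by auto
  then have "map_pmf (\<lambda>G. (G v, G v')) (Pi_pmf A dflt p) =
      map_pmf (\<lambda>G. (G v, G v')) (Pi_pmf (insert v (A - {v})) dflt p)" by simp
  also have "\<dots> = map_pmf (\<lambda>(y, f). (y, f v')) (pair_pmf (p v) (Pi_pmf (A - {v}) dflt p))"
    using assms by (subst Pi_pmf_insert) (auto simp: pmf.map_comp o_def case_prod_unfold)
  also have "\<dots> = pair_pmf (p v) (map_pmf (\<lambda>f. f v') (Pi_pmf (A - {v}) dflt p))"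
    by (simp add: pair_map_pmf2 apsnd_def map_prod_def case_prod_unfold)
  also have "map_pmf (\<lambda>f. f v') (Pi_pmf (A - {v}) dflt p) = p v'"
    using assms by (subst Pi_pmf_component) auto
  finally show ?thesis .
qed

lemma expectation_of_bool:
  "measure_pmf.expectation p (\<lambda>z. of_bool (Q z)) = measure_pmf.prob p {z. Q z}"
proof -
  have "(\<lambda>z. of_bool (Q z) :: real) = indicator {z. Q z}" by (auto simp: indicator_def)
  then show ?thesis by simp
qed

lemma prob_eq_sum:
  assumes "finite B" "set_pmf w \<subseteq> B"
  shows "measure_pmf.prob w {v. Q v} = (\<Sum>v\<in>B. pmf w v * of_bool (Q v))"
  using integral_measure_pmf[of B w "\<lambda>v. of_bool (Q v) :: real"] assms
  by (auto simp: expectation_of_bool)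

text \<open>A form of the leftover hash lemma for one fixed bin \<open>f\<close>. The atoms of
  \<open>w\<close> of weight at most \<theta> give a bin mass whose variance is at most \<theta> (M
  - 1) / M^2, since pairwise independence removes the cross terms. Heavy atoms can only add to the
  bin, so for the shortfall below 1 / M they cost no more than their share of the mean. The factor M
  - 1 instead of M makes the variance term vanish for a single bin.\<close>

lemma hash_deviation:
  fixes H :: "'h pmf" and F :: "'h \<Rightarrow> 'v \<Rightarrow> 'c" and w :: "'v pmf" and M :: nat
  assumes fin: "finite (set_pmf H)" "finite B" and wB: "set_pmf w \<subseteq> B" and M: "0 < M" and \<theta>: "0 \<le> \<theta>"
    and uniform: "\<And>v. v \<in> B \<Longrightarrow> measure_pmf.prob H {G. F G v = f} = 1 / M"
    and pairwise: "\<And>v v'. v \<in> B \<Longrightarrow> v' \<in> B \<Longrightarrow> v \<noteq> v' \<Longrightarrow>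
       measure_pmf.prob H {G. F G v = f \<and> F G v' = f} = 1 / (real M)\<^sup>2"
  shows "measure_pmf.expectation H (\<lambda>G. max 0 (1 / M - measure_pmf.prob w {v. F G v = f}))
     \<le> (sqrt (real (M - 1) * \<theta>) + measure_pmf.prob w {v. pmf w v > \<theta>}) / M"
proof -
  \<comment> \<open>\<open>g\<close> is \<open>w\<close> with the heavy atoms removed, and
    \<open>Y\<close> is the centred mass that \<open>g\<close> puts into the bin.\<close>
  define g where "g v = (if pmf w v \<le> \<theta> then pmf w v else 0)" for v
  define e where "e v G = (of_bool (F G v = f) :: real)" for v G
  define Y where "Y G = (\<Sum>v\<in>B. g v * (e v G - 1 / M))" for G
  have int[simp]: "integrable (measure_pmf H) h" for h :: "'h \<Rightarrow> real"
    using fin(1) by (rule integrable_measure_pmf_finite)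
  have g0: "0 \<le> g v" "g v \<le> \<theta>" "g v \<le> pmf w v" for v using \<theta> by (auto simp: g_def)
  have Ee: "measure_pmf.expectation H (e v) = 1 / M" if "v \<in> B" for v
    using uniform[OF that] by (simp add: e_def[abs_def] expectation_of_bool)
  have Eee: "measure_pmf.expectation H (\<lambda>G. e v G * e v' G) = (if v = v' then 1 / M else 1 / (real M)\<^sup>2)"
    if "v \<in> B" "v' \<in> B" for v v'
    using uniform[OF that(1)] pairwise[OF that]
    unfolding e_def of_bool_conj[symmetric] expectation_of_bool by (cases "v = v'") auto
  have total: "(\<Sum>v\<in>B. pmf w v) = 1"
    using sum_pmf_eq_1[of B w] fin wB by auto
  have tail: "1 - (\<Sum>v\<in>B. g v) = measure_pmf.prob w {v. pmf w v > \<theta>}"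
    unfolding prob_eq_sum[OF fin(2) wB] total[symmetric] sum_subtractf[symmetric] g_def
    by (intro sum.cong) auto
  have EY2: "measure_pmf.expectation H (\<lambda>G. (Y G)\<^sup>2) \<le> \<theta> * (real M - 1) / (real M)\<^sup>2"
  proof -
    have "measure_pmf.expectation H (\<lambda>G. (Y G)\<^sup>2) = (\<Sum>v\<in>B. \<Sum>v'\<in>B. g v * g v' *
        measure_pmf.expectation H (\<lambda>G. (e v G - 1 / M) * (e v' G - 1 / M)))"
    proof -
      have Y2: "(Y G)\<^sup>2 = (\<Sum>v\<in>B. \<Sum>v'\<in>B. (g v * g v') * ((e v G - 1 / M) * (e v' G - 1 / M)))" for G
        unfolding Y_def power2_eq_square sum_product by (intro sum.cong refl) simp
      show ?thesis unfolding Y2 by simp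
    qed
    also have "\<dots> = (\<Sum>v\<in>B. \<Sum>v'\<in>B. if v = v' then (g v)\<^sup>2 * (1 / M - 1 / (real M)\<^sup>2) else 0)"
    proof (intro sum.cong refl)
      fix v v' assume v: "v \<in> B" "v' \<in> B"
      have "measure_pmf.expectation H (\<lambda>G. (e v G - 1 / M) * (e v' G - 1 / M))
        = measure_pmf.expectation H (\<lambda>G. e v G * e v' G) - (1 / M) * measure_pmf.expectation H (e v)
           - (1 / M) * measure_pmf.expectation H (e v') + 1 / (real M)\<^sup>2"
        by (simp add: algebra_simps power2_eq_square)
      then show "g v * g v' * measure_pmf.expectation H (\<lambda>G. (e v G - 1 / M) * (e v' G - 1 / M)) =
         (if v = v' then (g v)\<^sup>2 * (1 / M - 1 / (real M)\<^sup>2) else 0)"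
        using v by (simp add: Ee Eee power2_eq_square)
    qed
    also have "\<dots> = (\<Sum>v\<in>B. (g v)\<^sup>2) * ((real M - 1) / (real M)\<^sup>2)"
      using fin M by (simp add: sum_distrib_right diff_divide_distrib power2_eq_square)
    also have "\<dots> \<le> \<theta> * ((real M - 1) / (real M)\<^sup>2)"
    proof (rule mult_right_mono)
      have "(\<Sum>v\<in>B. (g v)\<^sup>2) \<le> (\<Sum>v\<in>B. \<theta> * pmf w v)"
        unfolding power2_eq_square using g0 \<theta> by (intro sum_mono mult_mono) auto
      also have "\<dots> = \<theta>" by (simp add: total flip: sum_distrib_left)
      finally show "(\<Sum>v\<in>B. (g v)\<^sup>2) \<le> \<theta>" .
    qed (use M in auto)
    finally show ?thesis by simp
  qed
  \<comment> \<open>Jensen's inequality, read off from the nonnegative variance of |Y|.\<close>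
  have "(measure_pmf.expectation H (\<lambda>G. \<bar>Y G\<bar>))\<^sup>2 \<le> measure_pmf.expectation H (\<lambda>G. (Y G)\<^sup>2)"
    using measure_pmf.variance_positive[of H "\<lambda>G. \<bar>Y G\<bar>"] measure_pmf.variance_eq[of H "\<lambda>G. \<bar>Y G\<bar>"]
    by simp
  then have "measure_pmf.expectation H (\<lambda>G. \<bar>Y G\<bar>) \<le> sqrt (\<theta> * (real M - 1) / (real M)\<^sup>2)"
    using EY2 by (intro real_le_rsqrt) linarith
  then have EY: "measure_pmf.expectation H (\<lambda>G. \<bar>Y G\<bar>) \<le> sqrt (real (M - 1) * \<theta>) / M"
    using M by (simp add: real_sqrt_divide of_nat_diff mult.commute)
  \<comment> \<open>Replacing \<open>w\<close> by \<open>g\<close> lowers the mass of the bin and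
    hence raises the shortfall; the mean 1 / M drops by the heavy mass divided by M.\<close>
  have "max 0 (1 / M - measure_pmf.prob w {v. F G v = f}) \<le> \<bar>Y G\<bar> + (1 - (\<Sum>v\<in>B. g v)) / M" for G
  proof -
    have "(\<Sum>v\<in>B. g v * e v G) \<le> (\<Sum>v\<in>B. pmf w v * e v G)"
      using g0 by (intro sum_mono mult_right_mono) (auto simp: e_def)
    also have "\<dots> = measure_pmf.prob w {v. F G v = f}"
      by (simp add: prob_eq_sum[OF fin(2) wB] e_def)
    finally have "1 / M - measure_pmf.prob w {v. F G v = f} \<le> 1 / M - (\<Sum>v\<in>B. g v * e v G)" by simp
    also have "\<dots> = - Y G + (1 - (\<Sum>v\<in>B. g v)) / M"
      by (simp add: Y_def right_diff_distrib sum_subtractf diff_divide_distrib sum_divide_distrib)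
    finally show ?thesis using tail M by simp
  qed
  then have "measure_pmf.expectation H (\<lambda>G. max 0 (1 / M - measure_pmf.prob w {v. F G v = f}))
    \<le> measure_pmf.expectation H (\<lambda>G. \<bar>Y G\<bar> + (1 - (\<Sum>v\<in>B. g v)) / M)"
    by (intro integral_mono) auto
  also have "\<dots> \<le> (sqrt (real (M - 1) * \<theta>) + measure_pmf.prob w {v. pmf w v > \<theta>}) / M"
    using EY tail by (simp add: add_divide_distrib)
  finally show ?thesis .
qed


section \<open>Sampling a word conditioned on its bin\<close>

lemma nn_integral_commute_pmf:
  "(\<integral>\<^sup>+x. \<integral>\<^sup>+y. h x y \<partial>measure_pmf B \<partial>measure_pmf A) = (\<integral>\<^sup>+y. \<integral>\<^sup>+x. h x y \<partial>measure_pmf A \<partial>measure_pmf B)"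
proof -
  have "(\<integral>\<^sup>+x. \<integral>\<^sup>+y. h x y \<partial>measure_pmf B \<partial>measure_pmf A) =
      (\<integral>\<^sup>+(x, y). h x y \<partial>bind_pmf A (\<lambda>x. bind_pmf B (\<lambda>y. return_pmf (x, y))))" by simp
  also have "\<dots> = (\<integral>\<^sup>+(x, y). h x y \<partial>bind_pmf B (\<lambda>y. bind_pmf A (\<lambda>x. return_pmf (x, y))))"
    by (subst bind_commute_pmf) (rule refl)
  also have "\<dots> = (\<integral>\<^sup>+y. \<integral>\<^sup>+x. h x y \<partial>measure_pmf A \<partial>measure_pmf B)" by simp
  finally show ?thesis .
qed

text \<open>The bin is dealt without regard to \<open>w\<close>, so a word must be produced even for
  a bin of probability 0; there \<open>w\<close> itself serves as the default. The mass of such bins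
  is charged to the shortfall.\<close>

definition resample :: "'v pmf \<Rightarrow> 'v set \<Rightarrow> 'v pmf" where
  "resample w E = (if set_pmf w \<inter> E \<noteq> {} then cond_pmf w E else w)"

text \<open>Multiplying the conditional expectation by the probability of \<open>E\<close> extends
  the formula to null events, where both sides are 0.\<close>

lemma nn_integral_resample:
  "ennreal (measure_pmf.prob w E) * (\<integral>\<^sup>+v. h v \<partial>resample w E) = (\<integral>\<^sup>+v. h v * indicator E v \<partial>w)"
proof (cases "set_pmf w \<inter> E = {}")
  case True
  then have "measure_pmf.prob w E = 0" by (simp add: measure_pmf_zero_iff)
  moreover have "(\<integral>\<^sup>+v. h v * indicator E v \<partial>w) = (\<integral>\<^sup>+v. 0 \<partial>w)"
    using True by (intro nn_integral_cong_AE) (auto simp: AE_measure_pmf_iff indicator_def)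
  ultimately show ?thesis by simp
next
  case False
  then have "measure_pmf.prob w E \<noteq> 0" by (simp add: measure_pmf_zero_iff)
  with False show ?thesis
    by (simp add: resample_def cond_pmf.rep_eq nn_integral_uniform_measure
        measure_pmf.emeasure_eq_measure ennreal_times_divide mult_divide_eq_ennreal
        mult.commute[of "ennreal (measure_pmf.prob w E)"])
qed

text \<open>Drawing \<open>v\<close> first and putting f = F v gives the bin \<open>f\<close> its
  mass p(f); dealing \<open>f\<close> uniformly gives it 1 / M. Inside the bin the law of
  \<open>v\<close> is the same in both orders. Since the integrand is at most 1, the surplus weight
  costs at most the positive part of 1 / M - p(f).\<close>

lemma nn_integral_resample_uniform:
  fixes h :: "nat \<Rightarrow> 'v \<Rightarrow> ennreal"
  assumes h: "\<And>f v. h f v \<le> 1" and M: "0 < M" and F: "\<And>v. v \<in> set_pmf w \<Longrightarrow> F v < M"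
  shows "(\<integral>\<^sup>+f. \<integral>\<^sup>+v. h f v \<partial>measure_pmf (resample w {v. F v = f}) \<partial>measure_pmf (pmf_of_set {..<M}))
    \<le> (\<integral>\<^sup>+v. h (F v) v \<partial>w) + (\<Sum>f<M. ennreal (max 0 (1 / real M - measure_pmf.prob w {v. F v = f})))"
proof -
  let ?p = "\<lambda>f. measure_pmf.prob w {v. F v = f}"
  let ?X = "\<lambda>f. \<integral>\<^sup>+v. h f v \<partial>resample w {v. F v = f}"
  have X1: "?X f \<le> 1" for f
    using nn_integral_mono[of "resample w {v. F v = f}" "h f" "\<lambda>_. 1"] h by simp
  have "(\<integral>\<^sup>+f. ?X f \<partial>pmf_of_set {..<M}) = (\<Sum>f<M. ennreal (1 / real M) * ?X f)"
    using M by (subst nn_integral_measure_pmf_finite) (auto simp: lessThan_empty_iff mult.commute)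
  also have "\<dots> \<le> (\<Sum>f<M. ennreal (?p f) * ?X f + ennreal (max 0 (1 / real M - ?p f)))"
  proof (intro sum_mono)
    fix f
    have "ennreal (1 / real M) * ?X f \<le> (ennreal (?p f) + ennreal (max 0 (1 / real M - ?p f))) * ?X f"
      by (intro mult_right_mono, subst ennreal_plus[symmetric]) (simp_all only: max.cobounded1 measure_nonneg zero_le, rule ennreal_leI, linarith)
    also have "\<dots> \<le> ennreal (?p f) * ?X f + ennreal (max 0 (1 / real M - ?p f)) * 1"
      unfolding distrib_right by (intro add_mono mult_left_mono X1) auto
    finally show "ennreal (1 / real M) * ?X f \<le> ennreal (?p f) * ?X f + ennreal (max 0 (1 / real M - ?p f))" by simp
  qed
  also have "\<dots> = (\<Sum>f<M. \<integral>\<^sup>+v. h f v * indicator {v. F v = f} v \<partial>w)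
      + (\<Sum>f<M. ennreal (max 0 (1 / real M - ?p f)))"
    by (simp add: sum.distrib nn_integral_resample)
  also have "(\<Sum>f<M. \<integral>\<^sup>+v. h f v * indicator {v. F v = f} v \<partial>w) = (\<integral>\<^sup>+v. (\<Sum>f<M. h f v * indicator {v. F v = f} v) \<partial>w)"
    by (rule nn_integral_sum[symmetric]) simp
  also have "\<dots> = (\<integral>\<^sup>+v. h (F v) v \<partial>w)"
  proof (intro nn_integral_cong_AE AE_pmfI)
    fix v assume "v \<in> set_pmf w"
    then have "F v \<in> {..<M}" using F by auto
    then show "(\<Sum>f<M. h f v * indicator {v. F v = f} v) = h (F v) v"
      by (simp add: indicator_def of_bool_def if_distrib[of "(*) _"] cong: if_cong)
  qed
  finally show ?thesis .
qed

text \<open>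
  The first component of a hash value is the shared randomness \<open>f\<close>, the second one the message \<open>j\<close>.
  Messages start at \<open>1\<close>, which is why the default value outside \<open>B\<close> is \<open>(0, 1)\<close>.
\<close>

definition hash_pmf :: "'v set \<Rightarrow> nat \<Rightarrow> nat \<Rightarrow> ('v \<Rightarrow> nat \<times> nat) pmf" where
  "hash_pmf B M L = Pi_pmf B (0, 1) (\<lambda>_. pmf_of_set ({..<M} \<times> {1..L}))"

lemma set_hash_pmf:
  assumes "finite B" "0 < M" "0 < L" "G \<in> set_pmf (hash_pmf B M L)"
  shows "fst (G v) < M" "snd (G v) \<in> {1..L}"
proof -
  have ne: "{..<M} \<times> {1..L} \<noteq> {}" using assms by (auto simp: lessThan_empty_iff)
  have "G v \<in> {..<M} \<times> {1..L}"
    using assms ne by (cases "v \<in> B") (auto simp: hash_pmf_def set_Pi_pmf PiE_dflt_def)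
  then show "fst (G v) < M" "snd (G v) \<in> {1..L}" by (auto simp: mem_Times_iff)
qed

lemma finite_set_hash_pmf:
  assumes "finite B" "0 < M" "0 < L" shows "finite (set_pmf (hash_pmf B M L))"
  using assms unfolding hash_pmf_def by (subst set_Pi_pmf) (auto intro!: finite_PiE_dflt simp: lessThan_empty_iff)

lemma hash_pmf_prob:
  assumes B: "finite B" and pos: "0 < M" "0 < L"
  shows "v \<in> B \<Longrightarrow> f < M \<Longrightarrow> measure_pmf.prob (hash_pmf B M L) {G. fst (G v) = f} = 1 / real M" (is "_ \<Longrightarrow> _ \<Longrightarrow> ?A")
    and "v \<in> B \<Longrightarrow> v' \<in> B \<Longrightarrow> v \<noteq> v' \<Longrightarrow> f < M \<Longrightarrow>
      measure_pmf.prob (hash_pmf B M L) {G. fst (G v) = f \<and> fst (G v') = f} = 1 / (real M)\<^sup>2" (is "_ \<Longrightarrow> _ \<Longrightarrow> _ \<Longrightarrow> _ \<Longrightarrow> ?B")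
    and "v \<in> B \<Longrightarrow> v' \<in> B \<Longrightarrow> v \<noteq> v' \<Longrightarrow>
      measure_pmf.prob (hash_pmf B M L) {G. G v' = G v} = 1 / (real M * real L)" (is "_ \<Longrightarrow> _ \<Longrightarrow> _ \<Longrightarrow> ?C")
proof -
  let ?K = "{..<M} \<times> {1..L}"
  have ne: "?K \<noteq> {}" "finite ?K" using pos by (auto simp: lessThan_empty_iff)
  have K: "measure_pmf.prob (pmf_of_set ?K) (fst -` {f}) = 1 / real M" if "f < M" for f
  proof -
    have "?K \<inter> fst -` {f} = {f} \<times> {1..L}" using that by auto
    then show ?thesis using pos unfolding measure_pmf_of_set[OF ne] by (simp add: card_cartesian_product)
  qed
  show ?A if "v \<in> B" "f < M"
  proof -
    have "measure_pmf.prob (hash_pmf B M L) {G. fst (G v) = f}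
       = measure_pmf.prob (map_pmf (\<lambda>G. G v) (hash_pmf B M L)) (fst -` {f})"
      by (simp add: vimage_def)
    then show ?thesis using that B K[of f] by (simp only: hash_pmf_def Pi_pmf_component if_True)
  qed
  have pair: "map_pmf (\<lambda>G. (G v, G v')) (hash_pmf B M L) = pair_pmf (pmf_of_set ?K) (pmf_of_set ?K)"
    if "v \<in> B" "v' \<in> B" "v \<noteq> v'"
    unfolding hash_pmf_def by (rule map_Pi_pmf_pair[OF B that])
  show ?B if "v \<in> B" "v' \<in> B" "v \<noteq> v'" "f < M"
  proof -
    have "measure_pmf.prob (hash_pmf B M L) {G. fst (G v) = f \<and> fst (G v') = f}
       = measure_pmf.prob (map_pmf (\<lambda>G. (G v, G v')) (hash_pmf B M L)) (fst -` {f} \<times> fst -` {f})"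
      by (simp add: vimage_def)
    also have "\<dots> = (1 / real M) * (1 / real M)"
      unfolding pair[OF that(1-3)] measure_pmf_prob_product[OF countableI_type countableI_type] K[OF that(4)] ..
    finally show ?thesis by (simp add: power2_eq_square)
  qed
  show ?C if "v \<in> B" "v' \<in> B" "v \<noteq> v'"
  proof -
    have "measure_pmf.prob (hash_pmf B M L) {G. G v' = G v}
       = measure_pmf.prob (map_pmf (\<lambda>G. (G v, G v')) (hash_pmf B M L)) {(x, y). y = x}"
      by (simp add: vimage_def)
    also have "\<dots> = measure_pmf.prob (pair_pmf (pmf_of_set ?K) (pmf_of_set ?K)) {(x, y). y = x}"
      unfolding pair[OF that] ..
    also have "ennreal \<dots> = (\<integral>\<^sup>+z. indicator {(x, y). y = x} z \<partial>pair_pmf (pmf_of_set ?K) (pmf_of_set ?K))"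
      by (simp add: measure_pmf.emeasure_eq_measure)
    also have "\<dots> = (\<integral>\<^sup>+x. \<integral>\<^sup>+y. indicator {(x, y). y = x} (x, y) \<partial>pmf_of_set ?K \<partial>pmf_of_set ?K)"
      by (rule nn_integral_pair_pmf')
    also have "\<dots> = (\<integral>\<^sup>+x. emeasure (pmf_of_set ?K) {x} \<partial>pmf_of_set ?K)"
    proof (rule nn_integral_cong)
      fix x :: "nat \<times> nat"
      have "(\<lambda>y. indicator {(x, y). y = x} (x, y) :: ennreal) = indicator {x}"
        by (auto simp: fun_eq_iff indicator_def)
      then show "(\<integral>\<^sup>+y. indicator {(x, y). y = x} (x, y) \<partial>pmf_of_set ?K) = emeasure (pmf_of_set ?K) {x}"
        using nn_integral_indicator[of "{x}" "measure_pmf (pmf_of_set ?K)"] by (simp del: nn_integral_indicator)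
    qed
    also have "\<dots> = (\<integral>\<^sup>+x. ennreal (1 / (real M * real L)) \<partial>pmf_of_set ?K)"
      by (intro nn_integral_cong_AE AE_pmfI)
         (simp add: set_pmf_of_set[OF ne] emeasure_pmf_single pmf_of_set[OF ne] card_cartesian_product del: One_nat_def)
    also have "\<dots> = ennreal (1 / (real M * real L))" by simp
    finally show ?thesis by (subst (asm) ennreal_inj) auto
  qed
qed

section \<open>Channel simulation by random binning\<close>

text \<open>
  A random code \<open>(\<phi>, m, \<delta>)\<close> of word selector, message and decoder. The first estimate says that
  \<open>\<phi> (\<alpha> z)\<close> imitates a draw from \<open>W (\<alpha> z)\<close> up to total variation \<open>\<epsilon>\<close>, jointly with \<open>z\<close> and hence
  also with anything else that is independent of the draw given \<open>z\<close>.
\<close>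

definition simulates ::
  "'z pmf \<Rightarrow> ('z \<Rightarrow> 'a) \<Rightarrow> ('z \<Rightarrow> 'b) \<Rightarrow> ('a \<Rightarrow> 'v pmf) \<Rightarrow> real \<Rightarrow> nat \<Rightarrow>
   (('a \<Rightarrow> 'v) \<times> ('a \<Rightarrow> nat) \<times> ('b \<Rightarrow> nat \<Rightarrow> 'v)) pmf \<Rightarrow> bool" where
  "simulates P \<alpha> \<beta> W \<epsilon> L \<Omega> \<longleftrightarrow>
     (\<forall>(\<phi>, m, \<delta>) \<in> set_pmf \<Omega>. \<forall>a. m a \<in> {1..L}) \<and>
     (\<forall>h. (\<forall>z v. h z v \<le> 1) \<longrightarrow>
        (\<integral>\<^sup>+(\<phi>, m, \<delta>). \<integral>\<^sup>+z. h z (\<phi> (\<alpha> z)) \<partial>measure_pmf P \<partial>measure_pmf \<Omega>)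
          \<le> (\<integral>\<^sup>+z. \<integral>\<^sup>+v. h z v \<partial>measure_pmf (W (\<alpha> z)) \<partial>measure_pmf P) + ennreal \<epsilon>) \<and>
     (\<integral>\<^sup>+(\<phi>, m, \<delta>). \<integral>\<^sup>+z. of_bool (\<delta> (\<beta> z) (m (\<alpha> z)) \<noteq> \<phi> (\<alpha> z)) \<partial>measure_pmf P \<partial>measure_pmf \<Omega>)
       \<le> ennreal \<epsilon>"

text \<open>This turns a kernel into a random function with independent values, drawn in advance:
  each single evaluation still has the prescribed law. All randomised maps are replaced by functions
  in this way, so that one good function can be picked at the end.\<close>

lemma nn_integral_Pi_pmf_component:
  assumes "finite A" "a \<in> A"
  shows "(\<integral>\<^sup>+\<phi>. h (\<phi> a) \<partial>measure_pmf (Pi_pmf A d p)) = (\<integral>\<^sup>+v. h v \<partial>measure_pmf (p a))"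
proof -
  have "(\<integral>\<^sup>+\<phi>. h (\<phi> a) \<partial>measure_pmf (Pi_pmf A d p)) = (\<integral>\<^sup>+v. h v \<partial>measure_pmf (map_pmf (\<lambda>\<phi>. \<phi> a) (Pi_pmf A d p)))"
    by simp
  then show ?thesis using assms by (simp only: Pi_pmf_component if_True)
qed

text \<open>The zero-rate case. The shared random function is indexed by laws and not by inputs:
  both parties can compute the law W (\<alpha> z) = K (\<beta> z), and equal laws yield equal words.
  The simulation and the decoding are exact, and the message is constantly 1.\<close>

lemma simulates_common_kernel:
  fixes P :: "'z pmf" and \<alpha> :: "'z \<Rightarrow> 'a" and W :: "'a \<Rightarrow> 'v pmf"
  assumes fin: "finite A" and A: "\<And>z. z \<in> set_pmf P \<Longrightarrow> \<alpha> z \<in> A"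
    and eq: "\<And>z. z \<in> set_pmf P \<Longrightarrow> W (\<alpha> z) = K (\<beta> z)" and L: "1 \<le> L" and \<epsilon>: "0 \<le> \<epsilon>"
  shows "\<exists>\<Omega>. simulates P \<alpha> \<beta> W \<epsilon> L \<Omega>"
proof -
  define H where "H = Pi_pmf (W ` A) undefined (\<lambda>w. w)"
  define \<Omega> where "\<Omega> = map_pmf (\<lambda>\<phi>. (\<lambda>a. \<phi> (W a), \<lambda>a::'a. 1::nat, \<lambda>b (j::nat). \<phi> (K b))) H"
  have "simulates P \<alpha> \<beta> W \<epsilon> L \<Omega>"
    unfolding simulates_def
  proof (intro conjI allI impI)
    show "\<forall>(\<phi>, m, \<delta>) \<in> set_pmf \<Omega>. \<forall>a. m a \<in> {1..L}" using L by (auto simp: \<Omega>_def)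
  next
    fix h :: "'z \<Rightarrow> 'v \<Rightarrow> ennreal"
    have "(\<integral>\<^sup>+(\<phi>, m, \<delta>). \<integral>\<^sup>+z. h z (\<phi> (\<alpha> z)) \<partial>measure_pmf P \<partial>measure_pmf \<Omega>)
      = (\<integral>\<^sup>+z. \<integral>\<^sup>+\<phi>. h z (\<phi> (W (\<alpha> z))) \<partial>measure_pmf H \<partial>measure_pmf P)"
      by (simp add: \<Omega>_def) (rule nn_integral_commute_pmf)
    also have "\<dots> = (\<integral>\<^sup>+z. \<integral>\<^sup>+v. h z v \<partial>measure_pmf (W (\<alpha> z)) \<partial>measure_pmf P)"
    proof (intro nn_integral_cong_AE AE_pmfI)
      fix z assume "z \<in> set_pmf P"
      then show "(\<integral>\<^sup>+\<phi>. h z (\<phi> (W (\<alpha> z))) \<partial>measure_pmf H) = (\<integral>\<^sup>+v. h z v \<partial>measure_pmf (W (\<alpha> z)))"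
        unfolding H_def using fin A by (subst nn_integral_Pi_pmf_component) auto
    qed
    finally show "(\<integral>\<^sup>+(\<phi>, m, \<delta>). \<integral>\<^sup>+z. h z (\<phi> (\<alpha> z)) \<partial>measure_pmf P \<partial>measure_pmf \<Omega>)
        \<le> (\<integral>\<^sup>+z. \<integral>\<^sup>+v. h z v \<partial>measure_pmf (W (\<alpha> z)) \<partial>measure_pmf P) + ennreal \<epsilon>" by simp
  next
    have "(\<integral>\<^sup>+(\<phi>, m, \<delta>). \<integral>\<^sup>+z. of_bool (\<delta> (\<beta> z) (m (\<alpha> z)) \<noteq> \<phi> (\<alpha> z)) \<partial>measure_pmf P \<partial>measure_pmf \<Omega>)
      = (\<integral>\<^sup>+\<phi>. \<integral>\<^sup>+z. of_bool (\<phi> (K (\<beta> z)) \<noteq> \<phi> (W (\<alpha> z))) \<partial>measure_pmf P \<partial>measure_pmf H)"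
      by (simp add: \<Omega>_def)
    also have "\<dots> = (\<integral>\<^sup>+\<phi>. \<integral>\<^sup>+z. 0 \<partial>measure_pmf P \<partial>measure_pmf H)"
      by (intro nn_integral_cong nn_integral_cong_AE AE_pmfI) (simp add: eq)
    finally show "(\<integral>\<^sup>+(\<phi>, m, \<delta>). \<integral>\<^sup>+z. of_bool (\<delta> (\<beta> z) (m (\<alpha> z)) \<noteq> \<phi> (\<alpha> z)) \<partial>measure_pmf P \<partial>measure_pmf \<Omega>)
       \<le> ennreal \<epsilon>" by simp
  qed
  then show ?thesis ..
qed

text \<open>The shortfalls of the M bins are added up, which uses up the factor 1 / M of
  \<open>hash_deviation\<close>.\<close>

lemma nn_integral_resample_hash:
  fixes h :: "('v \<Rightarrow> nat \<times> nat) \<Rightarrow> nat \<Rightarrow> 'v \<Rightarrow> ennreal"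
  assumes h: "\<And>G f v. h G f v \<le> 1" and B: "finite B" "set_pmf w \<subseteq> B" and pos: "0 < M" "0 < L" and \<theta>: "0 \<le> \<theta>"
  shows "(\<integral>\<^sup>+G. \<integral>\<^sup>+f. \<integral>\<^sup>+v. h G f v \<partial>measure_pmf (resample w {v. fst (G v) = f})
        \<partial>measure_pmf (pmf_of_set {..<M}) \<partial>measure_pmf (hash_pmf B M L))
    \<le> (\<integral>\<^sup>+G. \<integral>\<^sup>+v. h G (fst (G v)) v \<partial>measure_pmf w \<partial>measure_pmf (hash_pmf B M L))
      + ennreal (sqrt (real (M - 1) * \<theta>)) + emeasure (measure_pmf w) {v. pmf w v > \<theta>}"
proof -
  let ?H = "hash_pmf B M L"
  let ?D = "\<lambda>G f. max 0 (1 / real M - measure_pmf.prob w {v. fst (G v) = f})"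
  let ?e = "sqrt (real (M - 1) * \<theta>) + measure_pmf.prob w {v. pmf w v > \<theta>}"
  have e0: "0 \<le> ?e" using \<theta> by simp
  have finH: "finite (set_pmf ?H)" using B pos by (intro finite_set_hash_pmf)
  have "(\<integral>\<^sup>+G. \<integral>\<^sup>+f. \<integral>\<^sup>+v. h G f v \<partial>measure_pmf (resample w {v. fst (G v) = f})
        \<partial>measure_pmf (pmf_of_set {..<M}) \<partial>measure_pmf ?H)
     \<le> (\<integral>\<^sup>+G. (\<integral>\<^sup>+v. h G (fst (G v)) v \<partial>measure_pmf w) + (\<Sum>f<M. ennreal (?D G f)) \<partial>measure_pmf ?H)"
    by (intro nn_integral_mono_AE AE_pmfI nn_integral_resample_uniform h pos)
       (use set_hash_pmf(1)[OF B(1) pos] in auto)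
  also have "\<dots> = (\<integral>\<^sup>+G. \<integral>\<^sup>+v. h G (fst (G v)) v \<partial>measure_pmf w \<partial>measure_pmf ?H)
      + (\<Sum>f<M. \<integral>\<^sup>+G. ennreal (?D G f) \<partial>measure_pmf ?H)"
    by (simp add: nn_integral_add nn_integral_sum)
  also have "(\<Sum>f<M. \<integral>\<^sup>+G. ennreal (?D G f) \<partial>measure_pmf ?H) \<le> (\<Sum>f<M. ennreal (?e / M))"
  proof (intro sum_mono)
    fix f assume f: "f \<in> {..<M}"
    have "(\<integral>\<^sup>+G. ennreal (?D G f) \<partial>measure_pmf ?H) = ennreal (measure_pmf.expectation ?H (\<lambda>G. ?D G f))"
      by (intro nn_integral_eq_integral integrable_measure_pmf_finite finH) auto
    also have "\<dots> \<le> ennreal (?e / M)"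
      using f hash_pmf_prob(1,2)[OF B(1) pos]
      by (intro ennreal_leI hash_deviation[OF finH B pos(1) \<theta>]) auto
    finally show "(\<integral>\<^sup>+G. ennreal (?D G f) \<partial>measure_pmf ?H) \<le> ennreal (?e / M)" .
  qed
  also have "(\<Sum>f<M. ennreal (?e / M)) = ennreal ?e"
    using e0 pos by (subst sum_ennreal) auto
  also have "ennreal ?e = ennreal (sqrt (real (M - 1) * \<theta>)) + emeasure (measure_pmf w) {v. pmf w v > \<theta>}"
    using \<theta> by (simp add: measure_pmf.emeasure_eq_measure)
  finally show ?thesis by (simp add: add.assoc add_mono)
qed

text \<open>Both estimates of \<open>simulates\<close> are bounded in an ideal experiment, where
  \<open>v\<close> is drawn from the channel independently of the hash function and f is read off
  from \<open>v\<close>. The change of experiment costs the first two terms of \<epsilon>. The other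
  two are the decoding error in the ideal experiment: words that \<open>K\<close> finds implausible,
  and collisions of hash values. \<open>K\<close> stands for the posterior of the word given the
  side information, but only its sub-probability property enters.\<close>

lemma simulates_random_binning:
  fixes P :: "'z pmf" and K :: "'v \<Rightarrow> 'b \<Rightarrow> real"
  assumes fin: "finite A" "finite B" and A: "\<And>z. z \<in> set_pmf P \<Longrightarrow> \<alpha> z \<in> A"
    and B: "\<And>a. a \<in> A \<Longrightarrow> set_pmf (W a) \<subseteq> B"
    and pos: "0 < M" "0 < L" and \<theta>: "0 \<le> \<theta>" "0 < \<theta>'"
    and K: "\<And>v b. 0 \<le> K v b" "\<And>b. (\<Sum>v\<in>B. K v b) \<le> 1"
    and \<tau>: "0 \<le> \<tau>" "(\<integral>\<^sup>+z. emeasure (measure_pmf (W (\<alpha> z))) {v. pmf (W (\<alpha> z)) v > \<theta>} \<partial>measure_pmf P) \<le> ennreal \<tau>"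
    and \<tau>': "0 \<le> \<tau>'" "(\<integral>\<^sup>+z. emeasure (measure_pmf (W (\<alpha> z))) {v. K v (\<beta> z) < \<theta>'} \<partial>measure_pmf P) \<le> ennreal \<tau>'"
    and \<epsilon>: "sqrt (real (M - 1) * \<theta>) + \<tau> + \<tau>' + 1 / (\<theta>' * real M * real L) \<le> \<epsilon>"
  shows "\<exists>\<Omega>. simulates P \<alpha> \<beta> W \<epsilon> L \<Omega>"
proof -
  let ?H = "hash_pmf B M L" and ?U = "pmf_of_set {..<M}"
  let ?s = "sqrt (real (M - 1) * \<theta>)"
  define R where "R G f a = resample (W a) {v. fst (G v) = f}" for G :: "'v \<Rightarrow> nat \<times> nat" and f a
  \<comment> \<open>The choice is forced, and correct, when the true word is plausible and no other
    plausible word has the same hash value.\<close>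
  define dec where "dec G f b j = (SOME v. v \<in> B \<and> \<theta>' \<le> K v b \<and> G v = (f, j))"
    for G :: "'v \<Rightarrow> nat \<times> nat" and f :: nat and b and j :: nat
  define \<Omega> where "\<Omega> = do {
     G \<leftarrow> ?H; f \<leftarrow> ?U; \<phi> \<leftarrow> Pi_pmf A undefined (R G f);
     return_pmf (\<phi>, \<lambda>a. snd (G (\<phi> a)), dec G f)}"
  \<comment> \<open>The change of experiment, for test functions that may also look at the hash
    function and at the dealt bin. Decoding depends on both, so \<open>simulates\<close> would be
    too weak a form here.\<close>
  have core: "(\<integral>\<^sup>+G. \<integral>\<^sup>+f. \<integral>\<^sup>+\<phi>. \<integral>\<^sup>+z. h G f z (\<phi> (\<alpha> z)) \<partial>measure_pmf P
        \<partial>measure_pmf (Pi_pmf A undefined (R G f)) \<partial>measure_pmf ?U \<partial>measure_pmf ?H)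
     \<le> (\<integral>\<^sup>+z. \<integral>\<^sup>+v. \<integral>\<^sup>+G. h G (fst (G v)) z v \<partial>measure_pmf ?H \<partial>measure_pmf (W (\<alpha> z)) \<partial>measure_pmf P)
       + ennreal (?s + \<tau>)"
    if h: "\<And>G f z v. h G f z v \<le> 1" for h :: "('v \<Rightarrow> nat \<times> nat) \<Rightarrow> nat \<Rightarrow> 'z \<Rightarrow> 'v \<Rightarrow> ennreal"
  proof -
    have "(\<integral>\<^sup>+G. \<integral>\<^sup>+f. \<integral>\<^sup>+\<phi>. \<integral>\<^sup>+z. h G f z (\<phi> (\<alpha> z)) \<partial>measure_pmf P
        \<partial>measure_pmf (Pi_pmf A undefined (R G f)) \<partial>measure_pmf ?U \<partial>measure_pmf ?H)
      = (\<integral>\<^sup>+z. \<integral>\<^sup>+G. \<integral>\<^sup>+f. \<integral>\<^sup>+\<phi>. h G f z (\<phi> (\<alpha> z))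
        \<partial>measure_pmf (Pi_pmf A undefined (R G f)) \<partial>measure_pmf ?U \<partial>measure_pmf ?H \<partial>measure_pmf P)"
      by (simp only: nn_integral_commute_pmf[where A = P])
    also have "\<dots> = (\<integral>\<^sup>+z. \<integral>\<^sup>+G. \<integral>\<^sup>+f. \<integral>\<^sup>+v. h G f z v
        \<partial>measure_pmf (R G f (\<alpha> z)) \<partial>measure_pmf ?U \<partial>measure_pmf ?H \<partial>measure_pmf P)"
      by (intro nn_integral_cong_AE AE_pmfI nn_integral_Pi_pmf_component fin A)
    also have "\<dots> \<le> (\<integral>\<^sup>+z. (\<integral>\<^sup>+G. \<integral>\<^sup>+v. h G (fst (G v)) z v \<partial>measure_pmf (W (\<alpha> z)) \<partial>measure_pmf ?H)
         + ennreal ?s + emeasure (measure_pmf (W (\<alpha> z))) {v. pmf (W (\<alpha> z)) v > \<theta>} \<partial>measure_pmf P)"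
      unfolding R_def by (intro nn_integral_mono_AE AE_pmfI nn_integral_resample_hash h fin B A pos \<theta>)
    also have "\<dots> = (\<integral>\<^sup>+z. \<integral>\<^sup>+G. \<integral>\<^sup>+v. h G (fst (G v)) z v \<partial>measure_pmf (W (\<alpha> z)) \<partial>measure_pmf ?H \<partial>measure_pmf P)
         + (ennreal ?s + (\<integral>\<^sup>+z. emeasure (measure_pmf (W (\<alpha> z))) {v. pmf (W (\<alpha> z)) v > \<theta>} \<partial>measure_pmf P))"
      by (simp add: nn_integral_add add.assoc)
    also have "\<dots> \<le> (\<integral>\<^sup>+z. \<integral>\<^sup>+v. \<integral>\<^sup>+G. h G (fst (G v)) z v \<partial>measure_pmf ?H \<partial>measure_pmf (W (\<alpha> z)) \<partial>measure_pmf P)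
         + (ennreal ?s + ennreal \<tau>)"
      by (intro add_mono order.refl nn_integral_mono eq_refl[OF nn_integral_commute_pmf] \<tau>(2))
    finally show ?thesis using \<theta> \<tau> by simp
  qed
  \<comment> \<open>In the ideal experiment \<open>v\<close> is fixed before the hash function is
    drawn, so this is a union bound over the rival words.\<close>
  have collide: "(\<integral>\<^sup>+G. of_bool (dec G (fst (G v)) b (snd (G v)) \<noteq> v) \<partial>measure_pmf ?H)
     \<le> indicator {v. K v b < \<theta>'} v + ennreal (1 / (\<theta>' * real M * real L))" if v: "v \<in> B" for v b
  proof -
    \<comment> \<open>Weights that sum to at most 1 leave room for at most 1 / \<theta>' words of
      weight \<theta>' or more.\<close>
    define T where "T = {v\<in>B. \<theta>' \<le> K v b}"
    have T: "finite T" "T \<subseteq> B" using fin by (auto simp: T_def)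
    have "real (card T) * \<theta>' = (\<Sum>v\<in>T. \<theta>')" by simp
    also have "\<dots> \<le> (\<Sum>v\<in>T. K v b)" by (intro sum_mono) (auto simp: T_def)
    also have "\<dots> \<le> (\<Sum>v\<in>B. K v b)" using T fin K by (intro sum_mono2) auto
    finally have card_T: "real (card T) \<le> 1 / \<theta>'"
      using K(2)[of b] \<theta> by (simp add: field_simps)
    have "of_bool (dec G (fst (G v)) b (snd (G v)) \<noteq> v)
      \<le> indicator {v. K v b < \<theta>'} v + (\<Sum>v'\<in>T - {v}. indicator {G. G v' = G v} G :: ennreal)" for G
    proof (cases "K v b < \<theta>' \<or> (\<exists>v'\<in>T - {v}. G v' = G v)")
      case True
      then show ?thesis
      proof
        assume "\<exists>v'\<in>T - {v}. G v' = G v"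
        then obtain v' where v': "v' \<in> T - {v}" "G v' = G v" by blast
        have "of_bool (dec G (fst (G v)) b (snd (G v)) \<noteq> v) \<le> (1::ennreal)" by simp
        also have "(1::ennreal) = indicator {G. G v' = G v} G" using v' by simp
        also have "\<dots> \<le> (\<Sum>v'\<in>T - {v}. indicator {G. G v' = G v} G)"
          using v' T by (intro member_le_sum) auto
        also have "\<dots> \<le> indicator {v. K v b < \<theta>'} v + (\<Sum>v'\<in>T - {v}. indicator {G. G v' = G v} G)"
          by (rule add_increasing) simp_all
        finally show ?thesis .
      next
        assume "K v b < \<theta>'"
        then have "of_bool (dec G (fst (G v)) b (snd (G v)) \<noteq> v) \<le> (indicator {v. K v b < \<theta>'} v :: ennreal)" by simp
        also have "\<dots> \<le> indicator {v. K v b < \<theta>'} v + (\<Sum>v'\<in>T - {v}. indicator {G. G v' = G v} G)"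
          by (rule add_increasing2) simp_all
        finally show ?thesis .
      qed
    next
      case False
      have "dec G (fst (G v)) b (snd (G v)) = v"
        unfolding dec_def using False v by (intro some_equality) (auto simp: T_def)
      then show ?thesis by simp
    qed
    then have "(\<integral>\<^sup>+G. of_bool (dec G (fst (G v)) b (snd (G v)) \<noteq> v) \<partial>measure_pmf ?H)
      \<le> (\<integral>\<^sup>+G. indicator {v. K v b < \<theta>'} v + (\<Sum>v'\<in>T - {v}. indicator {G. G v' = G v} G) \<partial>measure_pmf ?H)"
      by (intro nn_integral_mono) simp
    also have "\<dots> = indicator {v. K v b < \<theta>'} v + (\<Sum>v'\<in>T - {v}. emeasure (measure_pmf ?H) {G. G v' = G v})"
      by (subst nn_integral_add) (simp_all add: nn_integral_sum del: sum_indicator_eq_card)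
    also have "(\<Sum>v'\<in>T - {v}. emeasure (measure_pmf ?H) {G. G v' = G v})
       = (\<Sum>v'\<in>T - {v}. ennreal (1 / (real M * real L)))"
      using hash_pmf_prob(3)[OF fin(2) pos] v T
      by (intro sum.cong refl) (auto simp: measure_pmf.emeasure_eq_measure)
    also have "\<dots> = ennreal (real (card (T - {v})) * (1 / (real M * real L)))"
      by (subst sum_ennreal) auto
    also have "\<dots> \<le> ennreal (1 / (\<theta>' * real M * real L))"
    proof (intro ennreal_leI)
      have "real (card (T - {v})) \<le> 1 / \<theta>'"
        using card_T card_mono[of T "T - {v}"] T(1) by auto
      then have "real (card (T - {v})) * (1 / (real M * real L)) \<le> 1 / \<theta>' * (1 / (real M * real L))"
        by (intro mult_right_mono) auto
      then show "real (card (T - {v})) * (1 / (real M * real L)) \<le> 1 / (\<theta>' * real M * real L)"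
        by (simp add: mult.assoc)
    qed
    finally show ?thesis by simp
  qed
  have "simulates P \<alpha> \<beta> W \<epsilon> L \<Omega>"
    unfolding simulates_def
  proof (intro conjI allI impI)
    show "\<forall>(\<phi>, m, \<delta>) \<in> set_pmf \<Omega>. \<forall>a. m a \<in> {1..L}"
      using set_hash_pmf(2)[OF fin(2) pos] by (auto simp: \<Omega>_def simp del: atLeastAtMost_iff)
  next
    fix h :: "'z \<Rightarrow> 'v \<Rightarrow> ennreal" assume h: "\<forall>z v. h z v \<le> 1"
    have "(\<integral>\<^sup>+(\<phi>, m, \<delta>). \<integral>\<^sup>+z. h z (\<phi> (\<alpha> z)) \<partial>measure_pmf P \<partial>measure_pmf \<Omega>)
      \<le> (\<integral>\<^sup>+z. \<integral>\<^sup>+v. h z v \<partial>measure_pmf (W (\<alpha> z)) \<partial>measure_pmf P) + ennreal (?s + \<tau>)"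
      using core[of "\<lambda>_ _. h"] h by (simp add: \<Omega>_def)
    also have "\<dots> \<le> (\<integral>\<^sup>+z. \<integral>\<^sup>+v. h z v \<partial>measure_pmf (W (\<alpha> z)) \<partial>measure_pmf P) + ennreal \<epsilon>"
      using \<epsilon> \<tau>'(1) \<theta> by (intro add_mono order.refl ennreal_leI)
        (smt (verit) divide_nonneg_nonneg mult_nonneg_nonneg of_nat_0_le_iff)
    finally show "(\<integral>\<^sup>+(\<phi>, m, \<delta>). \<integral>\<^sup>+z. h z (\<phi> (\<alpha> z)) \<partial>measure_pmf P \<partial>measure_pmf \<Omega>)
      \<le> (\<integral>\<^sup>+z. \<integral>\<^sup>+v. h z v \<partial>measure_pmf (W (\<alpha> z)) \<partial>measure_pmf P) + ennreal \<epsilon>" .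
  next
    let ?c = "1 / (\<theta>' * real M * real L)"
    have "(\<integral>\<^sup>+(\<phi>, m, \<delta>). \<integral>\<^sup>+z. of_bool (\<delta> (\<beta> z) (m (\<alpha> z)) \<noteq> \<phi> (\<alpha> z)) \<partial>measure_pmf P \<partial>measure_pmf \<Omega>)
      \<le> (\<integral>\<^sup>+z. \<integral>\<^sup>+v. \<integral>\<^sup>+G. of_bool (dec G (fst (G v)) (\<beta> z) (snd (G v)) \<noteq> v) \<partial>measure_pmf ?H
           \<partial>measure_pmf (W (\<alpha> z)) \<partial>measure_pmf P) + ennreal (?s + \<tau>)"
      using core[of "\<lambda>G f z v. of_bool (dec G f (\<beta> z) (snd (G v)) \<noteq> v)"] by (simp add: \<Omega>_def)
    also have "\<dots> \<le> (\<integral>\<^sup>+z. \<integral>\<^sup>+v. indicator {v. K v (\<beta> z) < \<theta>'} v + ennreal ?c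
           \<partial>measure_pmf (W (\<alpha> z)) \<partial>measure_pmf P) + ennreal (?s + \<tau>)"
      using A B by (intro add_mono order.refl nn_integral_mono_AE AE_pmfI collide) blast
    also have "\<dots> = (\<integral>\<^sup>+z. emeasure (measure_pmf (W (\<alpha> z))) {v. K v (\<beta> z) < \<theta>'} \<partial>measure_pmf P) + ennreal ?c + ennreal (?s + \<tau>)"
      by (simp add: nn_integral_add)
    also have "\<dots> \<le> ennreal \<tau>' + ennreal ?c + ennreal (?s + \<tau>)"
      by (intro add_mono order.refl \<tau>')
    also have "\<dots> \<le> ennreal \<epsilon>"
      using \<epsilon> \<theta> \<tau> \<tau>' by (simp flip: ennreal_plus add: add_ac) (rule ennreal_leI, simp)
    finally show "(\<integral>\<^sup>+(\<phi>, m, \<delta>). \<integral>\<^sup>+z. of_bool (\<delta> (\<beta> z) (m (\<alpha> z)) \<noteq> \<phi> (\<alpha> z)) \<partial>measure_pmf P \<partial>measure_pmf \<Omega>)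
       \<le> ennreal \<epsilon>" .
  qed
  then show ?thesis ..
qed

section \<open>Blocks\<close>

primrec list_pmf :: "'v pmf list \<Rightarrow> 'v list pmf" where
  "list_pmf [] = return_pmf []"
| "list_pmf (w # ws) = do {v \<leftarrow> w; vs \<leftarrow> list_pmf ws; return_pmf (v # vs)}"

lemma length_list_pmf: "vs \<in> set_pmf (list_pmf ws) \<Longrightarrow> length vs = length ws"
  by (induction ws arbitrary: vs) auto

lemma pmf_list_pmf: "length vs = length ws \<Longrightarrow> pmf (list_pmf ws) vs = prod_list (map2 pmf ws vs)"
proof (induction ws arbitrary: vs)
  case (Cons w ws)
  then obtain v vs' where vs: "vs = v # vs'" "length vs' = length ws" by (cases vs) auto
  have "list_pmf (w # ws) = map_pmf (\<lambda>(v, vs). v # vs) (pair_pmf w (list_pmf ws))"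
    by (simp add: pair_pmf_def map_bind_pmf)
  moreover have "inj (\<lambda>(v, vs). v # vs :: 'a list)" by (auto simp: inj_def)
  ultimately have "pmf (list_pmf (w # ws)) vs = pmf (pair_pmf w (list_pmf ws)) (v, vs')"
    using pmf_map_inj'[of "\<lambda>(v, vs). v # vs" "pair_pmf w (list_pmf ws)" "(v, vs')"] vs by simp
  then show ?case using vs Cons.IH by (simp add: pmf_pair)
qed simp

text \<open>An i.i.d. block sent through a memoryless channel is an i.i.d. block of input-output
  pairs. The block simulations rest on this: channels can be attached one after another, and the
  weak law applies to the pairs.\<close>

lemma replicate_pmf_bind:
  "do {zs \<leftarrow> replicate_pmf n P; vs \<leftarrow> list_pmf (map W zs); return_pmf (zs, vs)}
    = map_pmf (\<lambda>t. (map fst t, map snd t)) (replicate_pmf n (do {z \<leftarrow> P; v \<leftarrow> W z; return_pmf (z, v)}))"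
proof (induction n)
  case (Suc n)
  let ?J = "do {z \<leftarrow> P; v \<leftarrow> W z; return_pmf (z, v)}"
  have "do {zs \<leftarrow> replicate_pmf (Suc n) P; vs \<leftarrow> list_pmf (map W zs); return_pmf (zs, vs)}
    = do {z \<leftarrow> P; zs \<leftarrow> replicate_pmf n P; v \<leftarrow> W z; vs \<leftarrow> list_pmf (map W zs); return_pmf (z # zs, v # vs)}"
    by (simp add: bind_assoc_pmf bind_return_pmf)
  also have "\<dots> = do {z \<leftarrow> P; v \<leftarrow> W z; zs \<leftarrow> replicate_pmf n P; vs \<leftarrow> list_pmf (map W zs); return_pmf (z # zs, v # vs)}"
    by (subst bind_commute_pmf) (rule refl)
  also have "\<dots> = do {z \<leftarrow> P; v \<leftarrow> W z; (zs, vs) \<leftarrow> do {zs \<leftarrow> replicate_pmf n P; vs \<leftarrow> list_pmf (map W zs); return_pmf (zs, vs)};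
      return_pmf (z # zs, v # vs)}"
    by (simp add: bind_assoc_pmf bind_return_pmf)
  also have "\<dots> = map_pmf (\<lambda>t. (map fst t, map snd t)) (replicate_pmf (Suc n) ?J)"
    unfolding Suc.IH by (simp add: bind_assoc_pmf bind_return_pmf map_bind_pmf bind_map_pmf)
  finally show ?case .
qed (simp add: bind_return_pmf)

lemma nn_integral_replicate_bind:
  "(\<integral>\<^sup>+zs. \<integral>\<^sup>+vs. h zs vs \<partial>measure_pmf (list_pmf (map W zs)) \<partial>measure_pmf (replicate_pmf n P))
    = (\<integral>\<^sup>+t. h (map fst t) (map snd t) \<partial>measure_pmf (replicate_pmf n (do {z \<leftarrow> P; v \<leftarrow> W z; return_pmf (z, v)})))"
  using arg_cong[OF replicate_pmf_bind[of n P W], of "\<lambda>p. \<integral>\<^sup>+(zs, vs). h zs vs \<partial>measure_pmf p"]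
  by simp

lemma length_replicate_pmf: "zs \<in> set_pmf (replicate_pmf n P) \<Longrightarrow> length zs = n"
  by (simp add: set_replicate_pmf)

lemma finite_lists_length: "finite {vs :: 'v::finite list. length vs = n}"
  using finite_lists_length_eq[of "UNIV :: 'v set" n] by simp

lemma finite_set_replicate_pmf: "finite (set_pmf P) \<Longrightarrow> finite (set_pmf (replicate_pmf n P))"
  using finite_lists_length_eq[of "set_pmf P" n] by (simp add: set_replicate_pmf in_lists_conv_set Collect_conj_eq subset_eq
      conj_commute)

lemma expectation_bind_pmf:
  fixes h :: "'b \<Rightarrow> real"
  assumes "finite (set_pmf p)" "\<And>x. x \<in> set_pmf p \<Longrightarrow> finite (set_pmf (f x))"
  shows "measure_pmf.expectation (bind_pmf p f) h = measure_pmf.expectation p (\<lambda>x. measure_pmf.expectation (f x) h)"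
  using assms by (subst pmf_expectation_bind[of "set_pmf p"]) (auto simp: integral_measure_pmf[of "set_pmf p"])

section \<open>The weak law of large numbers and equipartition\<close>

lemma variance_sum_list_replicate_pmf:
  fixes l :: "'t \<Rightarrow> real"
  assumes fin: "finite (set_pmf Q)" and mean: "measure_pmf.expectation Q l = 0"
  shows "measure_pmf.expectation (replicate_pmf n Q) (\<lambda>ts. (sum_list (map l ts))\<^sup>2)
      = n * measure_pmf.expectation Q (\<lambda>t. (l t)\<^sup>2)"
    and "measure_pmf.expectation (replicate_pmf n Q) (\<lambda>ts. sum_list (map l ts)) = 0"
proof (induction n)
  case (Suc n)
  have int: "integrable (measure_pmf Q) g" "integrable (measure_pmf (replicate_pmf n Q)) g'" for g g' :: "_ \<Rightarrow> real"
    using fin finite_set_replicate_pmf[OF fin] by (auto intro!: integrable_measure_pmf_finite)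
  note fins = fin finite_set_replicate_pmf[OF fin]
  have E: "measure_pmf.expectation (replicate_pmf (Suc n) Q) g
     = measure_pmf.expectation Q (\<lambda>x. measure_pmf.expectation (replicate_pmf n Q) (\<lambda>xs. g (x # xs)))" for g :: "'t list \<Rightarrow> real"
    using fins by (simp add: expectation_bind_pmf)
  show "measure_pmf.expectation (replicate_pmf (Suc n) Q) (\<lambda>ts. sum_list (map l ts)) = 0"
    unfolding E using Suc mean int by simp
  show "measure_pmf.expectation (replicate_pmf (Suc n) Q) (\<lambda>ts. (sum_list (map l ts))\<^sup>2)
      = Suc n * measure_pmf.expectation Q (\<lambda>t. (l t)\<^sup>2)"
    unfolding E using Suc mean int by (simp add: power2_sum algebra_simps)
qed simp_all

lemma weak_law_replicate_pmf:
  fixes l :: "'t \<Rightarrow> real"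
  assumes fin: "finite (set_pmf Q)" and \<eta>: "0 < \<eta>" and n: "0 < n"
  defines "\<mu> \<equiv> measure_pmf.expectation Q l"
  shows "measure_pmf.prob (replicate_pmf n Q) {ts. real n * \<eta> \<le> \<bar>sum_list (map l ts) - real n * \<mu>\<bar>}
     \<le> measure_pmf.expectation Q (\<lambda>t. (l t - \<mu>)\<^sup>2) / (real n * \<eta>\<^sup>2)"
proof -
  let ?R = "replicate_pmf n Q" and ?V = "measure_pmf.expectation Q (\<lambda>t. (l t - \<mu>)\<^sup>2)"
  define S where "S ts = sum_list (map (\<lambda>t. l t - \<mu>) ts)" for ts
  have int: "integrable (measure_pmf ?R) g" "integrable (measure_pmf Q) g'" for g g' :: "_ \<Rightarrow> real"
    using fin finite_set_replicate_pmf[OF fin] by (auto intro!: integrable_measure_pmf_finite)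
  have S: "S ts = sum_list (map l ts) - real n * \<mu>" if "ts \<in> set_pmf ?R" for ts
    using length_replicate_pmf[OF that] by (simp add: S_def sum_list_subtractf sum_list_triv)
  have "measure_pmf.prob ?R {ts. real n * \<eta> \<le> \<bar>sum_list (map l ts) - real n * \<mu>\<bar>} = measure_pmf.prob ?R {ts. (real n * \<eta>)\<^sup>2 \<le> (S ts)\<^sup>2}"
    using \<eta> n S by (intro measure_pmf.finite_measure_eq_AE AE_pmfI) (auto simp: abs_le_square_iff[symmetric])
  also have "\<dots> \<le> measure_pmf.expectation ?R (\<lambda>ts. (S ts)\<^sup>2) / (real n * \<eta>)\<^sup>2"
    using integral_Markov_inequality_measure[of "measure_pmf ?R" "\<lambda>ts. (S ts)\<^sup>2" UNIV "(real n * \<eta>)\<^sup>2"] int \<eta> n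
    by simp
  also have "measure_pmf.expectation ?R (\<lambda>ts. (S ts)\<^sup>2) = real n * ?V"
    unfolding S_def using fin int by (intro variance_sum_list_replicate_pmf) (simp_all add: \<mu>_def)
  also have "real n * ?V / (real n * \<eta>)\<^sup>2 = ?V / (real n * \<eta>\<^sup>2)"
    using n by (simp add: power2_eq_square field_simps)
  finally show ?thesis .
qed

lemma log_prod_list_map:
  "\<forall>t\<in>set ts. (0::real) < k t \<Longrightarrow> 0 < prod_list (map k ts) \<and> - log 2 (prod_list (map k ts)) = sum_list (map (\<lambda>t. - log 2 (k t)) ts)"
  by (induction ts) (simp_all add: log_mult)

text \<open>Stated for any weight that is positive on the support, because it is applied both to the
  channel likelihood, giving H(V | A), and to the posterior given B, giving H(V | B). The logarithm
  of the product is a sum of i.i.d. terms.\<close>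

lemma asymptotic_equipartition:
  fixes k :: "'t \<Rightarrow> real"
  assumes fin: "finite (set_pmf Q)" and k: "\<And>t. t \<in> set_pmf Q \<Longrightarrow> 0 < k t" and \<eta>: "0 < \<eta>" and \<tau>: "0 < \<tau>"
  defines "H \<equiv> measure_pmf.expectation Q (\<lambda>t. - log 2 (k t))"
  shows "\<forall>\<^sub>F n in sequentially. measure_pmf.prob (replicate_pmf n Q)
     {ts. prod_list (map k ts) < 2 powr (- (real n * (H + \<eta>))) \<or> 2 powr (- (real n * (H - \<eta>))) < prod_list (map k ts)} \<le> \<tau>"
proof -
  define V where "V = measure_pmf.expectation Q (\<lambda>t. (- log 2 (k t) - H)\<^sup>2)"
  have "((\<lambda>n. V / (real n * \<eta>\<^sup>2)) \<longlongrightarrow> 0) sequentially"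
    using \<eta> by real_asymp
  then have "\<forall>\<^sub>F n in sequentially. V / (real n * \<eta>\<^sup>2) < \<tau>"
    using \<tau> by (rule order_tendstoD(2))
  then show ?thesis
    using eventually_gt_at_top[of 0]
  proof eventually_elim
    case (elim n)
    have "measure_pmf.prob (replicate_pmf n Q)
     {ts. prod_list (map k ts) < 2 powr (- (real n * (H + \<eta>))) \<or> 2 powr (- (real n * (H - \<eta>))) < prod_list (map k ts)}
     \<le> measure_pmf.prob (replicate_pmf n Q) {ts. real n * \<eta> \<le> \<bar>sum_list (map (\<lambda>t. - log 2 (k t)) ts) - real n * H\<bar>}"
    proof (intro measure_pmf.finite_measure_mono_AE AE_pmfI impI)
      fix ts assume "ts \<in> set_pmf (replicate_pmf n Q)"
      then have "\<forall>t\<in>set ts. 0 < k t" using k by (auto simp: set_replicate_pmf)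
      then have kt: "0 < prod_list (map k ts)"
          "- log 2 (prod_list (map k ts)) = sum_list (map (\<lambda>t. - log 2 (k t)) ts)"
        using log_prod_list_map by blast+
      let ?p = "prod_list (map k ts)"
      assume "ts \<in> {ts. prod_list (map k ts) < 2 powr (- (real n * (H + \<eta>))) \<or> 2 powr (- (real n * (H - \<eta>))) < prod_list (map k ts)}"
      then have "log 2 ?p < - (real n * (H + \<eta>)) \<or> - (real n * (H - \<eta>)) < log 2 ?p"
        using kt by (auto simp: log_less_iff less_log_iff)
      then show "ts \<in> {ts. real n * \<eta> \<le> \<bar>sum_list (map (\<lambda>t. - log 2 (k t)) ts) - real n * H\<bar>}"
        using kt by (auto simp: algebra_simps)
    qed simp
    also have "\<dots> \<le> V / (real n * \<eta>\<^sup>2)"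
      unfolding V_def H_def by (rule weak_law_replicate_pmf[OF fin \<eta> elim(2)])
    finally show ?case using elim by simp
  qed
qed

section \<open>Channels and the excess rate\<close>

definition channel_pmf :: "'z pmf \<Rightarrow> ('z \<Rightarrow> 'v pmf) \<Rightarrow> ('z \<times> 'v) pmf" where
  "channel_pmf P \<kappa> = do {z \<leftarrow> P; v \<leftarrow> \<kappa> z; return_pmf (z, v)}"

lemma nn_integral_channel_pmf:
  "(\<integral>\<^sup>+t. h t \<partial>measure_pmf (channel_pmf P \<kappa>)) = (\<integral>\<^sup>+z. \<integral>\<^sup>+v. h (z, v) \<partial>measure_pmf (\<kappa> z) \<partial>measure_pmf P)"
  by (simp add: channel_pmf_def)

lemma emeasure_channel_pmf:
  "emeasure (measure_pmf (channel_pmf P \<kappa>)) S = (\<integral>\<^sup>+z. emeasure (measure_pmf (\<kappa> z)) {v. (z, v) \<in> S} \<partial>measure_pmf P)"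
proof -
  have "emeasure (measure_pmf (channel_pmf P \<kappa>)) S = (\<integral>\<^sup>+t. indicator S t \<partial>measure_pmf (channel_pmf P \<kappa>))" by simp
  also have "\<dots> = (\<integral>\<^sup>+z. \<integral>\<^sup>+v. indicator {v. (z, v) \<in> S} v \<partial>measure_pmf (\<kappa> z) \<partial>measure_pmf P)"
    unfolding nn_integral_channel_pmf by (intro nn_integral_cong) (auto simp: indicator_def)
  finally show ?thesis by simp
qed

lemma set_channel_pmf: "(z, v) \<in> set_pmf (channel_pmf P \<kappa>) \<longleftrightarrow> z \<in> set_pmf P \<and> v \<in> set_pmf (\<kappa> z)"
  by (auto simp: channel_pmf_def)

text \<open>Given \<alpha> z, the output is independent of the rest of \<open>z\<close>. The
  probability of the fibre of \<alpha> therefore factors out of the numerator and cancels.\<close>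

lemma posterior_channel_pmf:
  assumes z: "z \<in> set_pmf P"
  shows "posterior (channel_pmf P (\<lambda>z. W (\<alpha> z))) snd (\<alpha> \<circ> fst) v (\<alpha> z) = pmf (W (\<alpha> z)) v"
proof -
  let ?J = "channel_pmf P (\<lambda>z. W (\<alpha> z))" and ?Z = "{z'. \<alpha> z' = \<alpha> z}"
  have "emeasure (measure_pmf ?J) {t. snd t = v \<and> (\<alpha> \<circ> fst) t = \<alpha> z}
     = (\<integral>\<^sup>+z'. ennreal (pmf (W (\<alpha> z)) v) * indicator ?Z z' \<partial>measure_pmf P)"
    unfolding emeasure_channel_pmf
  proof (intro nn_integral_cong)
    fix z'
    show "emeasure (measure_pmf (W (\<alpha> z'))) {va. (z', va) \<in> {t. snd t = v \<and> (\<alpha> \<circ> fst) t = \<alpha> z}}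
       = ennreal (pmf (W (\<alpha> z)) v) * indicator ?Z z'"
      by (cases "\<alpha> z' = \<alpha> z") (auto simp: emeasure_pmf_single)
  qed
  then have num: "measure_pmf.prob ?J {t. snd t = v \<and> (\<alpha> \<circ> fst) t = \<alpha> z} = pmf (W (\<alpha> z)) v * measure_pmf.prob P ?Z"
    by (simp add: nn_integral_cmult_indicator measure_pmf.emeasure_eq_measure flip: ennreal_mult)
  have "emeasure (measure_pmf ?J) {t. (\<alpha> \<circ> fst) t = \<alpha> z} = (\<integral>\<^sup>+z'. indicator ?Z z' \<partial>measure_pmf P)"
    unfolding emeasure_channel_pmf by (intro nn_integral_cong) (auto simp: indicator_def)
  then have "measure_pmf.prob ?J {t. (\<alpha> \<circ> fst) t = \<alpha> z} = measure_pmf.prob P ?Z"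
    by (simp add: measure_pmf.emeasure_eq_measure)
  moreover have "0 < measure_pmf.prob P ?Z" using z by (intro measure_pmf_posI) auto
  ultimately show ?thesis unfolding posterior_def num by simp
qed

lemma expectation_channel_pmf:
  fixes P :: "'z::finite pmf" and \<kappa> :: "'z \<Rightarrow> 'v::finite pmf" and h :: "'z \<times> 'v \<Rightarrow> real"
  shows "measure_pmf.expectation (channel_pmf P \<kappa>) h = measure_pmf.expectation P (\<lambda>z. \<Sum>v\<in>UNIV. pmf (\<kappa> z) v * h (z, v))"
proof -
  have "measure_pmf.expectation (channel_pmf P \<kappa>) h
      = measure_pmf.expectation P (\<lambda>z. measure_pmf.expectation (\<kappa> z) (\<lambda>v. h (z, v)))"
    by (simp add: channel_pmf_def expectation_bind_pmf)
  then show ?thesis by (simp add: integral_measure_pmf[of UNIV])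
qed

lemma cond_ent_channel_pmf:
  "cond_ent (channel_pmf P (\<lambda>z. W (\<alpha> z))) snd (\<alpha> \<circ> fst)
    = measure_pmf.expectation (channel_pmf P (\<lambda>z. W (\<alpha> z))) (\<lambda>t. - log 2 (pmf (W (\<alpha> (fst t))) (snd t)))"
  unfolding cond_ent_def
proof (rule expectation_cong_set_pmf)
  fix t assume "t \<in> set_pmf (channel_pmf P (\<lambda>z. W (\<alpha> z)))"
  then have "fst t \<in> set_pmf P" by (cases t) (auto simp: set_channel_pmf)
  then show "- log 2 (posterior (channel_pmf P (\<lambda>z. W (\<alpha> z))) snd (\<alpha> \<circ> fst) (snd t) ((\<alpha> \<circ> fst) t))
      = - log 2 (pmf (W (\<alpha> (fst t))) (snd t))"
    using posterior_channel_pmf[of "fst t" P W \<alpha>] by simp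
qed

text \<open>This is \<open>H(V | B) - H(V | A)\<close>, where \<open>A = \<alpha> z\<close>, \<open>B = \<beta> z\<close> and \<open>V\<close> is drawn from \<open>W A\<close>.\<close>

definition excess_rate :: "'z pmf \<Rightarrow> ('z \<Rightarrow> 'a) \<Rightarrow> ('z \<Rightarrow> 'b) \<Rightarrow> ('a \<Rightarrow> 'v pmf) \<Rightarrow> real" where
  "excess_rate P \<alpha> \<beta> W =
     cond_ent (channel_pmf P (\<lambda>z. W (\<alpha> z))) snd (\<beta> \<circ> fst) - cond_ent (channel_pmf P (\<lambda>z. W (\<alpha> z))) snd (\<alpha> \<circ> fst)"

text \<open>V - A - B is a Markov chain, so the excess rate is I(V; A | B): the mean relative
  entropy of the channel law with respect to the posterior given B. If it vanishes, the channel law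
  at \<open>z\<close> is that posterior and hence depends on \<open>z\<close> through \<beta> z
  only.\<close>

lemma excess_rate_Gibbs:
  fixes P :: "'z::finite pmf" and W :: "'a \<Rightarrow> 'v::finite pmf" and \<alpha> :: "'z \<Rightarrow> 'a" and \<beta> :: "'z \<Rightarrow> 'b"
  defines "J \<equiv> channel_pmf P (\<lambda>z. W (\<alpha> z))"
  shows excess_rate_nonneg: "0 \<le> excess_rate P \<alpha> \<beta> W"
    and excess_rate_eq_0: "excess_rate P \<alpha> \<beta> W = 0 \<Longrightarrow> z \<in> set_pmf P \<Longrightarrow>
      pmf (W (\<alpha> z)) v = posterior J snd (\<beta> \<circ> fst) v (\<beta> z)"
proof -
  define w where "w t = pmf (W (\<alpha> (fst t))) (snd t)" for t :: "'z \<times> 'v"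
  define k where "k t = posterior J snd (\<beta> \<circ> fst) (snd t) (\<beta> (fst t))" for t :: "'z \<times> 'v"
  define y where "y t = k t / w t" for t
  have int[simp]: "integrable (measure_pmf J) g" for g :: "_ \<Rightarrow> real" by simp
  have pos: "0 < w t" "0 < k t" "0 < y t" if "t \<in> set_pmf J" for t
  proof -
    show "0 < w t" using that by (cases t) (auto simp: J_def set_channel_pmf w_def pmf_positive)
    show "0 < k t" using posterior_pos[OF that, of snd "\<beta> \<circ> fst"] by (simp add: k_def)
    then show "0 < y t" using \<open>0 < w t\<close> by (simp add: y_def)
  qed
  have "excess_rate P \<alpha> \<beta> W = measure_pmf.expectation J (\<lambda>t. - log 2 (k t)) - measure_pmf.expectation J (\<lambda>t. - log 2 (w t))"
    using cond_ent_channel_pmf[of P W \<alpha>]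
    by (simp add: excess_rate_def cond_ent_def[of _ _ "\<beta> \<circ> fst"] k_def w_def flip: J_def)
  also have "\<dots> = measure_pmf.expectation J (\<lambda>t. - ln (y t) / ln 2)"
    unfolding Bochner_Integration.integral_diff[OF int int, symmetric]
    by (rule expectation_cong_set_pmf)
       (use pos in \<open>auto simp: y_def log_def ln_div diff_divide_distrib less_imp_neq[symmetric]\<close>)
  finally have rate: "excess_rate P \<alpha> \<beta> W = measure_pmf.expectation J (\<lambda>t. - ln (y t)) / ln 2" by simp
  have k1: "(\<Sum>v\<in>UNIV. k (z, v)) \<le> 1" for z
    unfolding k_def using sum_posterior_le_1[of UNIV J snd "\<beta> \<circ> fst" "\<beta> z"] by simp
  have k0: "0 \<le> k t" for t by (simp add: k_def posterior_nonneg)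
  \<comment> \<open>Averaging over the output multiplies \<open>y\<close> by the denominator
    \<open>w\<close>, leaving a sum of posteriors.\<close>
  have "measure_pmf.expectation J y \<le> measure_pmf.expectation P (\<lambda>z. 1)"
    unfolding J_def expectation_channel_pmf
  proof (rule integral_mono)
    fix z
    have "(\<Sum>v\<in>UNIV. pmf (W (\<alpha> z)) v * y (z, v)) \<le> (\<Sum>v\<in>UNIV. k (z, v))"
      by (intro sum_mono) (auto simp: y_def w_def k0)
    then show "(\<Sum>v\<in>UNIV. pmf (W (\<alpha> z)) v * y (z, v)) \<le> 1" using k1[of z] by linarith
  qed auto
  then have Ey: "0 \<le> measure_pmf.expectation J (\<lambda>t. 1 - y t)" by simp
  have gap: "0 \<le> - ln (y t) - (1 - y t)" if "t \<in> set_pmf J" for t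
    using ln_le_minus_one[OF pos(3)[OF that]] by simp
  then have gap0: "0 \<le> measure_pmf.expectation J (\<lambda>t. - ln (y t) - (1 - y t))"
    by (intro integral_nonneg_AE AE_pmfI)
  \<comment> \<open>Both summands are nonnegative, so a vanishing excess rate forces each to vanish.
    The first is the gap in ln y \<le> y - 1, which closes only at y = 1.\<close>
  have split: "measure_pmf.expectation J (\<lambda>t. - ln (y t))
     = measure_pmf.expectation J (\<lambda>t. - ln (y t) - (1 - y t)) + measure_pmf.expectation J (\<lambda>t. 1 - y t)"
    by (simp flip: Bochner_Integration.integral_add)
  show "0 \<le> excess_rate P \<alpha> \<beta> W" unfolding rate split by (intro divide_nonneg_pos add_nonneg_nonneg gap0 Ey) simp
  assume "excess_rate P \<alpha> \<beta> W = 0" and z: "z \<in> set_pmf P"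
  then have "measure_pmf.expectation J (\<lambda>t. - ln (y t) - (1 - y t)) = 0"
    using gap0 Ey unfolding rate split by simp
  then have "AE t in measure_pmf J. - ln (y t) - (1 - y t) = 0"
    using gap by (subst (asm) integral_nonneg_eq_0_iff_AE) (auto intro!: AE_pmfI)
  then have y1: "y t = 1" if "t \<in> set_pmf J" for t
    using ln_eq_minus_one[OF pos(3)[OF that]] that by (auto simp: AE_measure_pmf_iff)
  \<comment> \<open>Equality is known on the support only. Off the support \<open>w\<close> is 0,
    and since \<open>w\<close> sums to 1 while the posterior sums to at most 1, the inequality for
    all letters becomes an equality.\<close>
  have le: "w (z, v) \<le> k (z, v)" for v
  proof (cases "(z, v) \<in> set_pmf J")
    case True then show ?thesis using y1[OF True] pos(1)[OF True] by (simp add: y_def)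
  next
    case False then have "w (z, v) = 0" using z by (auto simp: J_def set_channel_pmf w_def pmf_eq_0_set_pmf)
    then show ?thesis using k0 by simp
  qed
  have "(\<Sum>v\<in>UNIV. w (z, v)) = 1" unfolding w_def using sum_pmf_eq_1[of UNIV "W (\<alpha> z)"] by simp
  moreover have "(\<Sum>v\<in>UNIV. w (z, v)) \<le> (\<Sum>v\<in>UNIV. k (z, v))" by (intro sum_mono le)
  ultimately have "(\<Sum>v\<in>UNIV. k (z, v) - w (z, v)) = 0"
    using k1[of z] by (simp add: sum_subtractf)
  then have "k (z, v) - w (z, v) = 0" for v
    using le by (subst (asm) sum_nonneg_eq_0_iff) auto
  from this[of v] show "pmf (W (\<alpha> z)) v = posterior J snd (\<beta> \<circ> fst) v (\<beta> z)"
    by (simp add: k_def w_def)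
qed

lemma sum_lists_prod_le_1:
  fixes k :: "'v::finite \<Rightarrow> 'b \<Rightarrow> real"
  assumes "\<And>v b. 0 \<le> k v b" "\<And>b. (\<Sum>v\<in>UNIV. k v b) \<le> 1"
  shows "(\<Sum>vs | length vs = length bs. prod_list (map2 k vs bs)) \<le> 1"
proof (induction bs)
  case (Cons b bs)
  have nonneg: "0 \<le> prod_list (map2 k vs bs)" for vs
    by (intro prod_list_nonneg) (auto simp: assms)
  have eq: "{vs::'v list. length vs = length (b # bs)} = (\<lambda>(v, vs). v # vs) ` (UNIV \<times> {vs. length vs = length bs})"
    by (auto simp: image_iff length_Suc_conv)
  have "(\<Sum>vs | length vs = length (b # bs). prod_list (map2 k vs (b # bs)))
    = (\<Sum>(v, vs)\<in>UNIV \<times> {vs. length vs = length bs}. k v b * prod_list (map2 k vs bs))"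
    unfolding eq by (subst sum.reindex) (auto simp: inj_on_def intro!: sum.cong)
  also have "\<dots> = (\<Sum>v\<in>UNIV. k v b) * (\<Sum>vs | length vs = length bs. prod_list (map2 k vs bs))"
    by (simp add: sum_product sum.cartesian_product)
  also have "\<dots> \<le> 1 * 1"
    using assms Cons by (intro mult_mono sum_nonneg nonneg) auto
  finally show ?case by simp
qed simp


lemma nn_integral_of_bool:
  "(\<integral>\<^sup>+v. of_bool (Q v) \<partial>measure_pmf p) = emeasure (measure_pmf p) {v. Q v}"
proof -
  have "(\<lambda>v. of_bool (Q v) :: ennreal) = indicator {v. Q v}" by (auto simp: indicator_def)
  then show ?thesis by simp
qed

lemma eventually_powr_le:
  fixes \<eta> c \<delta> :: real
  assumes "0 < \<eta>" "0 < \<delta>"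
  shows "\<forall>\<^sub>F n in sequentially. c * 2 powr (- (real n * \<eta>)) \<le> \<delta>"
proof -
  have "((\<lambda>n. c * 2 powr (- (real n * \<eta>))) \<longlongrightarrow> 0) sequentially"
    using assms by real_asymp
  then have "\<forall>\<^sub>F n in sequentially. c * 2 powr (- (real n * \<eta>)) < \<delta>"
    using assms(2) by (rule order_tendstoD(2))
  then show ?thesis by eventually_elim simp
qed

text \<open>With a strictly larger rate, random binning works: bins for the shared randomness at a
  rate just below H(V | A), and an overall hash rate just above H(V | B). At rate 0 without slack
  the equality case of Gibbs' inequality gives a common kernel.\<close>

lemma eventually_simulates:
  fixes P :: "'z::finite pmf" and W :: "'a \<Rightarrow> 'v::finite pmf" and \<alpha> :: "'z \<Rightarrow> 'a" and \<beta> :: "'z \<Rightarrow> 'b"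
  assumes R: "0 \<le> R" and rate: "excess_rate P \<alpha> \<beta> W < R \<or> R = 0 \<and> excess_rate P \<alpha> \<beta> W = 0" and \<epsilon>: "0 < \<epsilon>"
  shows "\<forall>\<^sub>F n in sequentially. \<exists>\<Omega>. simulates (replicate_pmf n P) (map \<alpha>) (map \<beta>)
     (\<lambda>as. list_pmf (map W as)) \<epsilon> (nat \<lfloor>2 powr (real n * R)\<rfloor>) \<Omega>"
  using rate
proof
  assume zero: "R = 0 \<and> excess_rate P \<alpha> \<beta> W = 0"
  \<comment> \<open>Any source letter compatible with \<open>b\<close> will do, as all of them lead
    to the same output law.\<close>
  define K where "K b = W (\<alpha> (SOME z. z \<in> set_pmf P \<and> \<beta> z = b))" for b
  have K: "W (\<alpha> z) = K (\<beta> z)" if z: "z \<in> set_pmf P" for z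
  proof (rule pmf_eqI)
    fix v
    define z' where "z' = (SOME z'. z' \<in> set_pmf P \<and> \<beta> z' = \<beta> z)"
    have z': "z' \<in> set_pmf P" "\<beta> z' = \<beta> z"
      using someI[of "\<lambda>z'. z' \<in> set_pmf P \<and> \<beta> z' = \<beta> z" z] z by (auto simp: z'_def)
    show "pmf (W (\<alpha> z)) v = pmf (K (\<beta> z)) v"
      using excess_rate_eq_0[of P \<alpha> \<beta> W z v] excess_rate_eq_0[of P \<alpha> \<beta> W z' v] zero z z'
      by (simp add: K_def flip: z'_def)
  qed
  show ?thesis
  proof (intro always_eventually allI simulates_common_kernel)
    fix n
    show "finite (map \<alpha> ` {zs::'z list. length zs = n})" by (intro finite_imageI finite_lists_length)
    fix zs assume zs: "zs \<in> set_pmf (replicate_pmf n P)"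
    then show "map \<alpha> zs \<in> map \<alpha> ` {zs. length zs = n}" by (auto simp: length_replicate_pmf)
    show "list_pmf (map W (map \<alpha> zs)) = list_pmf (map K (map \<beta> zs))"
      using zs K by (intro arg_cong[of _ _ list_pmf]) (auto simp: set_replicate_pmf)
  qed (use zero \<epsilon> in auto)
next
  assume less: "excess_rate P \<alpha> \<beta> W < R"
  define J where "J = channel_pmf P (\<lambda>z. W (\<alpha> z))"
  define HA where "HA = cond_ent J snd (\<alpha> \<circ> fst)"
  define HB where "HB = cond_ent J snd (\<beta> \<circ> fst)"
  \<comment> \<open>A quarter of the slack: two parts keep M below the rate H(V | A), one goes into
    the threshold \<theta>', and the last one is left as the exponent of the collision term.\<close>
  define \<eta> where "\<eta> = (R - (HB - HA)) / 4"
  define w where "w t = pmf (W (\<alpha> (fst t))) (snd t)" for t :: "'z \<times> 'v"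
  define post where "post v b = posterior J snd (\<beta> \<circ> fst) v b" for v b
  define k where "k t = post (snd t) (\<beta> (fst t))" for t :: "'z \<times> 'v"
  have \<eta>: "0 < \<eta>" "R = HB - HA + 4 * \<eta>"
  proof -
    have "HB - HA < R" using less unfolding excess_rate_def HA_def HB_def J_def .
    then show "0 < \<eta>" "R = HB - HA + 4 * \<eta>" by (simp_all add: \<eta>_def field_simps)
  qed
  have w_pos: "0 < w t" if "t \<in> set_pmf J" for t
    using that by (cases t) (auto simp: J_def set_channel_pmf w_def pmf_positive)
  have k_pos: "0 < k t" if "t \<in> set_pmf J" for t
    using posterior_pos[OF that, of snd "\<beta> \<circ> fst"] by (simp add: k_def post_def)
  have HA: "HA = measure_pmf.expectation J (\<lambda>t. - log 2 (w t))"
    unfolding HA_def J_def cond_ent_channel_pmf w_def ..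
  have HB: "HB = measure_pmf.expectation J (\<lambda>t. - log 2 (k t))"
    by (simp add: HB_def cond_ent_def k_def post_def)
  have "0 < \<epsilon> / 4" using \<epsilon> by simp
  have fin: "finite (set_pmf J)" by simp
  have "\<forall>\<^sub>F n in sequentially. measure_pmf.prob (replicate_pmf n J) {ts. prod_list (map w ts) < 2 powr (- (real n * (HA + \<eta>)))
       \<or> 2 powr (- (real n * (HA - \<eta>))) < prod_list (map w ts)} \<le> \<epsilon> / 4"
    unfolding HA by (rule asymptotic_equipartition[OF fin w_pos \<eta>(1) \<open>0 < \<epsilon> / 4\<close>])
  moreover have "\<forall>\<^sub>F n in sequentially. measure_pmf.prob (replicate_pmf n J) {ts. prod_list (map k ts) < 2 powr (- (real n * (HB + \<eta>)))
       \<or> 2 powr (- (real n * (HB - \<eta>))) < prod_list (map k ts)} \<le> \<epsilon> / 4"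
    unfolding HB by (rule asymptotic_equipartition[OF fin k_pos \<eta>(1) \<open>0 < \<epsilon> / 4\<close>])
  moreover have "\<forall>\<^sub>F n in sequentially. 1 * 2 powr (- (real n * (\<eta> / 2))) \<le> \<epsilon> / 4"
    using \<eta>(1) \<open>0 < \<epsilon> / 4\<close> by (intro eventually_powr_le) auto
  moreover have "\<forall>\<^sub>F n in sequentially. 2 * 2 powr (- (real n * \<eta>)) \<le> \<epsilon> / 4"
    by (intro eventually_powr_le \<eta>(1) \<open>0 < \<epsilon> / 4\<close>)
  ultimately show ?thesis
  proof eventually_elim
    case (elim n)
    define \<theta> where "\<theta> = 2 powr (- (real n * (HA - \<eta>)))"
    define \<theta>' where "\<theta>' = 2 powr (- (real n * (HB + \<eta>)))"
    \<comment> \<open>The \<open>+ 1\<close> puts M above the power while M - 1 stays below it. If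
      HA < 2 * \<eta> and n is positive, then M = 1: there is no shared randomness and the deviation
      term is 0, although \<theta> may exceed 1.\<close>
    define M where "M = nat \<lfloor>2 powr (real n * (HA - 2 * \<eta>))\<rfloor> + 1"
    define L where "L = nat \<lfloor>2 powr (real n * R)\<rfloor>"
    \<comment> \<open>\<open>map2\<close> truncates, so side information of another length would
      break the bound 1 on the sum over words of length n. Weight 0 on a length mismatch restores it
      for every \<open>bs\<close>.\<close>
    define K where "K vs bs = (if length vs = length bs then prod_list (map2 post vs bs) else 0)" for vs bs
    let ?Pn = "replicate_pmf n P" and ?Jn = "replicate_pmf n J"
    have M1: "real (M - 1) \<le> 2 powr (real n * (HA - 2 * \<eta>))" "2 powr (real n * (HA - 2 * \<eta>)) \<le> real M" "0 < M"
    proof -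
      define x where "x = 2 powr (real n * (HA - 2 * \<eta>))"
      have "0 \<le> x" by (simp add: x_def)
      then have "real (nat \<lfloor>x\<rfloor>) = of_int \<lfloor>x\<rfloor>" by simp
      then have "real (nat \<lfloor>x\<rfloor>) \<le> x" "x \<le> real (nat \<lfloor>x\<rfloor> + 1)" by linarith+
      then show "real (M - 1) \<le> 2 powr (real n * (HA - 2 * \<eta>))" "2 powr (real n * (HA - 2 * \<eta>)) \<le> real M" "0 < M"
        unfolding M_def x_def[symmetric] by simp_all
    qed
    have one: "1 \<le> 2 powr (real n * R)" using R by (intro ge_one_powr_ge_zero) auto
    \<comment> \<open>Rounding a number that is at least 1 down to an integer loses at most half of
      it; this is the factor 2 in the collision term.\<close>
    have L1: "2 powr (real n * R) / 2 \<le> real L" "0 < L"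
    proof -
      define x where "x = 2 powr (real n * R)"
      have x: "1 \<le> x" using one by (simp add: x_def)
      then have "real (nat \<lfloor>x\<rfloor>) = of_int \<lfloor>x\<rfloor>" "1 \<le> \<lfloor>x\<rfloor>" by simp_all
      then have "x / 2 \<le> real (nat \<lfloor>x\<rfloor>)" "0 < nat \<lfloor>x\<rfloor>" by linarith+
      then show "2 powr (real n * R) / 2 \<le> real L" "0 < L"
        unfolding L_def x_def[symmetric] by simp_all
    qed
    have prod_w: "pmf (list_pmf (map W (map \<alpha> (map fst ts)))) (map snd ts) = prod_list (map w ts)" for ts
    proof -
      have "map2 pmf (map W (map \<alpha> (map fst ts))) (map snd ts) = map w ts"
        by (induction ts) (auto simp: w_def)
      then show ?thesis by (simp add: pmf_list_pmf)
    qed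
    have prod_k: "K (map snd ts) (map \<beta> (map fst ts)) = prod_list (map k ts)" for ts
    proof -
      have "map2 post (map snd ts) (map \<beta> (map fst ts)) = map k ts"
        by (induction ts) (auto simp: k_def)
      then show ?thesis by (simp add: K_def)
    qed
    have block: "(\<integral>\<^sup>+zs. emeasure (measure_pmf (list_pmf (map W (map \<alpha> zs)))) {vs. Q zs vs} \<partial>measure_pmf ?Pn)
       = emeasure (measure_pmf ?Jn) {ts. Q (map fst ts) (map snd ts)}" for Q
    proof -
      have "(\<integral>\<^sup>+zs. emeasure (measure_pmf (list_pmf (map W (map \<alpha> zs)))) {vs. Q zs vs} \<partial>measure_pmf ?Pn)
        = (\<integral>\<^sup>+zs. \<integral>\<^sup>+vs. of_bool (Q zs vs) \<partial>measure_pmf (list_pmf (map (\<lambda>z. W (\<alpha> z)) zs)) \<partial>measure_pmf ?Pn)"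
        by (simp add: nn_integral_of_bool o_def)
      also have "\<dots> = (\<integral>\<^sup>+ts. indicator {ts. Q (map fst ts) (map snd ts)} ts \<partial>measure_pmf ?Jn)"
        unfolding nn_integral_replicate_bind J_def channel_pmf_def by (simp add: indicator_def)
      finally show ?thesis by simp
    qed
    have "\<exists>\<Omega>. simulates ?Pn (map \<alpha>) (map \<beta>) (\<lambda>as. list_pmf (map W as)) \<epsilon> L \<Omega>"
    proof (rule simulates_random_binning[where A = "map \<alpha> ` {zs. length zs = n}" and B = "{vs. length vs = n}"
          and M = M and \<theta> = \<theta> and \<theta>' = \<theta>' and K = K and \<tau> = "\<epsilon> / 4" and \<tau>' = "\<epsilon> / 4"])
      show "finite (map \<alpha> ` {zs::'z list. length zs = n})" by (intro finite_imageI finite_lists_length)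
      show "finite {vs::'v list. length vs = n}" by (rule finite_lists_length)
      show "map \<alpha> zs \<in> map \<alpha> ` {zs. length zs = n}" if "zs \<in> set_pmf ?Pn" for zs
        using that by (auto simp: length_replicate_pmf)
      show "set_pmf (list_pmf (map W as)) \<subseteq> {vs. length vs = n}" if "as \<in> map \<alpha> ` {zs. length zs = n}" for as
        using that by (auto dest: length_list_pmf)
      show "0 < M" "0 < L" by fact+
      show "0 \<le> \<theta>" "0 < \<theta>'" by (simp_all add: \<theta>_def \<theta>'_def)
      show "0 \<le> K vs bs" for vs bs
        by (auto simp: K_def post_def posterior_nonneg intro!: prod_list_nonneg)
      show "(\<Sum>vs | length vs = n. K vs bs) \<le> 1" for bs
      proof (cases "length bs = n")
        case True
        then have "(\<Sum>vs | length vs = n. K vs bs) = (\<Sum>vs | length vs = length bs. prod_list (map2 post vs bs))"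
          by (intro sum.cong) (auto simp: K_def)
        also have "\<dots> \<le> 1"
          by (intro sum_lists_prod_le_1) (simp_all add: post_def posterior_nonneg sum_posterior_le_1)
        finally show ?thesis .
      next
        case False
        then have "(\<Sum>vs | length vs = n. K vs bs) = 0" by (intro sum.neutral) (auto simp: K_def)
        then show ?thesis by simp
      qed
      show "0 \<le> \<epsilon> / 4" "0 \<le> \<epsilon> / 4" using \<epsilon> by auto
      show "(\<integral>\<^sup>+zs. emeasure (measure_pmf (list_pmf (map W (map \<alpha> zs)))) {vs. \<theta> < pmf (list_pmf (map W (map \<alpha> zs))) vs} \<partial>measure_pmf ?Pn)
         \<le> ennreal (\<epsilon> / 4)"
        unfolding block prod_w unfolding measure_pmf.emeasure_eq_measure \<theta>_def
        by (intro ennreal_leI order_trans[OF measure_pmf.finite_measure_mono elim(1)]) auto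
      show "(\<integral>\<^sup>+zs. emeasure (measure_pmf (list_pmf (map W (map \<alpha> zs)))) {vs. K vs (map \<beta> zs) < \<theta>'} \<partial>measure_pmf ?Pn)
         \<le> ennreal (\<epsilon> / 4)"
        unfolding block prod_k unfolding measure_pmf.emeasure_eq_measure \<theta>'_def
        by (intro ennreal_leI order_trans[OF measure_pmf.finite_measure_mono elim(2)]) auto
      have "sqrt (real (M - 1) * \<theta>) \<le> sqrt (2 powr (real n * (HA - 2 * \<eta>)) * \<theta>)"
        using M1(1) by (intro real_sqrt_le_mono mult_right_mono) (auto simp: \<theta>_def)
      also have "\<dots> = 2 powr (- (real n * (\<eta> / 2)))"
        by (simp add: \<theta>_def powr_half_sqrt[symmetric] powr_powr algebra_simps flip: powr_add)
      finally have 1: "sqrt (real (M - 1) * \<theta>) \<le> \<epsilon> / 4" using elim(3) by simp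
      have "2 powr (real n * \<eta>) / 2 = \<theta>' * 2 powr (real n * (HA - 2 * \<eta>)) * (2 powr (real n * R) / 2)"
        by (simp add: \<theta>'_def \<eta>(2) algebra_simps flip: powr_add)
      also have "\<dots> \<le> \<theta>' * real M * real L"
        using M1(2) L1(1) by (intro mult_mono mult_nonneg_nonneg) (auto simp: \<theta>'_def)
      finally have "1 / (\<theta>' * real M * real L) \<le> 1 / (2 powr (real n * \<eta>) / 2)"
        by (intro divide_left_mono) (auto simp: \<theta>'_def M1 L1)
      also have "\<dots> = 2 * 2 powr (- (real n * \<eta>))" by (simp add: powr_minus divide_simps)
      finally have 2: "1 / (\<theta>' * real M * real L) \<le> \<epsilon> / 4" using elim(4) by simp
      show "sqrt (real (M - 1) * \<theta>) + \<epsilon> / 4 + \<epsilon> / 4 + 1 / (\<theta>' * real M * real L) \<le> \<epsilon>"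
        using 1 2 by simp
    qed
    then show ?case by (simp add: L_def)
  qed
qed

section \<open>Composition of the three simulations\<close>

lemma nn_integral_replicate_channel:
  "(\<integral>\<^sup>+t. h (map fst t) (map snd t) \<partial>measure_pmf (replicate_pmf n (channel_pmf P \<kappa>)))
    = (\<integral>\<^sup>+zs. \<integral>\<^sup>+vs. h zs vs \<partial>measure_pmf (list_pmf (map \<kappa> zs)) \<partial>measure_pmf (replicate_pmf n P))"
  unfolding channel_pmf_def nn_integral_replicate_bind ..

lemma simulatesD:
  assumes "simulates P \<alpha> \<beta> W \<epsilon> L \<Omega>"
  shows "\<And>\<omega> a. \<omega> \<in> set_pmf \<Omega> \<Longrightarrow> fst (snd \<omega>) a \<in> {1..L}"
    and "\<And>h. (\<And>z v. h z v \<le> 1) \<Longrightarrow> (\<integral>\<^sup>+\<omega>. \<integral>\<^sup>+z. h z (fst \<omega> (\<alpha> z)) \<partial>measure_pmf P \<partial>measure_pmf \<Omega>)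
          \<le> (\<integral>\<^sup>+z. \<integral>\<^sup>+v. h z v \<partial>measure_pmf (W (\<alpha> z)) \<partial>measure_pmf P) + ennreal \<epsilon>"
    and "(\<integral>\<^sup>+\<omega>. \<integral>\<^sup>+z. of_bool (snd (snd \<omega>) (\<beta> z) (fst (snd \<omega>) (\<alpha> z)) \<noteq> fst \<omega> (\<alpha> z)) \<partial>measure_pmf P \<partial>measure_pmf \<Omega>)
       \<le> ennreal \<epsilon>"
  using assms unfolding simulates_def case_prod_unfold by blast+

lemma nn_integral_pmf_le_1: "(\<And>z. h z \<le> 1) \<Longrightarrow> (\<integral>\<^sup>+z. h z \<partial>measure_pmf p) \<le> 1"
  using nn_integral_mono[of "measure_pmf p" h "\<lambda>_. 1"] by simp

lemma nn_integral_pmf_witness: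
  assumes "(\<integral>\<^sup>+\<omega>. f \<omega> \<partial>measure_pmf \<Omega>) \<le> c" "c \<noteq> \<infinity>"
  shows "\<exists>\<omega>\<in>set_pmf \<Omega>. f \<omega> \<le> c"
proof (rule ccontr)
  assume "\<not> ?thesis"
  then have less: "c < f \<omega>" if "\<omega> \<in> set_pmf \<Omega>" for \<omega> using that by (auto simp: not_le)
  obtain \<omega> where \<omega>: "\<omega> \<in> set_pmf \<Omega>" using set_pmf_not_empty[of \<Omega>] by blast
  have "(\<integral>\<^sup>+\<omega>. c \<partial>measure_pmf \<Omega>) < (\<integral>\<^sup>+\<omega>. f \<omega> \<partial>measure_pmf \<Omega>)"
    using assms(2) less \<omega>
    by (intro nn_integral_less) (auto intro!: AE_pmfI less_imp_le simp: AE_measure_pmf_iff not_le)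
  then show False using assms(1) by simp
qed

lemma map_replicate_pmf: "map_pmf (map f) (replicate_pmf n Q) = replicate_pmf n (map_pmf f Q)"
proof (induction n)
  case (Suc n)
  show ?case by (simp add: Suc[symmetric] map_bind_pmf bind_map_pmf)
qed simp

lemma map_fst_channel_pmf: "map_pmf fst (channel_pmf P \<kappa>) = P"
  by (simp add: channel_pmf_def map_bind_pmf bind_return_pmf')

text \<open>The word of one party is simulated over the source extended by the word of the other
  party, since the latter is part of the side information. In the first estimate the extension is
  integrated out, as the selected word does not depend on it. In the second it appears as a word
  drawn from its exact channel \<kappa>.\<close>

lemma simulates_replicate_channelD:
  fixes P :: "'z pmf" and \<kappa> :: "'z \<Rightarrow> 'w pmf" and \<alpha> :: "'z \<Rightarrow> 'a" and W :: "'a \<Rightarrow> 'v pmf"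
  assumes sim: "simulates (replicate_pmf n (channel_pmf P \<kappa>)) (map (\<alpha> \<circ> fst)) (map \<beta>) (\<lambda>as. list_pmf (map W as)) \<epsilon> L \<Omega>"
  shows "\<And>h. (\<And>zs vs. h zs vs \<le> 1) \<Longrightarrow>
      (\<integral>\<^sup>+\<omega>. \<integral>\<^sup>+zs. h zs (fst \<omega> (map \<alpha> zs)) \<partial>measure_pmf (replicate_pmf n P) \<partial>measure_pmf \<Omega>)
       \<le> (\<integral>\<^sup>+zs. \<integral>\<^sup>+vs. h zs vs \<partial>measure_pmf (list_pmf (map W (map \<alpha> zs))) \<partial>measure_pmf (replicate_pmf n P)) + ennreal \<epsilon>"
    and "(\<And>z v. \<beta> (z, v) = (\<gamma> z, v)) \<Longrightarrow>
      (\<integral>\<^sup>+\<omega>. \<integral>\<^sup>+zs. \<integral>\<^sup>+vs. of_bool (snd (snd \<omega>) (zip (map \<gamma> zs) vs) (fst (snd \<omega>) (map \<alpha> zs)) \<noteq> fst \<omega> (map \<alpha> zs))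
         \<partial>measure_pmf (list_pmf (map \<kappa> zs)) \<partial>measure_pmf (replicate_pmf n P) \<partial>measure_pmf \<Omega>) \<le> ennreal \<epsilon>"
proof -
  fix h :: "'z list \<Rightarrow> 'v list \<Rightarrow> ennreal" assume h: "\<And>zs vs. h zs vs \<le> 1"
  have eq: "replicate_pmf n P = map_pmf (map fst) (replicate_pmf n (channel_pmf P \<kappa>))"
    by (simp add: map_replicate_pmf map_fst_channel_pmf)
  show "(\<integral>\<^sup>+\<omega>. \<integral>\<^sup>+zs. h zs (fst \<omega> (map \<alpha> zs)) \<partial>measure_pmf (replicate_pmf n P) \<partial>measure_pmf \<Omega>)
       \<le> (\<integral>\<^sup>+zs. \<integral>\<^sup>+vs. h zs vs \<partial>measure_pmf (list_pmf (map W (map \<alpha> zs))) \<partial>measure_pmf (replicate_pmf n P)) + ennreal \<epsilon>"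
    using simulatesD(2)[OF sim, of "\<lambda>t. h (map fst t)", OF h]
    unfolding eq nn_integral_map_pmf map_map[symmetric] .
next
  assume \<beta>: "\<And>z v. \<beta> (z, v) = (\<gamma> z, v)"
  have zip: "map \<beta> t = zip (map \<gamma> (map fst t)) (map snd t)" for t
    by (induction t) (auto simp: \<beta>)
  show "(\<integral>\<^sup>+\<omega>. \<integral>\<^sup>+zs. \<integral>\<^sup>+vs. of_bool (snd (snd \<omega>) (zip (map \<gamma> zs) vs) (fst (snd \<omega>) (map \<alpha> zs)) \<noteq> fst \<omega> (map \<alpha> zs))
         \<partial>measure_pmf (list_pmf (map \<kappa> zs)) \<partial>measure_pmf (replicate_pmf n P) \<partial>measure_pmf \<Omega>) \<le> ennreal \<epsilon>"
    using simulatesD(3)[OF sim] unfolding zip map_map[symmetric]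
    by (subst nn_integral_cong[OF nn_integral_replicate_channel[symmetric]])
qed


text \<open>
  \<open>G1\<close> and \<open>G2\<close> are the decoded versions of \<open>F1\<close> and \<open>F2\<close>. The first two words given to \<open>G3\<close> are
  those of the decoder, the last two those of the encoder.
\<close>

lemma compose_simulations:
  fixes Z :: "'z pmf" and K1 :: "'z \<Rightarrow> 'v1 pmf" and K2 :: "'z \<Rightarrow> 'v2 pmf" and K3 :: "'z \<Rightarrow> 'v1 \<Rightarrow> 'v2 \<Rightarrow> 'u pmf"
    and F1 :: "'o1 \<Rightarrow> 'z \<Rightarrow> 'v1" and F2 :: "'o2 \<Rightarrow> 'z \<Rightarrow> 'v2" and F3 :: "'o3 \<Rightarrow> 'z \<Rightarrow> 'v1 \<Rightarrow> 'v2 \<Rightarrow> 'u"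
    and \<Omega>1 :: "'o1 pmf" and \<Omega>2 :: "'o2 pmf" and \<Omega>3 :: "'o3 pmf" and e :: ennreal
  assumes A1: "\<And>h. (\<And>z v. h z v \<le> 1) \<Longrightarrow>
      (\<integral>\<^sup>+o1. \<integral>\<^sup>+z. h z (F1 o1 z) \<partial>Z \<partial>\<Omega>1) \<le> (\<integral>\<^sup>+z. \<integral>\<^sup>+v. h z v \<partial>K1 z \<partial>Z) + e"
    and A2: "\<And>h. (\<And>z v. h z v \<le> 1) \<Longrightarrow>
      (\<integral>\<^sup>+o2. \<integral>\<^sup>+z. h z (F2 o2 z) \<partial>Z \<partial>\<Omega>2) \<le> (\<integral>\<^sup>+z. \<integral>\<^sup>+v. h z v \<partial>K2 z \<partial>Z) + e"
    and A3: "\<And>h. (\<And>z v1 v2 u. h z v1 v2 u \<le> 1) \<Longrightarrow>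
      (\<integral>\<^sup>+o3. \<integral>\<^sup>+z. \<integral>\<^sup>+v1. \<integral>\<^sup>+v2. h z v1 v2 (F3 o3 z v1 v2) \<partial>K2 z \<partial>K1 z \<partial>Z \<partial>\<Omega>3)
       \<le> (\<integral>\<^sup>+z. \<integral>\<^sup>+v1. \<integral>\<^sup>+v2. \<integral>\<^sup>+u. h z v1 v2 u \<partial>K3 z v1 v2 \<partial>K2 z \<partial>K1 z \<partial>Z) + e"
    and B1: "(\<integral>\<^sup>+o1. \<integral>\<^sup>+z. \<integral>\<^sup>+v2. of_bool (G1 o1 z v2 \<noteq> F1 o1 z) \<partial>K2 z \<partial>Z \<partial>\<Omega>1) \<le> e"
    and B2: "(\<integral>\<^sup>+o2. \<integral>\<^sup>+z. \<integral>\<^sup>+v1. of_bool (G2 o2 z v1 \<noteq> F2 o2 z) \<partial>K1 z \<partial>Z \<partial>\<Omega>2) \<le> e"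
    and B3: "(\<integral>\<^sup>+o3. \<integral>\<^sup>+z. \<integral>\<^sup>+v1. \<integral>\<^sup>+v2. of_bool (G3 o3 z v1 v2 v1 v2 \<noteq> F3 o3 z v1 v2) \<partial>K2 z \<partial>K1 z \<partial>Z \<partial>\<Omega>3) \<le> e"
    and C: "\<And>z v1 v2 u. C z v1 v2 u \<le> (1::ennreal)"
  shows "(\<integral>\<^sup>+o1. \<integral>\<^sup>+o2. \<integral>\<^sup>+o3. \<integral>\<^sup>+z.
      C z (G1 o1 z (F2 o2 z)) (F2 o2 z)
        (G3 o3 z (G1 o1 z (F2 o2 z)) (F2 o2 z) (F1 o1 z) (G2 o2 z (F1 o1 z))) \<partial>Z \<partial>\<Omega>3 \<partial>\<Omega>2 \<partial>\<Omega>1)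
    \<le> (\<integral>\<^sup>+z. \<integral>\<^sup>+v1. \<integral>\<^sup>+v2. \<integral>\<^sup>+u. C z v1 v2 u \<partial>K3 z v1 v2 \<partial>K2 z \<partial>K1 z \<partial>Z) + 10 * e"
proof -
  \<comment> \<open>The words are exchanged for exact ones in turn. While one is exchanged, the
    other is part of the test function, which is why simulation is stated jointly with
    \<open>z\<close>.\<close>
  have R12: "(\<integral>\<^sup>+o1. \<integral>\<^sup>+o2. \<integral>\<^sup>+z. h z (F1 o1 z) (F2 o2 z) \<partial>Z \<partial>\<Omega>2 \<partial>\<Omega>1)
      \<le> (\<integral>\<^sup>+z. \<integral>\<^sup>+v1. \<integral>\<^sup>+v2. h z v1 v2 \<partial>K2 z \<partial>K1 z \<partial>Z) + 2 * e"
    if h: "\<And>z v1 v2. h z v1 v2 \<le> 1" for h :: "'z \<Rightarrow> 'v1 \<Rightarrow> 'v2 \<Rightarrow> ennreal"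
  proof -
    have "(\<integral>\<^sup>+o1. \<integral>\<^sup>+o2. \<integral>\<^sup>+z. h z (F1 o1 z) (F2 o2 z) \<partial>Z \<partial>\<Omega>2 \<partial>\<Omega>1)
      = (\<integral>\<^sup>+o2. \<integral>\<^sup>+o1. \<integral>\<^sup>+z. h z (F1 o1 z) (F2 o2 z) \<partial>Z \<partial>\<Omega>1 \<partial>\<Omega>2)"
      by (rule nn_integral_commute_pmf)
    also have "\<dots> \<le> (\<integral>\<^sup>+o2. (\<integral>\<^sup>+z. \<integral>\<^sup>+v1. h z v1 (F2 o2 z) \<partial>K1 z \<partial>Z) + e \<partial>\<Omega>2)"
      by (intro nn_integral_mono A1 h)
    also have "\<dots> = (\<integral>\<^sup>+o2. \<integral>\<^sup>+z. \<integral>\<^sup>+v1. h z v1 (F2 o2 z) \<partial>K1 z \<partial>Z \<partial>\<Omega>2) + e"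
      by (simp add: nn_integral_add)
    also have "\<dots> \<le> (\<integral>\<^sup>+z. \<integral>\<^sup>+v2. \<integral>\<^sup>+v1. h z v1 v2 \<partial>K1 z \<partial>K2 z \<partial>Z) + e + e"
      by (intro add_mono order.refl A2 nn_integral_pmf_le_1 h)
    also have "\<dots> = (\<integral>\<^sup>+z. \<integral>\<^sup>+v1. \<integral>\<^sup>+v2. h z v1 v2 \<partial>K2 z \<partial>K1 z \<partial>Z) + 2 * e"
      by (subst nn_integral_commute_pmf) (simp add: add.assoc mult_2)
    finally show ?thesis .
  qed
  let ?E1 = "\<lambda>o1 o2 z. of_bool (G1 o1 z (F2 o2 z) \<noteq> F1 o1 z) :: ennreal"
  let ?E2 = "\<lambda>o1 o2 z. of_bool (G2 o2 z (F1 o1 z) \<noteq> F2 o2 z) :: ennreal"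
  let ?E3 = "\<lambda>o3 z v1 v2. of_bool (G3 o3 z v1 v2 v1 v2 \<noteq> F3 o3 z v1 v2) :: ennreal"
  let ?C0 = "\<lambda>o3 z v1 v2. C z v1 v2 (F3 o3 z v1 v2)"
  have "(\<integral>\<^sup>+o1. \<integral>\<^sup>+o2. \<integral>\<^sup>+o3. \<integral>\<^sup>+z. C z (G1 o1 z (F2 o2 z)) (F2 o2 z)
        (G3 o3 z (G1 o1 z (F2 o2 z)) (F2 o2 z) (F1 o1 z) (G2 o2 z (F1 o1 z))) \<partial>Z \<partial>\<Omega>3 \<partial>\<Omega>2 \<partial>\<Omega>1)
    \<le> (\<integral>\<^sup>+o1. \<integral>\<^sup>+o2. \<integral>\<^sup>+o3. \<integral>\<^sup>+z. ?C0 o3 z (F1 o1 z) (F2 o2 z) + ?E1 o1 o2 z + ?E2 o1 o2 z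
          + ?E3 o3 z (F1 o1 z) (F2 o2 z) \<partial>Z \<partial>\<Omega>3 \<partial>\<Omega>2 \<partial>\<Omega>1)"
  proof (intro nn_integral_mono)
    fix o1 o2 o3 z
    let ?c = "C z (G1 o1 z (F2 o2 z)) (F2 o2 z) (G3 o3 z (G1 o1 z (F2 o2 z)) (F2 o2 z) (F1 o1 z) (G2 o2 z (F1 o1 z)))"
    show "?c \<le> ?C0 o3 z (F1 o1 z) (F2 o2 z) + ?E1 o1 o2 z + ?E2 o1 o2 z + ?E3 o3 z (F1 o1 z) (F2 o2 z)"
    proof (cases "G1 o1 z (F2 o2 z) = F1 o1 z \<and> G2 o2 z (F1 o1 z) = F2 o2 z \<and>
        G3 o3 z (F1 o1 z) (F2 o2 z) (F1 o1 z) (F2 o2 z) = F3 o3 z (F1 o1 z) (F2 o2 z)")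
      \<comment> \<open>If some decoding fails, one of the three error indicators is 1 and pays for
        the whole cost. If all succeed, the cost is that of the true words.\<close>
      case False
      have "?c \<le> 1" by (rule C)
      also have "1 \<le> ?E1 o1 o2 z + ?E2 o1 o2 z + ?E3 o3 z (F1 o1 z) (F2 o2 z)"
        using False by auto
      also have "\<dots> \<le> ?C0 o3 z (F1 o1 z) (F2 o2 z) + (?E1 o1 o2 z + ?E2 o1 o2 z + ?E3 o3 z (F1 o1 z) (F2 o2 z))"
        by (rule add_increasing) simp_all
      finally show ?thesis by (simp only: add.assoc)
    qed simp
  qed
  also have "\<dots> = (\<integral>\<^sup>+o1. \<integral>\<^sup>+o2. \<integral>\<^sup>+o3. \<integral>\<^sup>+z. ?C0 o3 z (F1 o1 z) (F2 o2 z) \<partial>Z \<partial>\<Omega>3 \<partial>\<Omega>2 \<partial>\<Omega>1)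
      + (\<integral>\<^sup>+o1. \<integral>\<^sup>+o2. \<integral>\<^sup>+z. ?E1 o1 o2 z \<partial>Z \<partial>\<Omega>2 \<partial>\<Omega>1)
      + (\<integral>\<^sup>+o1. \<integral>\<^sup>+o2. \<integral>\<^sup>+z. ?E2 o1 o2 z \<partial>Z \<partial>\<Omega>2 \<partial>\<Omega>1)
      + (\<integral>\<^sup>+o1. \<integral>\<^sup>+o2. \<integral>\<^sup>+o3. \<integral>\<^sup>+z. ?E3 o3 z (F1 o1 z) (F2 o2 z) \<partial>Z \<partial>\<Omega>3 \<partial>\<Omega>2 \<partial>\<Omega>1)"
    by (simp add: nn_integral_add)
  \<comment> \<open>The budget: making V1 and V2 exact costs 2 * e for the true cost and for the
    error of U, each of which then takes one more e. The error of V1 costs e for making V2 exact and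
    e for decoding, and symmetrically for V2. In total 3 + 2 + 2 + 3 = 10.\<close>
  also have "\<dots> \<le> ((\<integral>\<^sup>+z. \<integral>\<^sup>+v1. \<integral>\<^sup>+v2. \<integral>\<^sup>+u. C z v1 v2 u \<partial>K3 z v1 v2 \<partial>K2 z \<partial>K1 z \<partial>Z) + 3 * e)
      + 2 * e + 2 * e + 3 * e"
  proof (intro add_mono)
    have lift: "(\<integral>\<^sup>+o1. \<integral>\<^sup>+o2. \<integral>\<^sup>+o3. \<integral>\<^sup>+z. h o3 z (F1 o1 z) (F2 o2 z) \<partial>Z \<partial>\<Omega>3 \<partial>\<Omega>2 \<partial>\<Omega>1)
       \<le> (\<integral>\<^sup>+o3. \<integral>\<^sup>+z. \<integral>\<^sup>+v1. \<integral>\<^sup>+v2. h o3 z v1 v2 \<partial>K2 z \<partial>K1 z \<partial>Z \<partial>\<Omega>3) + 2 * e"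
      if h: "\<And>o3 z v1 v2. h o3 z v1 v2 \<le> 1" for h :: "'o3 \<Rightarrow> 'z \<Rightarrow> 'v1 \<Rightarrow> 'v2 \<Rightarrow> ennreal"
    proof -
      have "(\<integral>\<^sup>+o1. \<integral>\<^sup>+o2. \<integral>\<^sup>+o3. \<integral>\<^sup>+z. h o3 z (F1 o1 z) (F2 o2 z) \<partial>Z \<partial>\<Omega>3 \<partial>\<Omega>2 \<partial>\<Omega>1)
        = (\<integral>\<^sup>+o3. \<integral>\<^sup>+o1. \<integral>\<^sup>+o2. \<integral>\<^sup>+z. h o3 z (F1 o1 z) (F2 o2 z) \<partial>Z \<partial>\<Omega>2 \<partial>\<Omega>1 \<partial>\<Omega>3)"
        by (simp only: nn_integral_commute_pmf[where B = \<Omega>3])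
      also have "\<dots> \<le> (\<integral>\<^sup>+o3. (\<integral>\<^sup>+z. \<integral>\<^sup>+v1. \<integral>\<^sup>+v2. h o3 z v1 v2 \<partial>K2 z \<partial>K1 z \<partial>Z) + 2 * e \<partial>\<Omega>3)"
        by (intro nn_integral_mono R12 h)
      also have "\<dots> = (\<integral>\<^sup>+o3. \<integral>\<^sup>+z. \<integral>\<^sup>+v1. \<integral>\<^sup>+v2. h o3 z v1 v2 \<partial>K2 z \<partial>K1 z \<partial>Z \<partial>\<Omega>3) + 2 * e"
        by (simp add: nn_integral_add)
      finally show ?thesis .
    qed
    have e3: "e + 2 * e = 3 * e" by (simp add: distrib_right[symmetric, of 1 e 2, simplified])
    have "(\<integral>\<^sup>+o1. \<integral>\<^sup>+o2. \<integral>\<^sup>+o3. \<integral>\<^sup>+z. ?C0 o3 z (F1 o1 z) (F2 o2 z) \<partial>Z \<partial>\<Omega>3 \<partial>\<Omega>2 \<partial>\<Omega>1)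
      \<le> (\<integral>\<^sup>+o3. \<integral>\<^sup>+z. \<integral>\<^sup>+v1. \<integral>\<^sup>+v2. ?C0 o3 z v1 v2 \<partial>K2 z \<partial>K1 z \<partial>Z \<partial>\<Omega>3) + 2 * e"
      by (rule lift[OF C])
    also have "\<dots> \<le> (\<integral>\<^sup>+z. \<integral>\<^sup>+v1. \<integral>\<^sup>+v2. \<integral>\<^sup>+u. C z v1 v2 u \<partial>K3 z v1 v2 \<partial>K2 z \<partial>K1 z \<partial>Z) + e + 2 * e"
      by (intro add_mono order.refl A3 C)
    finally show "(\<integral>\<^sup>+o1. \<integral>\<^sup>+o2. \<integral>\<^sup>+o3. \<integral>\<^sup>+z. ?C0 o3 z (F1 o1 z) (F2 o2 z) \<partial>Z \<partial>\<Omega>3 \<partial>\<Omega>2 \<partial>\<Omega>1)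
      \<le> (\<integral>\<^sup>+z. \<integral>\<^sup>+v1. \<integral>\<^sup>+v2. \<integral>\<^sup>+u. C z v1 v2 u \<partial>K3 z v1 v2 \<partial>K2 z \<partial>K1 z \<partial>Z) + 3 * e"
      by (simp only: add.assoc e3)
    have "(\<integral>\<^sup>+o1. \<integral>\<^sup>+o2. \<integral>\<^sup>+z. ?E1 o1 o2 z \<partial>Z \<partial>\<Omega>2 \<partial>\<Omega>1)
      = (\<integral>\<^sup>+o2. \<integral>\<^sup>+z. \<integral>\<^sup>+o1. ?E1 o1 o2 z \<partial>\<Omega>1 \<partial>Z \<partial>\<Omega>2)"
      by (simp only: nn_integral_commute_pmf[where A = \<Omega>1])
    also have "\<dots> \<le> (\<integral>\<^sup>+z. \<integral>\<^sup>+v2. \<integral>\<^sup>+o1. of_bool (G1 o1 z v2 \<noteq> F1 o1 z) \<partial>\<Omega>1 \<partial>K2 z \<partial>Z) + e"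
      by (rule A2) (intro nn_integral_pmf_le_1, simp)
    also have "\<dots> = (\<integral>\<^sup>+o1. \<integral>\<^sup>+z. \<integral>\<^sup>+v2. of_bool (G1 o1 z v2 \<noteq> F1 o1 z) \<partial>K2 z \<partial>Z \<partial>\<Omega>1) + e"
      by (simp only: nn_integral_commute_pmf[where A = \<Omega>1])
    also have "\<dots> \<le> e + e" by (intro add_mono B1 order.refl)
    finally show "(\<integral>\<^sup>+o1. \<integral>\<^sup>+o2. \<integral>\<^sup>+z. ?E1 o1 o2 z \<partial>Z \<partial>\<Omega>2 \<partial>\<Omega>1) \<le> 2 * e" by (simp add: mult_2)
    have "(\<integral>\<^sup>+o1. \<integral>\<^sup>+o2. \<integral>\<^sup>+z. ?E2 o1 o2 z \<partial>Z \<partial>\<Omega>2 \<partial>\<Omega>1)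
      = (\<integral>\<^sup>+o1. \<integral>\<^sup>+z. \<integral>\<^sup>+o2. ?E2 o1 o2 z \<partial>\<Omega>2 \<partial>Z \<partial>\<Omega>1)"
      by (simp only: nn_integral_commute_pmf[where A = \<Omega>2])
    also have "\<dots> \<le> (\<integral>\<^sup>+z. \<integral>\<^sup>+v1. \<integral>\<^sup>+o2. of_bool (G2 o2 z v1 \<noteq> F2 o2 z) \<partial>\<Omega>2 \<partial>K1 z \<partial>Z) + e"
      by (rule A1) (intro nn_integral_pmf_le_1, simp)
    also have "\<dots> = (\<integral>\<^sup>+o2. \<integral>\<^sup>+z. \<integral>\<^sup>+v1. of_bool (G2 o2 z v1 \<noteq> F2 o2 z) \<partial>K1 z \<partial>Z \<partial>\<Omega>2) + e"
      by (simp only: nn_integral_commute_pmf[where A = \<Omega>2])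
    also have "\<dots> \<le> e + e" by (intro add_mono B2 order.refl)
    finally show "(\<integral>\<^sup>+o1. \<integral>\<^sup>+o2. \<integral>\<^sup>+z. ?E2 o1 o2 z \<partial>Z \<partial>\<Omega>2 \<partial>\<Omega>1) \<le> 2 * e" by (simp add: mult_2)
    have "(\<integral>\<^sup>+o1. \<integral>\<^sup>+o2. \<integral>\<^sup>+o3. \<integral>\<^sup>+z. ?E3 o3 z (F1 o1 z) (F2 o2 z) \<partial>Z \<partial>\<Omega>3 \<partial>\<Omega>2 \<partial>\<Omega>1)
      \<le> (\<integral>\<^sup>+o3. \<integral>\<^sup>+z. \<integral>\<^sup>+v1. \<integral>\<^sup>+v2. ?E3 o3 z v1 v2 \<partial>K2 z \<partial>K1 z \<partial>Z \<partial>\<Omega>3) + 2 * e"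
      by (rule lift) simp
    also have "\<dots> \<le> e + 2 * e" by (intro add_mono B3 order.refl)
    finally show "(\<integral>\<^sup>+o1. \<integral>\<^sup>+o2. \<integral>\<^sup>+o3. \<integral>\<^sup>+z. ?E3 o3 z (F1 o1 z) (F2 o2 z) \<partial>Z \<partial>\<Omega>3 \<partial>\<Omega>2 \<partial>\<Omega>1) \<le> 3 * e"
      by (simp only: e3)
  qed
  also have "\<dots> = (\<integral>\<^sup>+z. \<integral>\<^sup>+v1. \<integral>\<^sup>+v2. \<integral>\<^sup>+u. C z v1 v2 u \<partial>K3 z v1 v2 \<partial>K2 z \<partial>K1 z \<partial>Z) + 10 * e"
    by (simp add: add.assoc flip: distrib_right)
  finally show ?thesis .
qed

section \<open>The block code\<close>

abbreviation "srcX \<equiv> (\<lambda>(x, s1, s2). x)"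
abbreviation "srcS1 \<equiv> (\<lambda>(x, s1, s2). s1)"
abbreviation "srcS2 \<equiv> (\<lambda>(x, s1, s2). s2)"

lemma messages_eq: "messages n R = {1..nat \<lfloor>2 powr (real n * R)\<rfloor>}"
proof -
  have "real j \<le> 2 powr (real n * R) \<longleftrightarrow> j \<le> nat \<lfloor>2 powr (real n * R)\<rfloor>" for j
    using le_nat_floor[of j] of_nat_floor[of "2 powr (real n * R)"] by (meson of_nat_le_iff order_trans powr_ge_zero)
  then show ?thesis unfolding messages_def by (simp add: atLeastAtMost_def atLeast_def atMost_def Collect_conj_eq)
qed

lemma nn_integral_sum_list_replicate_pmf:
  "(\<integral>\<^sup>+ts. sum_list (map g ts) \<partial>measure_pmf (replicate_pmf n Q)) = of_nat n * (\<integral>\<^sup>+t. g t \<partial>measure_pmf Q)"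
  by (induction n) (simp_all add: nn_integral_add distrib_right)

lemma avg_distortion_eq_sum_list:
  assumes "length ts = n"
  shows "avg_distortion d n (map a ts) (map (\<lambda>i. b (ts ! i)) [0..<n]) = sum_list (map (\<lambda>t. d (a t) (b t)) ts) / n"
  using assms by (simp add: avg_distortion_def sum_list_sum_nth atLeast0LessThan)

lemma avg_distortion_bounds:
  assumes "0 < n" "\<And>x y. 0 \<le> d x y" "\<And>x y. d x y \<le> dm"
  shows "0 \<le> avg_distortion d n xs ys" "avg_distortion d n xs ys \<le> dm"
proof -
  have "(\<Sum>i<n. d (xs ! i) (ys ! i)) \<le> (\<Sum>i<n. dm)" by (intro sum_mono assms)
  then show "0 \<le> avg_distortion d n xs ys" "avg_distortion d n xs ys \<le> dm"
    using assms by (auto simp: avg_distortion_def divide_le_eq mult.commute intro!: sum_nonneg divide_nonneg_nonneg)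
qed

definition src_aux ::
  "('x \<times> 's1 \<times> 's2) pmf \<Rightarrow> ('s1 \<Rightarrow> 'v1 pmf) \<Rightarrow> ('s2 \<Rightarrow> 'v2 pmf) \<Rightarrow> ((('x \<times> 's1 \<times> 's2) \<times> 'v1) \<times> 'v2) pmf" where
  "src_aux p pv1 pv2 = channel_pmf (channel_pmf p (\<lambda>z. pv1 (srcS1 z))) (\<lambda>t. pv2 (srcS2 (fst t)))"

definition enc_view :: "(('x \<times> 's1 \<times> 's2) \<times> 'v1) \<times> 'v2 \<Rightarrow> ('x \<times> 's1) \<times> ('v1 \<times> 'v2)" where
  "enc_view = (\<lambda>(((x, s1, s2), v1), v2). ((x, s1), (v1, v2)))"

definition dec_view :: "(('x \<times> 's1 \<times> 's2) \<times> 'v1) \<times> 'v2 \<Rightarrow> 's2 \<times> ('v1 \<times> 'v2)" where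
  "dec_view = (\<lambda>(((x, s1, s2), v1), v2). (s2, (v1, v2)))"

lemma map_views:
  "map enc_view t = zip (zip (map srcX (map fst (map fst t))) (map srcS1 (map fst (map fst t)))) (zip (map snd (map fst t)) (map snd t))"
  "map dec_view t = zip (map srcS2 (map fst (map fst t))) (zip (map snd (map fst t)) (map snd t))"
  by (induction t) (auto simp: enc_view_def dec_view_def)

lemma nn_integral_replicate_src_aux:
  "(\<integral>\<^sup>+zs. \<integral>\<^sup>+v1. \<integral>\<^sup>+v2. h zs v1 v2 \<partial>measure_pmf (list_pmf (map pv2 (map srcS2 zs)))
        \<partial>measure_pmf (list_pmf (map pv1 (map srcS1 zs))) \<partial>measure_pmf (replicate_pmf n p))
    = (\<integral>\<^sup>+t. h (map fst (map fst t)) (map snd (map fst t)) (map snd t) \<partial>measure_pmf (replicate_pmf n (src_aux p pv1 pv2)))"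
proof -
  have "(\<integral>\<^sup>+t. h (map fst (map fst t)) (map snd (map fst t)) (map snd t) \<partial>measure_pmf (replicate_pmf n (src_aux p pv1 pv2)))
    = (\<integral>\<^sup>+t. \<integral>\<^sup>+v2. h (map fst t) (map snd t) v2 \<partial>measure_pmf (list_pmf (map pv2 (map srcS2 (map fst t))))
        \<partial>measure_pmf (replicate_pmf n (channel_pmf p (\<lambda>z. pv1 (srcS1 z)))))"
    unfolding src_aux_def
    by (subst nn_integral_replicate_channel[where h = "\<lambda>t v2. h (map fst t) (map snd t) v2"])
       (simp add: o_def)
  also have "\<dots> = (\<integral>\<^sup>+zs. \<integral>\<^sup>+v1. \<integral>\<^sup>+v2. h zs v1 v2 \<partial>measure_pmf (list_pmf (map pv2 (map srcS2 zs)))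
        \<partial>measure_pmf (list_pmf (map pv1 (map srcS1 zs))) \<partial>measure_pmf (replicate_pmf n p))"
    by (subst nn_integral_replicate_channel[where h = "\<lambda>zs v1. \<integral>\<^sup>+v2. h zs v1 v2 \<partial>measure_pmf (list_pmf (map pv2 (map srcS2 zs)))"])
       (simp add: o_def)
  finally show ?thesis by simp
qed

text \<open>The side information is (S2, V2) for V1, ((X, S1), V1) for V2, and (S2, V1, V2) for U;
  this determines the three excess rates. A bound on the distortion measure is required because the
  simulations control expectations of bounded functions only.\<close>

lemma eventually_is_code:
  fixes p :: "('x::finite \<times> 's1::finite \<times> 's2::finite) pmf"
    and pv1 :: "'s1 \<Rightarrow> 'v1::finite pmf" and pv2 :: "'s2 \<Rightarrow> 'v2::finite pmf"
    and pu :: "('x \<times> 's1) \<times> ('v1 \<times> 'v2) \<Rightarrow> 'u::finite pmf"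
    and \<psi> :: "'u \<Rightarrow> 's2 \<times> ('v1 \<times> 'v2) \<Rightarrow> 'y" and d :: "'x \<Rightarrow> 'y \<Rightarrow> real"
  assumes d: "\<And>x y. 0 \<le> d x y" "\<And>x y. d x y \<le> dm" and dm: "0 < dm"
    and r: "0 \<le> r1" "0 \<le> r2" "0 \<le> r3"
    and rate1: "excess_rate (channel_pmf p (\<lambda>z. pv2 (srcS2 z))) (srcS1 \<circ> fst) (\<lambda>(z, v). (srcS2 z, v)) pv1 < r1
       \<or> r1 = 0 \<and> excess_rate (channel_pmf p (\<lambda>z. pv2 (srcS2 z))) (srcS1 \<circ> fst) (\<lambda>(z, v). (srcS2 z, v)) pv1 = 0"
    and rate2: "excess_rate (channel_pmf p (\<lambda>z. pv1 (srcS1 z))) (srcS2 \<circ> fst) (\<lambda>(z, v). ((srcX z, srcS1 z), v)) pv2 < r2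
       \<or> r2 = 0 \<and> excess_rate (channel_pmf p (\<lambda>z. pv1 (srcS1 z))) (srcS2 \<circ> fst) (\<lambda>(z, v). ((srcX z, srcS1 z), v)) pv2 = 0"
    and rate3: "excess_rate (src_aux p pv1 pv2) enc_view dec_view pu < r3
       \<or> r3 = 0 \<and> excess_rate (src_aux p pv1 pv2) enc_view dec_view pu = 0"
    and D: "(\<integral>\<^sup>+t. \<integral>\<^sup>+u. ennreal (d (srcX (fst (fst t))) (\<psi> u (dec_view t))) \<partial>measure_pmf (pu (enc_view t))
        \<partial>measure_pmf (src_aux p pv1 pv2)) \<le> ennreal D" "0 \<le> D"
    and \<epsilon>: "0 < \<epsilon>"
  shows "\<forall>\<^sub>F m in sequentially. \<exists>fv1 fv2 f g. is_code p d m r3 r1 r2 (D + \<epsilon>) fv1 fv2 f g"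
proof -
  \<comment> \<open>Ten simulation errors, each of which can cost the maximal distortion
    \<open>dm\<close>.\<close>
  define e where "e = \<epsilon> / (10 * dm)"
  have e: "0 < e" using dm \<epsilon> by (simp add: e_def)
  show ?thesis
    using eventually_simulates[OF r(1) rate1 e] eventually_simulates[OF r(2) rate2 e]
      eventually_simulates[OF r(3) rate3 e] eventually_gt_at_top[of 0]
  proof eventually_elim
    case (elim m)
    let ?Z = "replicate_pmf m p"
    from elim obtain \<Omega>1 \<Omega>2 \<Omega>3 where
      sim1: "simulates (replicate_pmf m (channel_pmf p (\<lambda>z. pv2 (srcS2 z)))) (map (srcS1 \<circ> fst)) (map (\<lambda>(z, v). (srcS2 z, v)))
         (\<lambda>as. list_pmf (map pv1 as)) e (nat \<lfloor>2 powr (real m * r1)\<rfloor>) \<Omega>1" and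
      sim2: "simulates (replicate_pmf m (channel_pmf p (\<lambda>z. pv1 (srcS1 z)))) (map (srcS2 \<circ> fst)) (map (\<lambda>(z, v). ((srcX z, srcS1 z), v)))
         (\<lambda>as. list_pmf (map pv2 as)) e (nat \<lfloor>2 powr (real m * r2)\<rfloor>) \<Omega>2" and
      sim3: "simulates (replicate_pmf m (src_aux p pv1 pv2)) (map enc_view) (map dec_view)
         (\<lambda>as. list_pmf (map pu as)) e (nat \<lfloor>2 powr (real m * r3)\<rfloor>) \<Omega>3" by blast
    define ea where "ea zs v1 v2 = zip (zip (map srcX zs) (map srcS1 zs)) (zip v1 v2)"
      for zs :: "('x \<times> 's1 \<times> 's2) list" and v1 :: "'v1 list" and v2 :: "'v2 list"
    define db where "db zs v1 v2 = zip (map srcS2 zs) (zip v1 v2)"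
      for zs :: "('x \<times> 's1 \<times> 's2) list" and v1 :: "'v1 list" and v2 :: "'v2 list"
    define rec where "rec us bs = map (\<lambda>i. \<psi> (us ! i) (bs ! i)) [0..<m]" for us bs
    \<comment> \<open>Division by \<open>dm\<close> brings the distortion into [0, 1], as the
      composition demands.\<close>
    define C where "C zs v1 v2 us = ennreal (avg_distortion d m (map srcX zs) (rec us (db zs v1 v2)) / dm)" for zs v1 v2 us
    \<comment> \<open>The \<open>F\<close> maps select a word at the party that owns it; the
      \<open>G\<close> maps decode it at the other party from the message and that party's own
      blocks.\<close>
    define F1 where "F1 \<omega> zs = fst \<omega> (map srcS1 zs)" for \<omega> :: "('s1 list \<Rightarrow> 'v1 list) \<times> ('s1 list \<Rightarrow> nat) \<times> (('s2 \<times> 'v2) list \<Rightarrow> nat \<Rightarrow> 'v1 list)" and zs :: "('x \<times> 's1 \<times> 's2) list"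
    define F2 where "F2 \<omega> zs = fst \<omega> (map srcS2 zs)" for \<omega> :: "('s2 list \<Rightarrow> 'v2 list) \<times> ('s2 list \<Rightarrow> nat) \<times> ((('x \<times> 's1) \<times> 'v1) list \<Rightarrow> nat \<Rightarrow> 'v2 list)" and zs :: "('x \<times> 's1 \<times> 's2) list"
    define F3 where "F3 \<omega> zs v1 v2 = fst \<omega> (ea zs v1 v2)" for \<omega> :: "((('x \<times> 's1) \<times> 'v1 \<times> 'v2) list \<Rightarrow> 'u list) \<times> ((('x \<times> 's1) \<times> 'v1 \<times> 'v2) list \<Rightarrow> nat) \<times> (('s2 \<times> 'v1 \<times> 'v2) list \<Rightarrow> nat \<Rightarrow> 'u list)" and zs v1 v2
    define G1 where "G1 \<omega> zs v2 = snd (snd \<omega>) (zip (map srcS2 zs) v2) (fst (snd \<omega>) (map srcS1 zs))" for \<omega> :: "('s1 list \<Rightarrow> 'v1 list) \<times> ('s1 list \<Rightarrow> nat) \<times> (('s2 \<times> 'v2) list \<Rightarrow> nat \<Rightarrow> 'v1 list)" and zs :: "('x \<times> 's1 \<times> 's2) list" and v2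
    define G2 where "G2 \<omega> zs v1 = snd (snd \<omega>) (zip (zip (map srcX zs) (map srcS1 zs)) v1) (fst (snd \<omega>) (map srcS2 zs))" for \<omega> :: "('s2 list \<Rightarrow> 'v2 list) \<times> ('s2 list \<Rightarrow> nat) \<times> ((('x \<times> 's1) \<times> 'v1) list \<Rightarrow> nat \<Rightarrow> 'v2 list)" and zs :: "('x \<times> 's1 \<times> 's2) list" and v1
    define G3 where "G3 \<omega> zs v1 v2 v1' v2' = snd (snd \<omega>) (db zs v1 v2) (fst (snd \<omega>) (ea zs v1' v2'))" for \<omega> :: "((('x \<times> 's1) \<times> 'v1 \<times> 'v2) list \<Rightarrow> 'u list) \<times> ((('x \<times> 's1) \<times> 'v1 \<times> 'v2) list \<Rightarrow> nat) \<times> (('s2 \<times> 'v1 \<times> 'v2) list \<Rightarrow> nat \<Rightarrow> 'u list)" and zs v1 v2 v1' v2'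
    have zip_maps: "zip (map srcX zs) (map srcS1 zs) = map (\<lambda>z. (srcX z, srcS1 z)) zs" for zs :: "('x \<times> 's1 \<times> 's2) list"
      by (induction zs) auto
    have views: "map enc_view t = ea (map fst (map fst t)) (map snd (map fst t)) (map snd t)"
        "map dec_view t = db (map fst (map fst t)) (map snd (map fst t)) (map snd t)" for t
      unfolding ea_def db_def by (rule map_views)+
    have bound: "(\<integral>\<^sup>+o1. \<integral>\<^sup>+o2. \<integral>\<^sup>+o3. \<integral>\<^sup>+zs. C zs (G1 o1 zs (F2 o2 zs)) (F2 o2 zs)
        (G3 o3 zs (G1 o1 zs (F2 o2 zs)) (F2 o2 zs) (F1 o1 zs) (G2 o2 zs (F1 o1 zs))) \<partial>?Z \<partial>\<Omega>3 \<partial>\<Omega>2 \<partial>\<Omega>1)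
      \<le> (\<integral>\<^sup>+zs. \<integral>\<^sup>+v1. \<integral>\<^sup>+v2. \<integral>\<^sup>+us. C zs v1 v2 us \<partial>list_pmf (map pu (ea zs v1 v2)) \<partial>list_pmf (map pv2 (map srcS2 zs))
           \<partial>list_pmf (map pv1 (map srcS1 zs)) \<partial>?Z) + 10 * ennreal e"
    proof (rule compose_simulations)
      show "(\<integral>\<^sup>+o1. \<integral>\<^sup>+zs. h zs (F1 o1 zs) \<partial>?Z \<partial>\<Omega>1) \<le> (\<integral>\<^sup>+zs. \<integral>\<^sup>+v. h zs v \<partial>list_pmf (map pv1 (map srcS1 zs)) \<partial>?Z) + ennreal e"
        if "\<And>zs v. h zs v \<le> 1" for h
        unfolding F1_def by (rule simulates_replicate_channelD(1)[OF sim1 that])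
      show "(\<integral>\<^sup>+o2. \<integral>\<^sup>+zs. h zs (F2 o2 zs) \<partial>?Z \<partial>\<Omega>2) \<le> (\<integral>\<^sup>+zs. \<integral>\<^sup>+v. h zs v \<partial>list_pmf (map pv2 (map srcS2 zs)) \<partial>?Z) + ennreal e"
        if "\<And>zs v. h zs v \<le> 1" for h
        unfolding F2_def by (rule simulates_replicate_channelD(1)[OF sim2 that])
      show "(\<integral>\<^sup>+o1. \<integral>\<^sup>+zs. \<integral>\<^sup>+v2. of_bool (G1 o1 zs v2 \<noteq> F1 o1 zs) \<partial>list_pmf (map pv2 (map srcS2 zs)) \<partial>?Z \<partial>\<Omega>1) \<le> ennreal e"
        using simulates_replicate_channelD(2)[OF sim1, of srcS2] by (simp add: F1_def G1_def o_def)
      show "(\<integral>\<^sup>+o2. \<integral>\<^sup>+zs. \<integral>\<^sup>+v1. of_bool (G2 o2 zs v1 \<noteq> F2 o2 zs) \<partial>list_pmf (map pv1 (map srcS1 zs)) \<partial>?Z \<partial>\<Omega>2) \<le> ennreal e"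
        using simulates_replicate_channelD(2)[OF sim2, of "\<lambda>z. (srcX z, srcS1 z)"] by (simp add: F2_def G2_def o_def zip_maps)
      show "(\<integral>\<^sup>+o3. \<integral>\<^sup>+zs. \<integral>\<^sup>+v1. \<integral>\<^sup>+v2. h zs v1 v2 (F3 o3 zs v1 v2) \<partial>list_pmf (map pv2 (map srcS2 zs))
            \<partial>list_pmf (map pv1 (map srcS1 zs)) \<partial>?Z \<partial>\<Omega>3)
         \<le> (\<integral>\<^sup>+zs. \<integral>\<^sup>+v1. \<integral>\<^sup>+v2. \<integral>\<^sup>+us. h zs v1 v2 us \<partial>list_pmf (map pu (ea zs v1 v2)) \<partial>list_pmf (map pv2 (map srcS2 zs))
            \<partial>list_pmf (map pv1 (map srcS1 zs)) \<partial>?Z) + ennreal e"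
        if "\<And>zs v1 v2 us. h zs v1 v2 us \<le> 1" for h
        using simulatesD(2)[OF sim3, of "\<lambda>t. h (map fst (map fst t)) (map snd (map fst t)) (map snd t)"] that
        unfolding views F3_def nn_integral_replicate_src_aux by blast
      show "(\<integral>\<^sup>+o3. \<integral>\<^sup>+zs. \<integral>\<^sup>+v1. \<integral>\<^sup>+v2. of_bool (G3 o3 zs v1 v2 v1 v2 \<noteq> F3 o3 zs v1 v2) \<partial>list_pmf (map pv2 (map srcS2 zs))
            \<partial>list_pmf (map pv1 (map srcS1 zs)) \<partial>?Z \<partial>\<Omega>3) \<le> ennreal e"
        using simulatesD(3)[OF sim3] unfolding views F3_def G3_def nn_integral_replicate_src_aux .
      show "C zs v1 v2 us \<le> 1" for zs v1 v2 us
        using avg_distortion_bounds(2)[of m d dm "map srcX zs" "rec us (db zs v1 v2)", OF elim(4) d] dm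
        by (simp add: C_def divide_le_eq)
    qed
    \<comment> \<open>Under the exact laws the block is i.i.d., so the expected average distortion
      equals its single-letter value for every block length.\<close>
    have "(\<integral>\<^sup>+zs. \<integral>\<^sup>+v1. \<integral>\<^sup>+v2. \<integral>\<^sup>+us. C zs v1 v2 us \<partial>list_pmf (map pu (ea zs v1 v2)) \<partial>list_pmf (map pv2 (map srcS2 zs))
           \<partial>list_pmf (map pv1 (map srcS1 zs)) \<partial>?Z)
       = (\<integral>\<^sup>+t. C (map fst (map fst (map fst t))) (map snd (map fst (map fst t))) (map snd (map fst t)) (map snd t)
           \<partial>replicate_pmf m (channel_pmf (src_aux p pv1 pv2) (\<lambda>t. pu (enc_view t))))"
      unfolding nn_integral_replicate_src_aux views[symmetric]
      by (subst nn_integral_replicate_channel[where h = "\<lambda>t us. C (map fst (map fst t)) (map snd (map fst t)) (map snd t) us"])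
         (simp add: o_def)
    also have "\<dots> = (\<integral>\<^sup>+t. ennreal (1 / (real m * dm)) * sum_list (map (\<lambda>t. ennreal (d (srcX (fst (fst (fst t)))) (\<psi> (snd t) (dec_view (fst t))))) t)
           \<partial>replicate_pmf m (channel_pmf (src_aux p pv1 pv2) (\<lambda>t. pu (enc_view t))))"
    proof (intro nn_integral_cong_AE AE_pmfI)
      fix t assume "t \<in> set_pmf (replicate_pmf m (channel_pmf (src_aux p pv1 pv2) (\<lambda>t. pu (enc_view t))))"
      then have len: "length t = m" by (rule length_replicate_pmf)
      have rec_t: "rec (map snd t) (map dec_view (map fst t)) = map (\<lambda>i. \<psi> (snd (t ! i)) (dec_view (fst (t ! i)))) [0..<m]"
        unfolding rec_def using len by (intro map_cong refl) auto
      have "avg_distortion d m (map srcX (map fst (map fst (map fst t)))) (rec (map snd t) (map dec_view (map fst t)))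
        = sum_list (map (\<lambda>t. d (srcX (fst (fst (fst t)))) (\<psi> (snd t) (dec_view (fst t)))) t) / m"
        unfolding rec_t using avg_distortion_eq_sum_list[OF len, of d "\<lambda>t. srcX (fst (fst (fst t)))"] by (simp add: o_def)
      then have "C (map fst (map fst (map fst t))) (map snd (map fst (map fst t))) (map snd (map fst t)) (map snd t)
        = ennreal (1 / (real m * dm) * sum_list (map (\<lambda>t. d (srcX (fst (fst (fst t)))) (\<psi> (snd t) (dec_view (fst t)))) t))"
        unfolding C_def views[symmetric] by simp
      also have "\<dots> = ennreal (1 / (real m * dm)) * sum_list (map (\<lambda>t. ennreal (d (srcX (fst (fst (fst t)))) (\<psi> (snd t) (dec_view (fst t))))) t)"
      proof -
        have "ennreal (sum_list (map g ts)) = sum_list (map (\<lambda>t. ennreal (g t)) ts)" if "\<And>t. 0 \<le> g t" for g :: "_ \<Rightarrow> real" and ts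
        proof -
          have nonneg: "0 \<le> sum_list (map g ts)" for ts by (intro sum_list_nonneg) (auto simp: that)
          show ?thesis by (induction ts) (simp_all add: nonneg that)
        qed
        then show ?thesis using d dm by (subst ennreal_mult) (auto intro!: sum_list_nonneg)
      qed
      finally show "C (map fst (map fst (map fst t))) (map snd (map fst (map fst t))) (map snd (map fst t)) (map snd t)
        = ennreal (1 / (real m * dm)) * sum_list (map (\<lambda>t. ennreal (d (srcX (fst (fst (fst t)))) (\<psi> (snd t) (dec_view (fst t))))) t)" .
    qed
    also have "\<dots> = ennreal (1 / (real m * dm)) * (of_nat m * (\<integral>\<^sup>+t. \<integral>\<^sup>+u. ennreal (d (srcX (fst (fst t))) (\<psi> u (dec_view t)))
         \<partial>pu (enc_view t) \<partial>src_aux p pv1 pv2))"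
      by (simp add: nn_integral_cmult nn_integral_sum_list_replicate_pmf nn_integral_channel_pmf)
    also have "\<dots> \<le> ennreal (1 / (real m * dm)) * (of_nat m * ennreal D)"
      by (intro mult_left_mono D) auto
    also have "\<dots> = ennreal (D / dm)"
      using elim(4) dm D(2) by (simp add: ennreal_of_nat_eq_real_of_nat flip: ennreal_mult)
    finally have "(\<integral>\<^sup>+o1. \<integral>\<^sup>+o2. \<integral>\<^sup>+o3. \<integral>\<^sup>+zs. C zs (G1 o1 zs (F2 o2 zs)) (F2 o2 zs)
        (G3 o3 zs (G1 o1 zs (F2 o2 zs)) (F2 o2 zs) (F1 o1 zs) (G2 o2 zs (F1 o1 zs))) \<partial>?Z \<partial>\<Omega>3 \<partial>\<Omega>2 \<partial>\<Omega>1)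
      \<le> ennreal (D / dm) + 10 * ennreal e"
      using bound by (meson add_right_mono order_trans)
    also have "\<dots> = ennreal ((D + \<epsilon>) / dm)"
    proof -
      have "10 * ennreal e = ennreal (10 * e)" using e by (subst ennreal_mult) auto
      then show ?thesis using e D(2) dm by (simp add: e_def add_divide_distrib flip: ennreal_plus)
    qed
    finally have total: "(\<integral>\<^sup>+o1. \<integral>\<^sup>+o2. \<integral>\<^sup>+o3. \<integral>\<^sup>+zs. C zs (G1 o1 zs (F2 o2 zs)) (F2 o2 zs)
        (G3 o3 zs (G1 o1 zs (F2 o2 zs)) (F2 o2 zs) (F1 o1 zs) (G2 o2 zs (F1 o1 zs))) \<partial>?Z \<partial>\<Omega>3 \<partial>\<Omega>2 \<partial>\<Omega>1)
      \<le> ennreal ((D + \<epsilon>) / dm)" .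
    \<comment> \<open>The three random codes are fixed one at a time, from the outermost integral
      inwards, with the same bound each time.\<close>
    obtain o1 where o1: "o1 \<in> set_pmf \<Omega>1" "(\<integral>\<^sup>+o2. \<integral>\<^sup>+o3. \<integral>\<^sup>+zs. C zs (G1 o1 zs (F2 o2 zs)) (F2 o2 zs)
        (G3 o3 zs (G1 o1 zs (F2 o2 zs)) (F2 o2 zs) (F1 o1 zs) (G2 o2 zs (F1 o1 zs))) \<partial>?Z \<partial>\<Omega>3 \<partial>\<Omega>2)
      \<le> ennreal ((D + \<epsilon>) / dm)"
      using nn_integral_pmf_witness[OF total] by auto
    obtain o2 where o2: "o2 \<in> set_pmf \<Omega>2" "(\<integral>\<^sup>+o3. \<integral>\<^sup>+zs. C zs (G1 o1 zs (F2 o2 zs)) (F2 o2 zs)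
        (G3 o3 zs (G1 o1 zs (F2 o2 zs)) (F2 o2 zs) (F1 o1 zs) (G2 o2 zs (F1 o1 zs))) \<partial>?Z \<partial>\<Omega>3)
      \<le> ennreal ((D + \<epsilon>) / dm)"
      using nn_integral_pmf_witness[OF o1(2)] by auto
    obtain o3 where o3: "o3 \<in> set_pmf \<Omega>3" "(\<integral>\<^sup>+zs. C zs (G1 o1 zs (F2 o2 zs)) (F2 o2 zs)
        (G3 o3 zs (G1 o1 zs (F2 o2 zs)) (F2 o2 zs) (F1 o1 zs) (G2 o2 zs (F1 o1 zs))) \<partial>?Z)
      \<le> ennreal ((D + \<epsilon>) / dm)"
      using nn_integral_pmf_witness[OF o2(2)] by auto
    define fv1 where "fv1 = fst (snd o1)"
    define fv2 where "fv2 s2 = fst (snd o2) s2" for s2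
    \<comment> \<open>The encoder knows S1 and therefore selects the V1 word itself. With it as side
      information it decodes the V2 word from the index \<open>j\<close>, and it sends the message
      of the U word selected from all of these.\<close>
    define f where "f = (\<lambda>(x, s1, j). fst (snd o3) (zip (zip x s1) (zip (fst o1 s1)
        (snd (snd o2) (zip (zip x s1) (fst o1 s1)) j))))"
    \<comment> \<open>The mirror image: the decoder selects the V2 word itself, decodes the V1 word
      from \<open>j1\<close>, then the U word from \<open>j\<close>, and reconstructs letter by
      letter.\<close>
    define g where "g = (\<lambda>(j, s2, j1). let v2 = fst o2 s2; bs = zip s2 (zip (snd (snd o1) (zip s2 v2) j1) v2)
        in rec (snd (snd o3) bs j) bs)"
    have "is_code p d m r3 r1 r2 (D + \<epsilon>) fv1 fv2 f g"
      unfolding is_code_def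
    proof (intro conjI)
      show "fv1 \<in> words m \<rightarrow> messages m r1" "fv2 \<in> words m \<rightarrow> messages m r2"
        unfolding messages_eq fv1_def fv2_def using simulatesD(1)[OF sim1 o1(1)] simulatesD(1)[OF sim2 o2(1)] by auto
      show "f \<in> words m \<times> words m \<times> messages m r2 \<rightarrow> messages m r3"
        unfolding messages_eq f_def using simulatesD(1)[OF sim3 o3(1)] by auto
      show "g \<in> messages m r3 \<times> words m \<times> messages m r1 \<rightarrow> words m"
        by (auto simp: g_def rec_def words_def Let_def)
      let ?A = "\<lambda>zs. avg_distortion d m (map srcX zs) (g (f (map srcX zs, map srcS1 zs, fv2 (map srcS2 zs)), map srcS2 zs, fv1 (map srcS1 zs)))"
      have CA: "C zs (G1 o1 zs (F2 o2 zs)) (F2 o2 zs)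
        (G3 o3 zs (G1 o1 zs (F2 o2 zs)) (F2 o2 zs) (F1 o1 zs) (G2 o2 zs (F1 o1 zs))) = ennreal (?A zs / dm)" for zs
        by (simp add: C_def G1_def G2_def G3_def F1_def F2_def ea_def db_def f_def g_def fv1_def fv2_def Let_def)
      have fin: "finite (set_pmf ?Z)" by (rule finite_set_replicate_pmf) simp
      have "ennreal (measure_pmf.expectation ?Z (\<lambda>zs. ?A zs / dm)) = (\<integral>\<^sup>+zs. ennreal (?A zs / dm) \<partial>?Z)"
        using dm by (intro nn_integral_eq_integral[symmetric] integrable_measure_pmf_finite fin AE_pmfI
            divide_nonneg_pos avg_distortion_bounds(1)[of m d dm] elim(4) d)
      also have "\<dots> \<le> ennreal ((D + \<epsilon>) / dm)" using o3(2) unfolding CA .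
      finally have "measure_pmf.expectation ?Z ?A / dm \<le> (D + \<epsilon>) / dm"
        using D(2) \<epsilon> dm by (subst (asm) ennreal_le_iff) auto
      then have "measure_pmf.expectation ?Z ?A \<le> D + \<epsilon>" using dm by (simp add: divide_le_cancel)
      then show "measure_pmf.expectation ?Z (\<lambda>z. let xs = map srcX z; s1s = map srcS1 z; s2s = map srcS2 z
          in avg_distortion d m xs (g (f (xs, s1s, fv2 s2s), s2s, fv1 s1s))) \<le> D + \<epsilon>"
        by (simp add: Let_def)
    qed
    then show ?case by blast
  qed
qed

section \<open>Achievability\<close>

lemma map_take_replicate_pmf: "map_pmf (take m) (replicate_pmf (m + k) p) = replicate_pmf m p"
proof -
  have "map_pmf (take m) (replicate_pmf (m + k) p) = replicate_pmf m p \<bind> (\<lambda>xs. return_pmf xs)"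
    unfolding replicate_pmf_distrib map_bind_pmf map_return_pmf
    by (intro bind_pmf_cong refl) (simp add: length_replicate_pmf)
  then show ?thesis by (simp add: bind_return_pmf')
qed

text \<open>Only the first \<open>m\<close> letters are coded. A longer block has larger message
  sets at the same rate, which makes room for a code of higher rate on the shorter block. The
  \<open>k\<close> remaining letters are reconstructed arbitrarily, at a cost of at most
  \<open>dm\<close> each.\<close>

lemma is_code_pad:
  fixes p :: "('x::finite \<times> 's1::finite \<times> 's2::finite) pmf" and d :: "'x \<Rightarrow> 'y \<Rightarrow> real"
  assumes code: "is_code p d m R R1 R2 D fv1 fv2 f g"
    and d: "\<And>x y. 0 \<le> d x y" "\<And>x y. d x y \<le> dm" and m: "0 < m"
    and n: "real m * R \<le> real (m + k) * R'" "real m * R1 \<le> real (m + k) * R1'" "real m * R2 \<le> real (m + k) * R2'"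
    and R': "0 \<le> R'"
  shows "\<exists>fv1 fv2 f g. is_code p d (m + k) R' R1' R2' (D + real k / real (m + k) * dm) fv1 fv2 f g"
proof -
  let ?n = "m + k"
  have sub: "messages m R \<subseteq> messages ?n R'" "messages m R1 \<subseteq> messages ?n R1'" "messages m R2 \<subseteq> messages ?n R2'"
  proof -
    have "messages m r \<subseteq> messages ?n r'" if "real m * r \<le> real ?n * r'" for r r'
    proof -
      have le: "2 powr (real m * r) \<le> (2::real) powr (real ?n * r')" using that by (intro powr_mono) auto
      show ?thesis unfolding messages_def by (intro Collect_mono) (blast intro: order_trans[OF _ le])
    qed
    then show "messages m R \<subseteq> messages ?n R'" "messages m R1 \<subseteq> messages ?n R1'" "messages m R2 \<subseteq> messages ?n R2'"
      using n by blast+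
  qed
  have one: "1 \<in> messages ?n R'"
    using R' by (simp add: messages_def ge_one_powr_ge_zero)
  define fv1' where "fv1' s = fv1 (take m s)" for s
  define fv2' where "fv2' s = fv2 (take m s)" for s
  \<comment> \<open>The maps must be defined on the larger message sets. Messages outside the old
    sets never occur in the code, so default values serve there; 1 is a message because R' is
    nonnegative.\<close>
  define f' where "f' = (\<lambda>(x, s1, j). if j \<in> messages m R2 then f (take m x, take m s1, j) else 1)"
  define g' where "g' = (\<lambda>(j, s2, j1). if j \<in> messages m R \<and> j1 \<in> messages m R1
      then g (j, take m s2, j1) @ replicate k undefined else replicate ?n undefined)"
  have fs: "fv1 \<in> words m \<rightarrow> messages m R1" "fv2 \<in> words m \<rightarrow> messages m R2"
      "f \<in> words m \<times> words m \<times> messages m R2 \<rightarrow> messages m R"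
      "g \<in> messages m R \<times> words m \<times> messages m R1 \<rightarrow> words m"
    using code by (simp_all add: is_code_def)
  let ?A = "\<lambda>z. avg_distortion d m (map srcX z) (g (f (map srcX z, map srcS1 z, fv2 (map srcS2 z)), map srcS2 z, fv1 (map srcS1 z)))"
  let ?A' = "\<lambda>z. avg_distortion d ?n (map srcX z) (g' (f' (map srcX z, map srcS1 z, fv2' (map srcS2 z)), map srcS2 z, fv1' (map srcS1 z)))"
  have le: "?A' z \<le> ?A (take m z) + real k / real ?n * dm" if z: "z \<in> set_pmf (replicate_pmf ?n p)" for z
  proof -
    let ?z = "take m z"
    have len: "length z = ?n" "length ?z = m" using length_replicate_pmf[OF z] by auto
    then have w: "map srcX ?z \<in> words m" "map srcS1 ?z \<in> words m" "map srcS2 ?z \<in> words m" by (auto simp: words_def)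
    define ys where "ys = g (f (map srcX ?z, map srcS1 ?z, fv2 (map srcS2 ?z)), map srcS2 ?z, fv1 (map srcS1 ?z))"
    have j: "fv1 (map srcS1 ?z) \<in> messages m R1" "fv2 (map srcS2 ?z) \<in> messages m R2"
      using fs w by auto
    then have jf: "f (map srcX ?z, map srcS1 ?z, fv2 (map srcS2 ?z)) \<in> messages m R" using fs w by auto
    then have "ys \<in> words m" unfolding ys_def using fs(4) w j by auto
    then have ys: "length ys = m" by (simp add: words_def)
    have "g' (f' (map srcX z, map srcS1 z, fv2' (map srcS2 z)), map srcS2 z, fv1' (map srcS1 z)) = ys @ replicate k undefined"
      using j jf by (simp add: f'_def g'_def fv1'_def fv2'_def ys_def take_map)
    then have A': "?A' z = (\<Sum>i<?n. d (map srcX z ! i) ((ys @ replicate k undefined) ! i)) / real ?n"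
      by (simp add: avg_distortion_def)
    have "(\<Sum>i<?n. d (map srcX z ! i) ((ys @ replicate k undefined) ! i))
      = (\<Sum>i<m. d (map srcX z ! i) ((ys @ replicate k undefined) ! i)) + (\<Sum>i=m..<?n. d (map srcX z ! i) ((ys @ replicate k undefined) ! i))"
      by (simp add: sum.atLeastLessThan_concat[of 0 m ?n, symmetric] flip: atLeast0LessThan)
    also have "(\<Sum>i<m. d (map srcX z ! i) ((ys @ replicate k undefined) ! i)) = real m * ?A ?z"
      unfolding ys_def[symmetric] using m len ys by (simp add: avg_distortion_def nth_append)
    also have "real m * ?A ?z + (\<Sum>i=m..<?n. d (map srcX z ! i) ((ys @ replicate k undefined) ! i)) \<le> real ?n * ?A ?z + real k * dm"
    proof (rule add_mono)
      show "real m * ?A ?z \<le> real ?n * ?A ?z"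
        by (intro mult_right_mono avg_distortion_bounds(1)[of m d dm] m d) auto
      show "(\<Sum>i=m..<?n. d (map srcX z ! i) ((ys @ replicate k undefined) ! i)) \<le> real k * dm"
        using sum_mono[of "{m..<?n}" "\<lambda>i. d (map srcX z ! i) ((ys @ replicate k undefined) ! i)" "\<lambda>_. dm"] d by simp
    qed
    finally have "?A' z \<le> (real ?n * ?A ?z + real k * dm) / real ?n"
      unfolding A' by (rule divide_right_mono) simp
    also have "\<dots> = ?A ?z + real k / real ?n * dm"
      using m by (subst add_divide_distrib) simp
    finally show ?thesis .
  qed
  have "is_code p d ?n R' R1' R2' (D + real k / real ?n * dm) fv1' fv2' f' g'"
    unfolding is_code_def
  proof (intro conjI)
    show "fv1' \<in> words ?n \<rightarrow> messages ?n R1'" "fv2' \<in> words ?n \<rightarrow> messages ?n R2'"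
      unfolding fv1'_def fv2'_def words_def mem_Collect_eq
      by (auto intro!: subsetD[OF sub(2)] subsetD[OF sub(3)] funcset_mem[OF fs(1)] funcset_mem[OF fs(2)] simp: words_def)
    show "f' \<in> words ?n \<times> words ?n \<times> messages ?n R2' \<rightarrow> messages ?n R'"
    proof
      fix t :: "'x list \<times> 's1 list \<times> nat"
      assume "t \<in> words ?n \<times> words ?n \<times> messages ?n R2'"
      then obtain x s1 j where t: "t = (x, s1, j)" "x \<in> words ?n" "s1 \<in> words ?n" by auto
      then have "f (take m x, take m s1, j) \<in> messages m R" if "j \<in> messages m R2"
        using that by (intro funcset_mem[OF fs(3)]) (auto simp: words_def)
      then show "f' t \<in> messages ?n R'" using sub(1) one t(1) by (auto simp: f'_def)
    qed
    show "g' \<in> messages ?n R' \<times> words ?n \<times> messages ?n R1' \<rightarrow> words ?n"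
    proof
      fix t :: "nat \<times> 's2 list \<times> nat"
      assume "t \<in> messages ?n R' \<times> words ?n \<times> messages ?n R1'"
      then obtain j s2 j1 where t: "t = (j, s2, j1)" "s2 \<in> words ?n" by auto
      then have "g (j, take m s2, j1) \<in> words m" if "j \<in> messages m R" "j1 \<in> messages m R1"
        using that by (intro funcset_mem[OF fs(4)]) (auto simp: words_def)
      then show "g' t \<in> words ?n" using t(1) by (auto simp: g'_def words_def)
    qed
    have fin: "finite (set_pmf (replicate_pmf ?n p))" by (rule finite_set_replicate_pmf) simp
    have "measure_pmf.expectation (replicate_pmf ?n p) ?A'
       \<le> measure_pmf.expectation (replicate_pmf ?n p) (\<lambda>z. ?A (take m z) + real k / real ?n * dm)"
      using le fin by (intro integral_mono_AE AE_pmfI integrable_measure_pmf_finite)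
    also have "\<dots> = measure_pmf.expectation (replicate_pmf ?n p) (\<lambda>z. ?A (take m z)) + real k / real ?n * dm"
      using fin by (subst Bochner_Integration.integral_add) (auto intro!: integrable_measure_pmf_finite)
    also have "measure_pmf.expectation (replicate_pmf ?n p) (\<lambda>z. ?A (take m z)) = measure_pmf.expectation (replicate_pmf m p) ?A"
      unfolding map_take_replicate_pmf[of m k p, symmetric] integral_map_pmf ..
    also have "measure_pmf.expectation (replicate_pmf m p) ?A + real k / real ?n * dm \<le> D + real k / real ?n * dm"
      using code unfolding is_code_def Let_def by simp
    finally show "measure_pmf.expectation (replicate_pmf ?n p) (\<lambda>z. let xs = map srcX z; s1s = map srcS1 z; s2s = map srcS2 z
        in avg_distortion d ?n xs (g' (f' (xs, s1s, fv2' s2s), s2s, fv1' s1s))) \<le> D + real k / real ?n * dm"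
      unfolding Let_def .
  qed
  then show ?thesis by blast
qed

lemma is_code_mono: "is_code p d n R R1 R2 D fv1 fv2 f g \<Longrightarrow> D \<le> D' \<Longrightarrow> is_code p d n R R1 R2 D' fv1 fv2 f g"
  unfolding is_code_def by linarith

section \<open>From admissible single-letter laws to codes\<close>

lemma cond_ent_inj: "inj g \<Longrightarrow> cond_ent q V (\<lambda>z. g (B z)) = cond_ent q V B"
  by (simp add: cond_ent_def posterior_def inj_eq)

text \<open>The channel laws to which the simulations refer are marginals of the joint law, with the
  reconstruction symbol summed out. The information differences of the theorem thereby become excess
  rates.\<close>

lemma joint_law_views:
  fixes p :: "('x::finite \<times> 's1::finite \<times> 's2::finite) pmf"
    and pv1 :: "'s1 \<Rightarrow> 'v1::finite pmf" and pv2 :: "'s2 \<Rightarrow> 'v2::finite pmf"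
    and pu :: "'x \<Rightarrow> 's1 \<Rightarrow> 'v1 \<Rightarrow> 'v2 \<Rightarrow> 'u::finite pmf" and py :: "'u \<Rightarrow> 's2 \<Rightarrow> 'v1 \<Rightarrow> 'v2 \<Rightarrow> 'y::finite pmf"
  defines "q \<equiv> joint_law p pv1 pv2 pu py"
  shows excess_rate_V1: "excess_rate (channel_pmf p (\<lambda>z. pv2 (srcS2 z))) (srcS1 \<circ> fst) (\<lambda>(z, v). (srcS2 z, v)) pv1
      = mutual_info q rv_V1 rv_S1 - mutual_info q rv_V1 (\<lambda>z. (rv_S2 z, rv_V2 z))" (is ?A)
    and excess_rate_V2: "excess_rate (channel_pmf p (\<lambda>z. pv1 (srcS1 z))) (srcS2 \<circ> fst) (\<lambda>(z, v). ((srcX z, srcS1 z), v)) pv2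
      = mutual_info q rv_V2 rv_S2 - mutual_info q rv_V2 (\<lambda>z. (rv_X z, rv_S1 z, rv_V1 z))" (is ?B)
    and excess_rate_U: "excess_rate (src_aux p pv1 pv2) enc_view dec_view (\<lambda>((x, s1), (v1, v2)). pu x s1 v1 v2) = rate_of q" (is ?C)
proof -
  define f1 where "f1 = (\<lambda>(x::'x, s1::'s1, s2::'s2, v1::'v1, v2::'v2, u::'u, y::'y). (((x, s1, s2), v2), v1))"
  define f2 where "f2 = (\<lambda>(x::'x, s1::'s1, s2::'s2, v1::'v1, v2::'v2, u::'u, y::'y). (((x, s1, s2), v1), v2))"
  define f3 where "f3 = (\<lambda>(x::'x, s1::'s1, s2::'s2, v1::'v1, v2::'v2, u::'u, y::'y). ((((x, s1, s2), v1), v2), u))"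
  \<comment> \<open>Here V1 is drawn after V2, contrary to \<open>joint_law\<close>. The order may
    be exchanged because the two are independent given the source.\<close>
  have m1: "channel_pmf (channel_pmf p (\<lambda>z. pv2 (srcS2 z))) (\<lambda>t. pv1 ((srcS1 \<circ> fst) t)) = map_pmf f1 q"
    unfolding q_def joint_law_def channel_pmf_def f1_def
    by (simp add: map_bind_pmf bind_assoc_pmf bind_return_pmf case_prod_unfold)
       (subst bind_commute_pmf, rule refl)
  have m2: "channel_pmf (channel_pmf p (\<lambda>z. pv1 (srcS1 z))) (\<lambda>t. pv2 ((srcS2 \<circ> fst) t)) = map_pmf f2 q"
    unfolding q_def joint_law_def channel_pmf_def f2_def
    by (simp add: map_bind_pmf bind_assoc_pmf bind_return_pmf case_prod_unfold)
  have m3: "channel_pmf (src_aux p pv1 pv2) (\<lambda>t. (\<lambda>((x, s1), (v1, v2)). pu x s1 v1 v2) (enc_view t)) = map_pmf f3 q"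
    unfolding q_def joint_law_def src_aux_def channel_pmf_def f3_def enc_view_def
    by (simp add: map_bind_pmf bind_assoc_pmf bind_return_pmf case_prod_unfold)
  have o: "snd \<circ> f1 = rv_V1" "(srcS1 \<circ> fst) \<circ> fst \<circ> f1 = rv_S1" "(\<lambda>(z, v). (srcS2 z, v)) \<circ> fst \<circ> f1 = (\<lambda>z. (rv_S2 z, rv_V2 z))"
      "snd \<circ> f2 = rv_V2" "(srcS2 \<circ> fst) \<circ> fst \<circ> f2 = rv_S2"
      "(\<lambda>(z, v). ((srcX z, srcS1 z), v)) \<circ> fst \<circ> f2 = (\<lambda>z. (\<lambda>(x, s1, v1). ((x, s1), v1)) (rv_X z, rv_S1 z, rv_V1 z))"
      "snd \<circ> f3 = rv_U" "enc_view \<circ> fst \<circ> f3 = (\<lambda>z. ((rv_X z, rv_S1 z), (rv_V1 z, rv_V2 z)))"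
      "dec_view \<circ> fst \<circ> f3 = (\<lambda>z. (rv_S2 z, (rv_V1 z, rv_V2 z)))"
    by (auto simp: fun_eq_iff f1_def f2_def f3_def enc_view_def dec_view_def rv_X_def rv_S1_def rv_S2_def rv_V1_def rv_V2_def rv_U_def)
  \<comment> \<open>Conditioning depends only on the partition induced by the conditioning variable,
    so regrouping the triple (X, S1, V1) leaves the conditional entropy unchanged.\<close>
  have inj: "inj (\<lambda>(x::'x, s1::'s1, v1::'v1). ((x, s1), v1))" by (auto simp: inj_def)
  show ?A unfolding excess_rate_def m1 cond_ent_map_pmf o mutual_info_diff ..
  show ?B unfolding excess_rate_def m2 cond_ent_map_pmf o mutual_info_diff cond_ent_inj[OF inj] ..
  show ?C unfolding excess_rate_def m3 cond_ent_map_pmf o rate_of_def cond_mutual_info_diff ..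
qed

text \<open>The reconstruction enters the distortion but none of the rates. A random table with
  independent entries drawn from \<open>py\<close> has the given expected distortion, so some fixed
  table is at least as good.\<close>

lemma derandomized_reconstruction:
  fixes p :: "('x::finite \<times> 's1::finite \<times> 's2::finite) pmf" and d :: "'x \<Rightarrow> 'y::finite \<Rightarrow> real"
    and pv1 :: "'s1 \<Rightarrow> 'v1::finite pmf" and pv2 :: "'s2 \<Rightarrow> 'v2::finite pmf"
    and pu :: "'x \<Rightarrow> 's1 \<Rightarrow> 'v1 \<Rightarrow> 'v2 \<Rightarrow> 'u::finite pmf" and py :: "'u \<Rightarrow> 's2 \<Rightarrow> 'v1 \<Rightarrow> 'v2 \<Rightarrow> 'y pmf"
  assumes d: "\<And>x y. 0 \<le> d x y"
    and D: "measure_pmf.expectation (joint_law p pv1 pv2 pu py) (\<lambda>z. d (rv_X z) (rv_Y z)) \<le> D"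
  shows "\<exists>\<psi>. (\<integral>\<^sup>+t. \<integral>\<^sup>+u. ennreal (d (srcX (fst (fst t))) (\<psi> u (dec_view t)))
        \<partial>measure_pmf ((\<lambda>((x, s1), (v1, v2)). pu x s1 v1 v2) (enc_view t)) \<partial>measure_pmf (src_aux p pv1 pv2)) \<le> ennreal D"
proof -
  let ?pu = "\<lambda>((x, s1), (v1, v2)). pu x s1 v1 v2"
  define \<Psi> where "\<Psi> = Pi_pmf (UNIV :: ('u \<times> 's2 \<times> 'v1 \<times> 'v2) set) undefined (\<lambda>(u, s2, v1, v2). py u s2 v1 v2)"
  have "(\<integral>\<^sup>+\<psi>. \<integral>\<^sup>+t. \<integral>\<^sup>+u. ennreal (d (srcX (fst (fst t))) (\<psi> (u, dec_view t)))
        \<partial>measure_pmf (?pu (enc_view t)) \<partial>measure_pmf (src_aux p pv1 pv2) \<partial>measure_pmf \<Psi>)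
    = (\<integral>\<^sup>+t. \<integral>\<^sup>+u. \<integral>\<^sup>+\<psi>. ennreal (d (srcX (fst (fst t))) (\<psi> (u, dec_view t)))
        \<partial>measure_pmf \<Psi> \<partial>measure_pmf (?pu (enc_view t)) \<partial>measure_pmf (src_aux p pv1 pv2))"
    by (simp only: nn_integral_commute_pmf[where A = \<Psi>])
  also have "\<dots> = (\<integral>\<^sup>+t. \<integral>\<^sup>+u. \<integral>\<^sup>+y. ennreal (d (srcX (fst (fst t))) y)
        \<partial>measure_pmf ((\<lambda>(u, s2, v1, v2). py u s2 v1 v2) (u, dec_view t)) \<partial>measure_pmf (?pu (enc_view t)) \<partial>measure_pmf (src_aux p pv1 pv2))"
    unfolding \<Psi>_def by (intro nn_integral_cong nn_integral_Pi_pmf_component) auto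
  also have "\<dots> = (\<integral>\<^sup>+z. ennreal (d (rv_X z) (rv_Y z)) \<partial>measure_pmf (joint_law p pv1 pv2 pu py))"
    by (simp add: joint_law_def src_aux_def channel_pmf_def case_prod_unfold rv_X_def rv_Y_def enc_view_def dec_view_def)
  also have "\<dots> = ennreal (measure_pmf.expectation (joint_law p pv1 pv2 pu py) (\<lambda>z. d (rv_X z) (rv_Y z)))"
    by (intro nn_integral_eq_integral) (auto simp: d)
  also have "\<dots> \<le> ennreal D" by (intro ennreal_leI D)
  finally obtain \<psi> where "(\<integral>\<^sup>+t. \<integral>\<^sup>+u. ennreal (d (srcX (fst (fst t))) (\<psi> (u, dec_view t)))
        \<partial>measure_pmf (?pu (enc_view t)) \<partial>measure_pmf (src_aux p pv1 pv2)) \<le> ennreal D"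
    using nn_integral_pmf_witness[of \<Psi>] by force
  then show ?thesis by (intro exI[of _ "\<lambda>u b. \<psi> (u, b)"])
qed

lemma achievable_above_rate_of:
  fixes p :: "('x::finite \<times> 's1::finite \<times> 's2::finite) pmf" and d :: "'x \<Rightarrow> 'y::finite \<Rightarrow> real"
    and q :: "('x, 's1, 's2, 'v1::finite, 'v2::finite, 'u::finite, 'y) outcome pmf"
  assumes d: "\<And>x y. 0 \<le> d x y" and R': "0 \<le> R1'" "0 \<le> R2'"
    and q: "q \<in> admissible_laws p d R1' R2' D" and R: "rate_of q < R"
  shows "achievable p d D R R1' R2'"
  unfolding achievable_def
proof (intro allI impI)
  fix \<epsilon> :: real assume \<epsilon>: "0 < \<epsilon>"
  obtain pv1 pv2 pu py where q_eq: "q = joint_law p pv1 pv2 pu py"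
    and R1': "mutual_info q rv_V1 rv_S1 - mutual_info q rv_V1 (\<lambda>z. (rv_S2 z, rv_V2 z)) \<le> R1'"
    and R2': "mutual_info q rv_V2 rv_S2 - mutual_info q rv_V2 (\<lambda>z. (rv_X z, rv_S1 z, rv_V1 z)) \<le> R2'"
    and D: "measure_pmf.expectation q (\<lambda>z. d (rv_X z) (rv_Y z)) \<le> D"
    using q by (auto simp: admissible_laws_def)
  \<comment> \<open>An admissible law exists only at nonnegative distortion levels; for such levels
    passing to extended nonnegative reals loses nothing.\<close>
  have D0: "0 \<le> D" using D by (rule order_trans[rotated]) (auto intro!: integral_nonneg_AE simp: d)
  \<comment> \<open>The added 1 keeps \<open>dm\<close> positive even if the distortion measure is
    identically 0, since it is divided by.\<close>
  define dm where "dm = Max (range (\<lambda>(x, y). d x y)) + 1"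
  have Max: "d x y \<le> Max (range (\<lambda>(x, y). d x y))" for x y
    by (rule Max_ge) (auto intro: rev_image_eqI[of "(x, y)"])
  have dm: "d x y \<le> dm" for x y using Max[of x y] by (simp add: dm_def)
  have dm0: "0 < dm" using Max[of undefined undefined] d[of undefined undefined] by (simp add: dm_def)
  \<comment> \<open>The uncoded fraction of the block will be at most 2 * \<delta>, so padding costs
    at most \<epsilon> / 2. The other half of \<epsilon> is left to the code.\<close>
  define \<delta> where "\<delta> = \<epsilon> / (4 * dm)"
  have \<delta>: "0 < \<delta>" using \<epsilon> dm0 by (simp add: \<delta>_def)
  \<comment> \<open>Scaling by 1 + \<delta> makes a weak inequality strict unless r = 0; then the
    excess rate is squeezed to 0 and the common-kernel case applies.\<close>
  have slack: "e < r * (1 + \<delta>) \<or> r * (1 + \<delta>) = 0 \<and> e = 0" if "0 \<le> e" "e \<le> r" for e r :: real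
    using that \<delta> by (cases "r = 0") (auto simp: distrib_left intro: le_less_trans)
  \<comment> \<open>\<open>rate_of q\<close> is an excess rate and hence nonnegative by Gibbs'
    inequality.\<close>
  have "0 \<le> R" using R excess_rate_nonneg[of "src_aux p pv1 pv2" enc_view dec_view "\<lambda>((x, s1), (v1, v2)). pu x s1 v1 v2"]
    unfolding excess_rate_U[of p pv1 pv2 pu py, folded q_eq] by linarith
  obtain \<psi> where \<psi>: "(\<integral>\<^sup>+t. \<integral>\<^sup>+u. ennreal (d (srcX (fst (fst t))) (\<psi> u (dec_view t)))
        \<partial>measure_pmf ((\<lambda>((x, s1), (v1, v2)). pu x s1 v1 v2) (enc_view t)) \<partial>measure_pmf (src_aux p pv1 pv2)) \<le> ennreal D"
    using derandomized_reconstruction[OF d D[unfolded q_eq]] by blast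
  have "\<forall>\<^sub>F m in sequentially. \<exists>fv1 fv2 f g. is_code p d m (R * (1 + \<delta>)) (R1' * (1 + \<delta>)) (R2' * (1 + \<delta>)) (D + \<epsilon> / 2) fv1 fv2 f g"
  proof (rule eventually_is_code[OF d dm dm0 _ _ _ slack slack slack \<psi> D0])
    show "excess_rate (channel_pmf p (\<lambda>z. pv2 (srcS2 z))) (srcS1 \<circ> fst) (\<lambda>(z, v). (srcS2 z, v)) pv1 \<le> R1'"
      unfolding excess_rate_V1[of p pv2 pv1 pu py, folded q_eq] by (rule R1')
    show "excess_rate (channel_pmf p (\<lambda>z. pv1 (srcS1 z))) (srcS2 \<circ> fst) (\<lambda>(z, v). ((srcX z, srcS1 z), v)) pv2 \<le> R2'"
      unfolding excess_rate_V2[of p pv1 pv2 pu py, folded q_eq] by (rule R2')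
    show "excess_rate (src_aux p pv1 pv2) enc_view dec_view (\<lambda>((x, s1), (v1, v2)). pu x s1 v1 v2) \<le> R"
      unfolding excess_rate_U[of p pv1 pv2 pu py, folded q_eq] using R by simp
  qed (use \<delta> \<epsilon> R' \<open>0 \<le> R\<close> in \<open>auto intro: excess_rate_nonneg\<close>)
  moreover have "\<forall>\<^sub>F m in sequentially. 1 / \<delta> \<le> real m" by real_asymp
  ultimately have "\<forall>\<^sub>F m in sequentially. 0 < m \<and> 1 / \<delta> \<le> real m \<and>
     (\<exists>fv1 fv2 f g. is_code p d m (R * (1 + \<delta>)) (R1' * (1 + \<delta>)) (R2' * (1 + \<delta>)) (D + \<epsilon> / 2) fv1 fv2 f g)"
    using eventually_gt_at_top[of 0] by eventually_elim blast
  then obtain m fv1 fv2 f g where m: "0 < m" "1 / \<delta> \<le> real m"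
    and code: "is_code p d m (R * (1 + \<delta>)) (R1' * (1 + \<delta>)) (R2' * (1 + \<delta>)) (D + \<epsilon> / 2) fv1 fv2 f g"
    by (auto dest!: eventually_happens)
  \<comment> \<open>Enough padding for m * (1 + \<delta>) \<le> m + k, so that the scaled rates fit
    into the original ones. The condition 1 / \<delta> \<le> m absorbs the rounding: k \<le>
    \<delta> * m + 1 \<le> 2 * \<delta> * m.\<close>
  define k where "k = nat \<lceil>\<delta> * m\<rceil>"
  have k: "\<delta> * m \<le> real k" "real k \<le> \<delta> * m + 1"
    using \<delta> by (auto simp: k_def real_nat_ceiling_ge)
  have scale: "real m * (r * (1 + \<delta>)) \<le> real (m + k) * r" if "0 \<le> r" for r
  proof -
    have "real m * (r * (1 + \<delta>)) = (real m + \<delta> * m) * r" by (simp add: algebra_simps)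
    also have "\<dots> \<le> real (m + k) * r" using k that by (intro mult_right_mono) auto
    finally show ?thesis .
  qed
  obtain fv1' fv2' f' g' where code': "is_code p d (m + k) R R1' R2' (D + \<epsilon> / 2 + real k / real (m + k) * dm) fv1' fv2' f' g'"
    using is_code_pad[OF code d dm m(1) scale scale scale] \<open>0 \<le> R\<close> R' by blast
  have "1 \<le> \<delta> * m" using m \<delta> by (simp add: field_simps)
  then have "real k \<le> 2 * \<delta> * real m" using k by simp
  also have "\<dots> \<le> 2 * \<delta> * real (m + k)" using \<delta> by simp
  finally have "real k \<le> 2 * \<delta> * real (m + k)" .
  then have "real k / real (m + k) \<le> 2 * \<delta>" using m by (simp add: divide_le_eq)
  then have "real k / real (m + k) * dm \<le> 2 * \<delta> * dm" using dm0 by (intro mult_right_mono) auto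
  also have "\<dots> = \<epsilon> / 2" using dm0 by (simp add: \<delta>_def)
  finally have "D + \<epsilon> / 2 + real k / real (m + k) * dm \<le> D + \<epsilon>" by linarith
  then have "is_code p d (m + k) R R1' R2' (D + \<epsilon>) fv1' fv2' f' g'"
    by (rule is_code_mono[OF code'])
  then show "\<exists>n\<ge>1. \<exists>fv1 fv2 f g. is_code p d n R R1' R2' (D + \<epsilon>) fv1 fv2 f g"
    using m(1) by (intro exI[of _ "m + k"]) auto
qed

text \<open>The bound holds for each admissible law separately, so the infimum covers the minimum;
  with no admissible law the right-hand side is infinite. Achievability is known strictly above
  \<open>rate_of q\<close>, hence the arbitrary slack \<open>e\<close>.\<close>

theorem fact2:
  fixes p :: "('x::finite \<times> 's1::finite \<times> 's2::finite) pmf"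
    and d :: "'x \<Rightarrow> 'y::finite \<Rightarrow> real"
    and D R1' R2' :: real
  assumes d_nonneg: "\<And>x y. 0 \<le> d x y"
    and R1'_nonneg: "0 \<le> R1'"
    and R2'_nonneg: "0 \<le> R2'"
  shows "R12_star p d R1' R2' D \<le>
    (INF q \<in> (admissible_laws p d R1' R2' D ::
        ('x, 's1, 's2, 'v1::finite, 'v2::finite, 'u::finite, 'y) outcome pmf set).
      ereal (rate_of q))"
proof (rule INF_greatest, rule ereal_le_epsilon2)
  fix q :: "('x, 's1, 's2, 'v1, 'v2, 'u, 'y) outcome pmf" and e :: real
  assume q: "q \<in> admissible_laws p d R1' R2' D" and e: "0 < e"
  have "achievable p d D (rate_of q + e) R1' R2'"
    using e by (intro achievable_above_rate_of[OF d_nonneg R1'_nonneg R2'_nonneg q]) simp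
  then have "R12_star p d R1' R2' D \<le> ereal (rate_of q + e)"
    unfolding R12_star_def by (intro Inf_lower) blast
  then show "R12_star p d R1' R2' D \<le> ereal (rate_of q) + ereal e" by simp
qed

end
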